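(* For $\ell\ge1$, the operator $P_\ell$ has no resonance and no eigenvalue on the real axis. For $\ell=0$, $P_0$ has no eigenvalue in $\mathbb R$ and no resonance in $\mathbb R\setminus\{0\}$. But $0$ is a simple resonance of $P_0$, and, for $z$ close to $0$, $$(P_0-z^2)^{-1}=\frac{i\gamma}{z}\,r\,\langle r,\cdot\rangle+H(z),$$ where $\gamma\in(0,+\infty)$ and $H(z)$ is a holomorphic (bounded) family of operators near $z=0$; this is an equality between operators from $L^2_{\rm comp}(\mathbb R)$ to $L^2_{\rm loc}(\mathbb R)$.
   Context: Fix $M>0$ and $\Lambda$ with $0<9M^2\Lambda<1$. Let $\alpha(r)=\big(1-\frac{2M}{r}-\frac13\Lambda r^2\big)^{1/2}$ and let $0<r_-<r_+$ be its two positive zeros. The Regge--Wheeler coordinate $x$ is a function of $r\in(r_-,r_+)$ with $x'(r)=\alpha(r)^{-2}$ (constant of integration fixed once and for all); it maps $(r_-,r_+)$ bijectively onto $\mathbb R$, and $r,\alpha$ are regarded as functions of $x\in\mathbb R$. For $\ell\in\{0,1,2,\dots\}$ let $$P_\ell=r^{-1}D_xr^2D_xr^{-1}+\alpha^2r^{-2}\ell(\ell+1),\qquad D_x=\tfrac1i\partial_x,$$ a self-adjoint operator on $L^2(\mathbb R,dx)$, with scalar product $\langle\cdot,\cdot\rangle$ (this is the restriction to the $\ell$-th spherical harmonics of the operator governing the wave equation in the De Sitter--Schwarzschild metric; the terms of order zero in $P_\ell$, once written as $D_x^2$ plus a potential, decay exponentially as $x\to\pm\infty$). The family $(P_\ell-\lambda^2)^{-1}:L^2_{\rm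 comp}(\mathbb R)\to L^2_{\rm loc}(\mathbb R)$ extends meromorphically from $\{\operatorname{Im}\lambda>0\}$ to $\mathbb C$ (known); the poles $\lambda$ of this extension are the resonances of $P_\ell$. *)

theory Defs
  imports "HOL-Analysis.Analysis"
begin

(* Elements of L^2 spaces are represented by Borel functions, and all
   identities between them are understood almost everywhere. *)

definition L2 :: "(real \<Rightarrow> complex) set" where
  "L2 = {f. f \<in> borel_measurable lborel \<and> integrable lborel (\<lambda>x. (cmod (f x))\<^sup>2)}"

definition L2_on :: "real \<Rightarrow> (real \<Rightarrow> complex) set" where
  "L2_on a = {f \<in> L2. AE x in lborel. x \<notin> {-a..a} \<longrightarrow> f x = 0}"

definition L2_comp :: "(real \<Rightarrow> complex) set" where
  "L2_comp = (\<Union>a. L2_on a)"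

definition L2_loc :: "(real \<Rightarrow> complex) set" where
  "L2_loc = {f. f \<in> borel_measurable lborel \<and>
     (\<forall>a. set_integrable lborel {-a..a} (\<lambda>x. (cmod (f x))\<^sup>2))}"

definition L2_norm :: "(real \<Rightarrow> complex) \<Rightarrow> real" where
  "L2_norm f = sqrt (LINT x|lborel. (cmod (f x))\<^sup>2)"

definition L2_seminorm :: "real \<Rightarrow> (real \<Rightarrow> complex) \<Rightarrow> real" where
  "L2_seminorm a f = sqrt (LINT x:{-a..a}|lborel. (cmod (f x))\<^sup>2)"

(* Linear in the second argument. It is also used as a duality pairing
   between L^2_loc and L^2_comp. *)
definition L2_inner :: "(real \<Rightarrow> complex) \<Rightarrow> (real \<Rightarrow> complex) \<Rightarrow> complex" where
  "L2_inner f g = (LINT x|lborel. cnj (f x) * g x)"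

type_synonym fun_op = "(real \<Rightarrow> complex) \<Rightarrow> (real \<Rightarrow> complex)"

(* Continuous linear operators from L^2_comp (inductive limit topology) to
   L^2_loc. Together, linearity and the bounds imply that A respects almost
   everywhere equality. *)
definition comp_loc_op :: "fun_op \<Rightarrow> bool" where
  "comp_loc_op A \<longleftrightarrow>
     (\<forall>f\<in>L2_comp. A f \<in> L2_loc) \<and>
     (\<forall>f\<in>L2_comp. \<forall>g\<in>L2_comp. \<forall>c d. AE x in lborel.
        A (\<lambda>y. c * f y + d * g y) x = c * A f x + d * A g x) \<and>
     (\<forall>a b. \<exists>C. \<forall>f\<in>L2_on a. L2_seminorm b (A f) \<le> C * L2_norm f)"

(* Complex differentiability in the operator norm from L^2([-a,a]) to
   L^2([-b,b]), for all a and b. *)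
definition holomorphic_family :: "(complex \<Rightarrow> fun_op) \<Rightarrow> complex set \<Rightarrow> bool" where
  "holomorphic_family H U \<longleftrightarrow>
     (\<forall>z\<in>U. comp_loc_op (H z)) \<and>
     (\<forall>z\<in>U. \<exists>D. comp_loc_op D \<and>
        (\<forall>a b. \<forall>e>0. \<exists>d>0. \<forall>w\<in>U. w \<noteq> z \<longrightarrow> dist w z < d \<longrightarrow>
           (\<forall>f\<in>L2_on a.
              L2_seminorm b (\<lambda>x. (H w f x - H z f x) / (w - z) - D f x) \<le> e * L2_norm f)))"

definition laurent_principal_part ::
    "(complex \<Rightarrow> fun_op) \<Rightarrow> complex \<Rightarrow> nat \<Rightarrow> (nat \<Rightarrow> fun_op) \<Rightarrow> bool" where
  "laurent_principal_part R z0 N A \<longleftrightarrow>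
     (\<forall>j\<in>{1..N}. comp_loc_op (A j)) \<and>
     (\<exists>e>0. \<exists>H. holomorphic_family H (ball z0 e) \<and>
        (\<forall>z\<in>ball z0 e - {z0}. \<forall>f\<in>L2_comp. AE x in lborel.
           R z f x = (\<Sum>j=1..N. A j f x / (z - z0) ^ j) + H z f x))"

definition meromorphic_family :: "(complex \<Rightarrow> fun_op) \<Rightarrow> bool" where
  "meromorphic_family R \<longleftrightarrow> (\<forall>z0. \<exists>N A. laurent_principal_part R z0 N A)"

definition family_pole_of_order :: "(complex \<Rightarrow> fun_op) \<Rightarrow> complex \<Rightarrow> nat \<Rightarrow> bool" where
  "family_pole_of_order R z0 N \<longleftrightarrow> N \<ge> 1 \<and>
     (\<exists>A. laurent_principal_part R z0 N A \<and> (\<exists>f\<in>L2_comp. \<not> (AE x in lborel. A N f x = 0)))"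

(* An unbounded operator P on L^2 is given by its graph: P u v means that
   u is in the domain and that its image is v. *)
type_synonym graph_op = "(real \<Rightarrow> complex) \<Rightarrow> (real \<Rightarrow> complex) \<Rightarrow> bool"

definition is_eigenvalue :: "graph_op \<Rightarrow> complex \<Rightarrow> bool" where
  "is_eigenvalue P \<mu> \<longleftrightarrow> (\<exists>u. P u (\<lambda>x. \<mu> * u x) \<and> \<not> (AE x in lborel. u x = 0))"

(* T is the bounded two-sided inverse of P - z; its linearity modulo null
   sets follows from that of P. *)
definition is_resolvent :: "graph_op \<Rightarrow> complex \<Rightarrow> fun_op \<Rightarrow> bool" where
  "is_resolvent P z T \<longleftrightarrow>
     (\<forall>f\<in>L2. P (T f) (\<lambda>x. f x + z * T f x)) \<and>
     (\<forall>u v. P u v \<longrightarrow> (AE x in lborel. T (\<lambda>y. v y - z * u y) x = u x)) \<and>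
     (\<exists>C. \<forall>f\<in>L2. L2_norm (T f) \<le> C * L2_norm f)"

definition meromorphic_resolvent_extension :: "graph_op \<Rightarrow> (complex \<Rightarrow> fun_op) \<Rightarrow> bool" where
  "meromorphic_resolvent_extension P R \<longleftrightarrow> meromorphic_family R \<and>
     (\<forall>z. Im z > 0 \<longrightarrow> (\<exists>T. is_resolvent P (z\<^sup>2) T \<and>
        (\<forall>f\<in>L2_comp. AE x in lborel. R z f x = T f x)))"

(* In the next two definitions R is the meromorphic extension of
   (P - z^2)^(-1) from the upper half plane. *)
definition is_resonance :: "(complex \<Rightarrow> fun_op) \<Rightarrow> complex \<Rightarrow> bool" where
  "is_resonance R z \<longleftrightarrow> (\<exists>N. family_pole_of_order R z N)"

definition is_simple_resonance :: "(complex \<Rightarrow> fun_op) \<Rightarrow> complex \<Rightarrow> bool" where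
  "is_simple_resonance R z \<longleftrightarrow> family_pole_of_order R z 1"

(* Up to a null set, f is locally absolutely continuous with derivative g. *)
definition weak_deriv :: "(real \<Rightarrow> complex) \<Rightarrow> (real \<Rightarrow> complex) \<Rightarrow> bool" where
  "weak_deriv f g \<longleftrightarrow>
     (\<forall>a b. set_integrable lborel {a..b} g) \<and>
     (\<exists>F. (AE x in lborel. f x = F x) \<and>
        (\<forall>a b. a \<le> b \<longrightarrow> F b - F a = (LINT x:{a..b}|lborel. g x)))"

(* g = D_x f with D_x = (1/i) d/dx *)
definition weak_Dx :: "(real \<Rightarrow> complex) \<Rightarrow> (real \<Rightarrow> complex) \<Rightarrow> bool" where
  "weak_Dx f g \<longleftrightarrow> weak_deriv f (\<lambda>x. \<i> * g x)"

definition alpha :: "real \<Rightarrow> real \<Rightarrow> real \<Rightarrow> real" where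
  "alpha M \<Lambda> \<rho> = sqrt (1 - 2 * M / \<rho> - \<Lambda> * \<rho>\<^sup>2 / 3)"

(* r^(-1) D_x r^2 D_x r^(-1) + a^2 r^(-2) l(l+1) on its maximal domain, with
   r and a functions of x. When r and 1/r are bounded and r has bounded first
   and second derivatives and a is bounded, this domain is H^2(R), and the
   operator is self-adjoint. *)
definition P_op :: "(real \<Rightarrow> real) \<Rightarrow> (real \<Rightarrow> real) \<Rightarrow> nat \<Rightarrow> graph_op" where
  "P_op r a l u v \<longleftrightarrow> u \<in> L2 \<and> v \<in> L2 \<and>
     (\<exists>w1 w2. weak_Dx (\<lambda>x. u x / of_real (r x)) w1 \<and>
        weak_Dx (\<lambda>x. of_real ((r x)\<^sup>2) * w1 x) w2 \<and>
        (AE x in lborel. v x = w2 x / of_real (r x)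
           + of_real ((a x)\<^sup>2 / (r x)\<^sup>2 * real (l * (l + 1))) * u x))"

end

(* The Laurent coefficients of R at a real point t are limits of (z - t)^j R(z) f along z = t + i eps,
   where R(z) f is the resolvent in L^2. If the coefficients of index greater than j vanish, then
   U = lim (z - t)^j R(z) f solves (P - t^2) U = 0, and it is outgoing: for z in the upper half plane
   an L^2 solution of the equation near +oo satisfies u' - i z u = o(|u|), with a bound that is
   uniform up to the real axis. So neither Jost solutions nor the lower half plane are needed.
   For t <> 0 the flux Im (cnj U U') is constant, while being outgoing at both ends gives it opposite
   signs, whence U = 0. For t = 0 the quantity r^2 phi' cnj phi, where U = r phi, increases and tends
   to 0 at both ends, so that phi is constant, and phi = 0 if l >= 1. For l = 0 the constant follows
   from the Wronskian of u with the zero energy solution r: its increment over [-x, x] is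
   eps^2 <r, u> - <r, f>, and it is about - eps rp u(x) and eps rm u(-x) at the ends.
   This gives gamma = 1 / (rp^2 + rm^2). *)

theory Submission
  imports Defs
begin

section \<open>Decay of square integrable solutions\<close>

text \<open>The topology of the Laurent expansion only gives convergence in L^2 on bounded
  intervals, whereas the outgoing bounds and the flux concern values of u and u' at single points.
  The equation closes this gap: a solution is fixed by two numbers, so almost everywhere
  convergence, used at two points, yields pointwise convergence of u and u' everywhere. Because
  dr/dx = \<alpha>^2, the weight r' majorizes the potential and, towards each end, the distance of r
  to its limit, while its tail integrals are differences of values of r. All estimates at infinity
  are therefore comparisons with r, and their constants do not see Im z. At t = 0 and l = 0 the
  limit state may be nonzero although the source has dropped out of its equation. Its size is
  recovered before the limit: the Wronskian identity is divided by \<epsilon>, which keeps the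
  source with the weight (i \<epsilon>)^j / \<epsilon>. The order of limits matters: first
  \<epsilon> to 0 at a fixed x, then x to infinity.\<close>

lemma norm_diff_le_of_deriv_bound:
  fixes f :: "real \<Rightarrow> 'a::real_normed_vector" and g :: "real \<Rightarrow> real"
  assumes "x \<le> y"
    and f: "\<And>s. x \<le> s \<Longrightarrow> s \<le> y \<Longrightarrow> (f has_vector_derivative f' s) (at s)"
    and g: "\<And>s. x \<le> s \<Longrightarrow> s \<le> y \<Longrightarrow> (g has_real_derivative g' s) (at s)"
    and le: "\<And>s. x \<le> s \<Longrightarrow> s \<le> y \<Longrightarrow> norm (f' s) \<le> g' s"
  shows "norm (f y - f x) \<le> g y - g x"
proof (cases "x = y")
  case False
  then have "x < y" using \<open>x \<le> y\<close> by simp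
  moreover have "continuous_on {x..y} f"
    using f by (intro continuous_at_imp_continuous_on ballI has_vector_derivative_continuous) auto
  moreover have "continuous_on {x..y} g"
    using g by (intro continuous_at_imp_continuous_on ballI DERIV_isCont) auto
  ultimately show ?thesis
    using f g le
    by (intro differentiable_bound_general[where f' = f' and \<phi>' = g'])
       (auto simp: has_real_derivative_iff_has_vector_derivative)
qed auto

lemma has_vector_derivative_cmod_power2:
  fixes u :: "real \<Rightarrow> complex"
  assumes "(u has_vector_derivative u') (at x)"
  shows "((\<lambda>x. (cmod (u x))\<^sup>2) has_real_derivative 2 * Re (cnj (u x) * u')) (at x)"
proof -
  have "((\<lambda>x. Re (cnj (u x) * u x)) has_real_derivative Re (cnj (u x) * u' + cnj u' * u x)) (at x)"
    by (rule has_field_derivative_Re) (auto intro!: derivative_eq_intros assms)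
  moreover have "Re (cnj (u x) * u x) = (cmod (u x))\<^sup>2" for x
    by (metis complex_norm_square mult.commute Re_complex_of_real)
  moreover have "Re (cnj (u x) * u' + cnj u' * u x) = 2 * Re (cnj (u x) * u')"
    by simp
  ultimately show ?thesis by (simp add: mult.commute)
qed

text \<open>The function \<^term>\<open>h = (\<lambda>x. (cmod (u x))\<^sup>2)\<close> is almost convex: \<open>h'' \<ge> - 2 \<beta> h\<close>, so that
  \<open>h'\<close> is bounded above when \<open>h\<close> has a bounded antiderivative.\<close>
lemma second_order_decay:
  fixes u du B :: "real \<Rightarrow> complex"
  assumes u: "\<And>x. x \<ge> A \<Longrightarrow> (u has_vector_derivative du x) (at x)"
    and du: "\<And>x. x \<ge> A \<Longrightarrow> (du has_vector_derivative B x * u x) (at x)"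
    and B: "\<And>x. x \<ge> A \<Longrightarrow> cmod (B x) \<le> \<beta>"
    and H: "\<And>x. x \<ge> A \<Longrightarrow> (H has_real_derivative (cmod (u x))\<^sup>2) (at x)"
    and Hb: "\<And>x. x \<ge> A \<Longrightarrow> \<bar>H x\<bar> \<le> I"
  shows "(u \<longlongrightarrow> 0) at_top" and "(du \<longlongrightarrow> 0) at_top"
proof -
  define h where "h = (\<lambda>x. (cmod (u x))\<^sup>2)"
  define h1 where "h1 = (\<lambda>x. 2 * Re (cnj (u x) * du x))"
  have \<beta>: "\<beta> \<ge> 0" using B[of A] norm_ge_zero order_trans by blast
  have H': "(H has_real_derivative h x) (at x)" if "x \<ge> A" for x
    using H[OF that] by (simp add: h_def)
  have h': "(h has_real_derivative h1 x) (at x)" if "x \<ge> A" for x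
    unfolding h_def h1_def using has_vector_derivative_cmod_power2[OF u[OF that]] .
  have h0: "h x \<ge> 0" for x by (simp add: h_def)
  have h1': "(h1 has_real_derivative 2 * (cmod (du x))\<^sup>2 + 2 * Re (B x) * h x) (at x)" if "x \<ge> A" for x
  proof -
    have "((\<lambda>x. Re (cnj (u x) * du x)) has_real_derivative
        Re (cnj (u x) * (B x * u x) + cnj (du x) * du x)) (at x)"
      by (rule has_field_derivative_Re) (auto intro!: derivative_eq_intros u du that)
    then have "((\<lambda>x. 2 * Re (cnj (u x) * du x)) has_real_derivative
        2 * Re (cnj (u x) * (B x * u x) + cnj (du x) * du x)) (at x)"
      by (rule DERIV_cmult)
    moreover have "2 * Re (cnj (u x) * (B x * u x) + cnj (du x) * du x)
        = 2 * (cmod (du x))\<^sup>2 + 2 * Re (B x) * h x"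
      unfolding h_def cmod_power2 by (simp add: algebra_simps power2_eq_square)
    ultimately show ?thesis by (simp only: h1_def)
  qed
  have Hmono: "H x \<le> H y" if "A \<le> x" "x \<le> y" for x y
    using that H' h0 by (intro DERIV_nonneg_imp_nondecreasing[of x y H]) (meson order_trans)+
  \<comment> \<open>\<open>h1 + 2 * \<beta> * H\<close> is nondecreasing, and \<open>H\<close>
    varies by at most \<open>2 * I\<close>; this is the loss \<open>4 * \<beta> * I\<close>.\<close>
  have almost: "h1 x - 4 * \<beta> * I \<le> h1 y" if "A \<le> x" "x \<le> y" for x y
  proof -
    have "h1 x + 2 * \<beta> * H x \<le> h1 y + 2 * \<beta> * H y"
    proof (rule DERIV_nonneg_imp_nondecreasing[OF that(2)])
      fix s assume s: "x \<le> s" "s \<le> y"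
      have "((\<lambda>s. h1 s + 2 * \<beta> * H s) has_real_derivative
          (2 * (cmod (du s))\<^sup>2 + 2 * Re (B s) * h s) + 2 * \<beta> * h s) (at s)"
        using s that by (auto intro!: derivative_eq_intros h1' H')
      moreover have "- \<beta> \<le> Re (B s)"
        using B[of s] abs_Re_le_cmod[of "B s"] s that by linarith
      then have "0 \<le> (Re (B s) + \<beta>) * h s"
        using h0 by (intro mult_nonneg_nonneg) auto
      then have "0 \<le> 2 * (cmod (du s))\<^sup>2 + 2 * ((Re (B s) + \<beta>) * h s)" by simp
      then have "0 \<le> (2 * (cmod (du s))\<^sup>2 + 2 * Re (B s) * h s) + 2 * \<beta> * h s"
        by (simp add: algebra_simps)
      ultimately show "\<exists>y. ((\<lambda>s. h1 s + 2 * \<beta> * H s) has_real_derivative y) (at s) \<and> 0 \<le> y" by blast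
    qed
    moreover have "\<beta> * H y \<le> \<beta> * I" "\<beta> * (- I) \<le> \<beta> * H x"
      using Hb[of x] Hb[of y] that \<beta> by (intro mult_left_mono; fastforce)+
    ultimately show ?thesis by (simp add: algebra_simps)
  qed
  define M where "M = 4 * \<beta> * I + 1"
  have I: "I \<ge> 0" using Hb[of A] by auto
  have M: "M \<ge> 1" using \<beta> I by (simp add: M_def)
  \<comment> \<open>Above \<open>M\<close> the slope would stay at least 1 forever, so
    \<open>h\<close> would reach 1 after one unit and \<open>H\<close> would gain
    \<open>1 + 2 * I\<close> up to \<open>y\<close>, more than its bound allows.\<close>
  have h1le: "h1 x \<le> M" if x: "x \<ge> A" for x
  proof (rule ccontr)
    assume "\<not> h1 x \<le> M"
    then have ge: "h1 y \<ge> 1" if "y \<ge> x" for y using almost[OF x that] by (simp add: M_def)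
    have h_ge: "h y \<ge> 1" if y: "y \<ge> x + 1" for y
    proof -
      have "h x - x \<le> h y - y"
        using y ge x
        by (intro DERIV_nonneg_imp_nondecreasing[of x y "\<lambda>s. h s - s"] exI[of _ "h1 _ - 1"] conjI)
           (auto intro!: derivative_eq_intros h')
      then show ?thesis using y h0[of x] by linarith
    qed
    define y where "y = x + 2 + 2 * I"
    have "H (x + 1) - (x + 1) \<le> H y - y"
      using h_ge x I
      by (intro DERIV_nonneg_imp_nondecreasing[of "x+1" y "\<lambda>s. H s - s"] exI[of _ "h _ - 1"] conjI)
         (auto intro!: derivative_eq_intros H' simp: y_def)
    moreover have "\<bar>H (x+1)\<bar> \<le> I" "\<bar>H y\<bar> \<le> I" using x I by (auto intro!: Hb simp: y_def)
    ultimately show False by (simp add: y_def abs_if split: if_splits)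
  qed
  \<comment> \<open>An upper bound on the slope suffices: near its supremum \<open>H\<close> gains
    little over a window of length \<open>\<tau>\<close>, so \<open>h\<close> is at most
    \<open>e / 2\<close> somewhere in the window and can climb by at most
    \<open>M * \<tau> = e / 2\<close> before its end.\<close>
  have small: "\<exists>x0\<ge>A. \<forall>x\<ge>x0. h x \<le> e" if e: "e > 0" for e
  proof -
    define \<tau> where "\<tau> = e / (2 * M)"
    have \<tau>: "\<tau> > 0" "M * \<tau> = e / 2" using e M by (auto simp: \<tau>_def)
    define S where "S = Sup (H ` {A..})"
    have bdd: "bdd_above (H ` {A..})" using Hb by (intro bdd_aboveI[of _ I]) (auto simp: abs_le_iff)
    have "S - \<tau> * (e / 2) < Sup (H ` {A..})" using \<tau> e by (simp add: S_def)
    then obtain x0 where x0: "x0 \<ge> A" "H x0 > S - \<tau> * (e / 2)"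
      by (subst (asm) less_cSup_iff) (use bdd in auto)
    have "h x \<le> e" if x: "x \<ge> x0 + \<tau>" for x
    proof -
      obtain \<xi> where \<xi>: "x - \<tau> < \<xi>" "\<xi> < x" "H x - H (x - \<tau>) = (x - (x - \<tau>)) * h \<xi>"
        using MVT2[of "x - \<tau>" x H h] H' x x0 \<tau> by (auto simp: )
      have "H x \<le> S" unfolding S_def using x x0 \<tau> bdd by (intro cSup_upper) auto
      moreover have "H x0 \<le> H (x - \<tau>)" using x x0 by (intro Hmono) auto
      ultimately have "\<tau> * h \<xi> \<le> \<tau> * (e / 2)" using \<xi>(3) x0(2) by simp
      then have 1: "h \<xi> \<le> e / 2" using \<tau> by simp
      obtain \<zeta> where "\<xi> < \<zeta>" "\<zeta> < x" "h x - h \<xi> = (x - \<xi>) * h1 \<zeta>"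
        using MVT2[of \<xi> x h h1] h' x x0 \<tau> \<xi> by (auto simp: )
      moreover have "(x - \<xi>) * h1 \<zeta> \<le> \<tau> * M"
        using calculation \<xi> x x0 M h1le[of \<zeta>] by (intro order_trans[OF mult_left_mono[of "h1 \<zeta>" M] mult_right_mono]) auto
      ultimately show ?thesis using 1 \<tau>(2) by (simp add: mult.commute)
    qed
    then show ?thesis using x0(1) \<tau>(1) by (intro exI[of _ "x0 + \<tau>"]) auto
  qed
  have small_u: "\<exists>x0\<ge>A. \<forall>x\<ge>x0. cmod (u x) \<le> e" if e: "e > 0" for e
  proof -
    obtain x0 where "x0 \<ge> A" "\<And>x. x \<ge> x0 \<Longrightarrow> h x \<le> e\<^sup>2" using small[of "e\<^sup>2"] e by auto
    then show ?thesis using e by (intro exI[of _ x0]) (auto simp: h_def power2_le_iff_abs_le)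
  qed
  show "(u \<longlongrightarrow> 0) at_top"
    unfolding tendsto_iff eventually_at_top_linorder
  proof (intro allI impI)
    fix e :: real assume "e > 0"
    then obtain x0 where "\<forall>x\<ge>x0. cmod (u x) \<le> e / 2" using small_u[of "e/2"] by auto
    then show "\<exists>N. \<forall>n\<ge>N. dist (u n) 0 < e" using \<open>e > 0\<close> by (intro exI[of _ x0]) force
  qed
  show "(du \<longlongrightarrow> 0) at_top"
    unfolding tendsto_iff eventually_at_top_linorder
  proof (intro allI impI)
    fix e :: real assume e: "e > 0"
    \<comment> \<open>Chosen for the final count: two values of \<open>u\<close> cost
      \<open>\<eta>\<close> each and the second order remainder costs
      \<open>\<beta> * \<eta>\<close>, in total \<open>e / 2\<close>.\<close>
    define \<eta> where "\<eta> = e / (2 * (\<beta> + 2))"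
    have \<eta>: "\<eta> > 0" "(\<beta> + 2) * \<eta> = e / 2" using e \<beta> by (auto simp: \<eta>_def field_simps)
    obtain x0 where x0: "x0 \<ge> A" "\<And>x. x \<ge> x0 \<Longrightarrow> cmod (u x) \<le> \<eta>" using small_u[OF \<eta>(1)] by auto
    have "cmod (du x) < e" if x: "x \<ge> x0" for x
    proof -
      \<comment> \<open>On a unit interval \<open>du\<close> is nearly constant because its
        derivative \<open>B * u\<close> is small; so \<open>u (x+1) - u x\<close> approximates
        \<open>du x\<close>.\<close>
      have du_le: "cmod (du s - du x) \<le> \<beta> * \<eta>" if s: "x \<le> s" "s \<le> x + 1" for s
      proof -
        have "cmod (du s - du x) \<le> \<beta> * \<eta> * s - \<beta> * \<eta> * x"
        proof (rule norm_diff_le_of_deriv_bound[where f' = "\<lambda>s. B s * u s" and g' = "\<lambda>_. \<beta> * \<eta>"])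
          fix y assume "x \<le> y" "y \<le> s"
          then show "cmod (B y * u y) \<le> \<beta> * \<eta>"
            using x x0 B[of y] \<beta> by (auto simp: norm_mult intro!: mult_mono)
        qed (use x x0 s in \<open>auto intro!: derivative_eq_intros du\<close>)
        also have "\<dots> = \<beta> * \<eta> * (s - x)" by (simp add: algebra_simps)
        also have "\<dots> \<le> \<beta> * \<eta> * 1" using s \<beta> \<eta> by (intro mult_left_mono) auto
        finally show ?thesis by simp
      qed
      have "cmod ((u (x+1) - of_real (x+1) * du x) - (u x - of_real x * du x)) \<le> \<beta> * \<eta> * (x+1) - \<beta> * \<eta> * x"
        by (rule norm_diff_le_of_deriv_bound[where f' = "\<lambda>s. du s - du x" and g' = "\<lambda>_. \<beta> * \<eta>"
            and f = "\<lambda>s. u s - of_real s * du x"])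
           (use x x0 du_le in \<open>auto intro!: derivative_eq_intros u\<close>)
      then have 1: "cmod (u (x+1) - u x - du x) \<le> \<beta> * \<eta>" by (simp add: algebra_simps)
      have "du x = u (x+1) - u x - (u (x+1) - u x - du x)" by simp
      then have "cmod (du x) \<le> cmod (u (x+1)) + cmod (u x) + cmod (u (x+1) - u x - du x)"
        by (smt (verit) norm_triangle_ineq4)
      also have "\<dots> \<le> \<eta> + \<eta> + \<beta> * \<eta>" using 1 x0 x by (intro add_mono) auto
      also have "\<dots> = e / 2" using \<eta>(2) by (simp add: algebra_simps)
      finally show ?thesis using e by simp
    qed
    then show "\<exists>N. \<forall>n\<ge>N. dist (du n) 0 < e" by (intro exI[of _ x0]) auto
  qed
qed

section \<open>Outgoing solutions on a half-line\<close>

text \<open>The half-line \<open>[0, \<infinity>)\<close> with a short-range potential: \<open>d\<close> and its antiderivative up to the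
  constant \<open>C\<close> bound the first two tail integrals of \<^term>\<open>\<bar>W\<bar>\<close>.\<close>

locale half_line =
  fixes W d d1 :: "real \<Rightarrow> real" and C :: real
  assumes C: "C > 0"
    and d_deriv: "\<And>x. x \<ge> 0 \<Longrightarrow> (d has_real_derivative - d1 x) (at x)"
    and d_nonneg: "\<And>x. x \<ge> 0 \<Longrightarrow> d x \<ge> 0"
    and W_le: "\<And>x. x \<ge> 0 \<Longrightarrow> \<bar>W x\<bar> \<le> C * d1 x"
    and d_le: "\<And>x. x \<ge> 0 \<Longrightarrow> d x \<le> C * d1 x"
    and d_lim: "(d \<longlongrightarrow> 0) at_top"
begin

lemma d1_nonneg: "x \<ge> 0 \<Longrightarrow> d1 x \<ge> 0"
  using order_trans[OF abs_ge_zero W_le[of x]] C by (simp add: zero_le_mult_iff)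

text \<open>\<open>A\<close> marks a point beyond the support of the source, where the equation is
  homogeneous. \<open>A \<ge> 0\<close> places it where the bounds of the locale hold.\<close>

definition decaying_sol :: "complex \<Rightarrow> real \<Rightarrow> (real \<Rightarrow> complex) \<Rightarrow> (real \<Rightarrow> complex) \<Rightarrow> bool" where
  "decaying_sol z A u du \<longleftrightarrow> A \<ge> 0 \<and>
     (\<forall>x\<ge>A. (u has_vector_derivative du x) (at x) \<and>
             (du has_vector_derivative (of_real (W x) - z\<^sup>2) * u x) (at x)) \<and>
     (u \<longlongrightarrow> 0) at_top \<and> (du \<longlongrightarrow> 0) at_top"

text \<open>For \<open>z\<close> in the upper half plane a decaying solution is outgoing. With \<open>q = u' - i z u\<close>, the
  equation reads \<open>(exp (i z x) q)' = exp (i z x) W u\<close> and \<open>(exp (- i z x) u)' = exp (- i z x) q\<close>;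
  both are integrated from infinity, which gives bounds that do not degenerate when \<open>z\<close>
  approaches the real axis.\<close>

lemma outgoing_estimates:
  assumes sol: "decaying_sol z A u du" and z: "Im z > 0"
    and x: "x \<ge> A" and small: "C\<^sup>2 * d x \<le> 1 / 2"
  shows "\<And>y. y \<ge> x \<Longrightarrow> cmod (u y) \<le> 2 * cmod (u x)"
    and "\<And>y. y \<ge> x \<Longrightarrow> cmod (du y - \<i> * z * u y) \<le> 2 * C * d y * cmod (u x)"
proof -
  have A: "A \<ge> 0" and u': "\<And>s. s \<ge> A \<Longrightarrow> (u has_vector_derivative du s) (at s)"
    and du': "\<And>s. s \<ge> A \<Longrightarrow> (du has_vector_derivative (of_real (W s) - z\<^sup>2) * u s) (at s)"
    and u0: "(u \<longlongrightarrow> 0) at_top" and du0: "(du \<longlongrightarrow> 0) at_top"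
    using sol by (auto simp: decaying_sol_def)
  define \<epsilon> where "\<epsilon> = Im z"
  have \<epsilon>: "\<epsilon> > 0" using z by (simp add: \<epsilon>_def)
  define q where "q = (\<lambda>s. du s - \<i> * z * u s)"
  have q0: "(q \<longlongrightarrow> 0) at_top"
    unfolding q_def using tendsto_diff[OF du0 tendsto_mult_right_zero[OF u0]] by simp
  have q': "(q has_vector_derivative of_real (W s) * u s - \<i> * z * q s) (at s)" if "s \<ge> A" for s
    unfolding q_def using u'[OF that] du'[OF that]
    by (auto intro!: derivative_eq_intros simp: algebra_simps power2_eq_square)
  have cexp: "((\<lambda>s. exp (c * of_real s)) has_vector_derivative c * exp (c * of_real s)) (at s)" for c :: complex and s
    by (rule has_vector_derivative_real_field) (auto intro!: derivative_eq_intros)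
  \<comment> \<open>Absorption argument: \<open>S\<close> is finite because \<open>u\<close> tends
    to 0, and the two integrations lead to \<open>S \<le> cmod (u x) + S / 2\<close>.\<close>
  define S where "S = Sup ((\<lambda>y. cmod (u y)) ` {x..})"
  have bdd: "bdd_above ((\<lambda>y. cmod (u y)) ` {x..})"
  proof -
    obtain y0 where y0: "\<And>y. y \<ge> y0 \<Longrightarrow> cmod (u y) < 1"
      using tendstoD[OF u0, of 1] by (auto simp: eventually_at_top_linorder)
    have "continuous_on {x..max x y0} (\<lambda>y. cmod (u y))"
      using x u' by (intro continuous_on_norm continuous_at_imp_continuous_on ballI)
        (auto intro!: has_vector_derivative_continuous[OF u'])
    then have "bounded ((\<lambda>y. cmod (u y)) ` {x..max x y0})"
      by (intro compact_imp_bounded compact_continuous_image) auto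
    then obtain b where b: "\<And>y. x \<le> y \<Longrightarrow> y \<le> max x y0 \<Longrightarrow> cmod (u y) \<le> b"
      unfolding bounded_iff by (metis atLeastAtMost_iff imageI real_norm_def abs_norm_cancel)
    show ?thesis
    proof (rule bdd_aboveI2[of _ _ "max b 1"])
      fix y assume "y \<in> {x..}"
      then show "cmod (u y) \<le> max b 1" using b[of y] y0[of y] by (cases "y \<le> max x y0") (auto simp: le_max_iff_disj)
    qed
  qed
  have uS: "cmod (u y) \<le> S" if "y \<ge> x" for y
    unfolding S_def using that bdd by (intro cSup_upper) auto
  have S0: "S \<ge> 0" using uS[of x] norm_ge_zero[of "u x"] by linarith
  have qS: "cmod (q y) \<le> C * S * d y" if y: "y \<ge> x" for y
  proof -
    \<comment> \<open>The weight \<open>exp (- \<epsilon> * s)\<close> decreases, so beyond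
      \<open>y\<close> it is at most its value at \<open>y\<close>, and this value cancels against
      the weight of \<open>p y\<close>. No \<epsilon> is left in the bound.\<close>
    define p where "p = (\<lambda>s. exp (\<i> * z * of_real s) * q s)"
    have p': "(p has_vector_derivative exp (\<i> * z * of_real s) * (of_real (W s) * u s)) (at s)" if "s \<ge> A" for s
      unfolding p_def using has_vector_derivative_mult[OF cexp[of "\<i> * z" s] q'[OF that]] by (simp add: algebra_simps)
    have nexp: "cmod (exp (\<i> * z * of_real s)) = exp (- \<epsilon> * s)" for s by (simp add: \<epsilon>_def)
    have *: "cmod (p t - p y) \<le> exp (- \<epsilon> * y) * (C * S * d y)" if t: "t \<ge> y" for t
    proof -
      have "cmod (p t - p y) \<le> - (exp (- \<epsilon> * y) * C * S * d t) - - (exp (- \<epsilon> * y) * C * S * d y)"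
      proof (rule norm_diff_le_of_deriv_bound[OF t p'])
        fix s assume s: "y \<le> s" "s \<le> t"
        show "s \<ge> A" using s y x by simp
        show "((\<lambda>s. - (exp (- \<epsilon> * y) * C * S * d s)) has_real_derivative exp (- \<epsilon> * y) * C * S * d1 s) (at s)"
          using s y x A by (auto intro!: derivative_eq_intros d_deriv)
        have "cmod (exp (\<i> * z * of_real s) * (of_real (W s) * u s)) = exp (- \<epsilon> * s) * (\<bar>W s\<bar> * cmod (u s))"
          by (simp add: norm_mult \<epsilon>_def)
        also have "\<dots> \<le> exp (- \<epsilon> * y) * ((C * d1 s) * S)"
          using s y x A \<epsilon> C by (intro mult_mono W_le uS) (auto intro!: mult_nonneg_nonneg d1_nonneg)
        finally show "cmod (exp (\<i> * z * of_real s) * (of_real (W s) * u s)) \<le> exp (- \<epsilon> * y) * C * S * d1 s"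
          by (simp add: algebra_simps)
      qed
      also have "\<dots> \<le> exp (- \<epsilon> * y) * (C * S * d y)"
        using d_nonneg[of t] t y x A C S0 by simp
      finally show ?thesis .
    qed
    have "(p \<longlongrightarrow> 0) at_top"
    proof (rule Lim_null_comparison[OF _ tendsto_norm_zero[OF q0]])
      show "\<forall>\<^sub>F s in at_top. cmod (p s) \<le> cmod (q s)"
        using eventually_ge_at_top[of 0]
      proof eventually_elim
        case (elim s)
        then show ?case using \<epsilon> unfolding p_def norm_mult nexp by (intro mult_left_le_one_le) auto
      qed
    qed
    then have "((\<lambda>t. cmod (p t - p y)) \<longlongrightarrow> cmod (0 - p y)) at_top" by (intro tendsto_intros)
    then have "cmod (0 - p y) \<le> exp (- \<epsilon> * y) * (C * S * d y)"
      by (rule tendsto_upperbound) (use * in \<open>blast intro: eventually_at_top_linorderI[of y]\<close>, simp)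
    then show ?thesis by (simp add: p_def norm_mult \<epsilon>_def)
  qed
  have uy: "cmod (u y) \<le> cmod (u x) + S / 2" if y: "y \<ge> x" for y
  proof -
    \<comment> \<open>Here the weight \<open>exp (\<epsilon> * s)\<close> grows, so the integration
      runs forward from \<open>x\<close> to \<open>y\<close> and the weight cancels again at
      \<open>y\<close>. One factor \<open>C\<close> comes from \<open>qS\<close>, the other from
      \<open>d \<le> C * d1\<close>.\<close>
    define m where "m = (\<lambda>s. exp (- \<i> * z * of_real s) * u s)"
    have m': "(m has_vector_derivative exp (- \<i> * z * of_real s) * q s) (at s)" if "s \<ge> A" for s
      unfolding m_def q_def using has_vector_derivative_mult[OF cexp[of "- \<i> * z" s] u'[OF that]] by (simp add: algebra_simps)
    have "cmod (m y - m x) \<le> - (exp (\<epsilon> * y) * C * C * S * d y) - - (exp (\<epsilon> * y) * C * C * S * d x)"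
    proof (rule norm_diff_le_of_deriv_bound[OF y m'])
      fix s assume s: "x \<le> s" "s \<le> y"
      show "s \<ge> A" using s x by simp
      show "((\<lambda>s. - (exp (\<epsilon> * y) * C * C * S * d s)) has_real_derivative exp (\<epsilon> * y) * C * C * S * d1 s) (at s)"
        using s x A by (auto intro!: derivative_eq_intros d_deriv)
      have "cmod (exp (- \<i> * z * of_real s) * q s) = exp (\<epsilon> * s) * cmod (q s)"
        by (simp add: norm_mult \<epsilon>_def)
      also have "\<dots> \<le> exp (\<epsilon> * y) * (C * S * (C * d1 s))"
        using s x A \<epsilon> C S0 qS[of s] d_le[of s] d_nonneg[of s]
        by (intro mult_mono order_trans[OF qS mult_left_mono]) auto
      finally show "cmod (exp (- \<i> * z * of_real s) * q s) \<le> exp (\<epsilon> * y) * C * C * S * d1 s"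
        by (simp add: algebra_simps)
    qed
    also have "\<dots> \<le> exp (\<epsilon> * y) * (C\<^sup>2 * d x * S)"
      using d_nonneg[of y] y x A C S0 by (simp add: power2_eq_square)
    also have "\<dots> \<le> exp (\<epsilon> * y) * (1 / 2 * S)" using small S0 by (intro mult_left_mono mult_right_mono) auto
    finally have "cmod (m y) \<le> cmod (m x) + exp (\<epsilon> * y) * (S / 2)"
      using norm_triangle_ineq2[of "m y" "m x"] by simp
    also have "cmod (m x) \<le> exp (\<epsilon> * y) * cmod (u x)"
      using y \<epsilon> by (auto simp: m_def norm_mult \<epsilon>_def[symmetric] intro!: mult_right_mono)
    also have "cmod (m y) = exp (\<epsilon> * y) * cmod (u y)"
      by (simp add: m_def norm_mult \<epsilon>_def)
    finally have "exp (\<epsilon> * y) * cmod (u y) \<le> exp (\<epsilon> * y) * (cmod (u x) + S / 2)"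
      by (simp add: algebra_simps)
    then show ?thesis by simp
  qed
  have "S \<le> cmod (u x) + S / 2" unfolding S_def
    by (rule cSup_least) (use uy in \<open>auto simp: S_def\<close>)
  then have S2: "S \<le> 2 * cmod (u x)" by simp
  show "cmod (u y) \<le> 2 * cmod (u x)" if "y \<ge> x" for y using uS[OF that] S2 by simp
  show "cmod (du y - \<i> * z * u y) \<le> 2 * C * d y * cmod (u x)" if y: "y \<ge> x" for y
  proof -
    have "cmod (q y) \<le> C * S * d y" by (rule qS[OF y])
    also have "\<dots> \<le> C * (2 * cmod (u x)) * d y"
      using S2 S0 C d_nonneg[of y] y x A by (intro mult_mono) auto
    finally show ?thesis by (simp add: q_def algebra_simps)
  qed
qed

text \<open>The bounds are homogeneous in the solution and their constants contain no
  \<open>Im z\<close>, so they survive the rescaling by \<open>c n\<close> and the passage to a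
  possibly real \<open>z0\<close>.\<close>

lemma outgoing_estimates_limit:
  assumes sol: "\<And>n. decaying_sol (z n) A (u n) (du n)" and z: "\<And>n. Im (z n) > 0" "z \<longlonglongrightarrow> z0"
    and u: "\<And>x. (\<lambda>n. c n * u n x) \<longlonglongrightarrow> U x" and du: "\<And>x. (\<lambda>n. c n * du n x) \<longlonglongrightarrow> U1 x"
    and x: "x \<ge> A" and small: "C\<^sup>2 * d x \<le> 1 / 2" and y: "y \<ge> x"
  shows "cmod (U y) \<le> 2 * cmod (U x)" "cmod (U1 y - \<i> * z0 * U y) \<le> 2 * C * d y * cmod (U x)"
proof -
  note est = outgoing_estimates[OF sol z(1) x small y]
  have "cmod (c n * u n y) \<le> 2 * cmod (c n * u n x)" for n
    using mult_left_mono[OF est(1), of "cmod (c n)"] by (simp add: norm_mult algebra_simps)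
  then show "cmod (U y) \<le> 2 * cmod (U x)"
    by (intro tendsto_le[OF _ tendsto_mult_left[OF tendsto_norm[OF u]] tendsto_norm[OF u]]) auto
  have "cmod (c n * du n y - \<i> * z n * (c n * u n y)) \<le> 2 * C * d y * cmod (c n * u n x)" for n
  proof -
    have "c n * du n y - \<i> * z n * (c n * u n y) = c n * (du n y - \<i> * z n * u n y)"
      by (simp add: algebra_simps)
    then show ?thesis
      using mult_left_mono[OF est(2), of "cmod (c n)"] by (simp add: norm_mult mult_ac)
  qed
  moreover have "(\<lambda>n. cmod (c n * du n y - \<i> * z n * (c n * u n y))) \<longlonglongrightarrow> cmod (U1 y - \<i> * z0 * U y)"
    by (intro tendsto_intros u du z)
  ultimately show "cmod (U1 y - \<i> * z0 * U y) \<le> 2 * C * d y * cmod (U x)"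
    by (intro tendsto_le[OF _ tendsto_mult_left[OF tendsto_norm[OF u]]]) auto
qed

text \<open>Here \<open>W = \<rho>'' / \<rho>\<close>, so that \<open>\<rho>\<close> solves the equation at \<open>z = 0\<close>, and \<open>\<rho> u' - \<rho>' u\<close> is the
  Wronskian of \<open>\<rho>\<close> and \<open>u\<close>.\<close>

lemma zero_energy_flux:
  assumes sol: "decaying_sol (\<i> * of_real \<epsilon>) A u du" and \<epsilon>: "0 < \<epsilon>" "\<epsilon> \<le> 1"
    and x: "x \<ge> A" and small: "C\<^sup>2 * d x \<le> 1 / 2"
    and \<rho>: "\<And>s. s \<ge> 0 \<Longrightarrow> (\<rho> has_real_derivative \<rho>1 s) (at s)"
           "\<And>s. s \<ge> 0 \<Longrightarrow> (\<rho>1 has_real_derivative W s * \<rho> s) (at s)"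
    and \<rho>_lim: "\<And>s. s \<ge> 0 \<Longrightarrow> \<bar>\<rho> s - \<rho>inf\<bar> \<le> d s" "(\<rho>1 \<longlongrightarrow> 0) at_top" and inf: "\<rho>inf > 0"
  shows "cmod (of_real (\<rho> x) * du x - of_real (\<rho>1 x) * u x + of_real (\<epsilon> * \<rho>inf) * u x)
           \<le> \<epsilon> * ((2 + 2 * C * \<rho>inf) * C * d x * cmod (u x))"
proof -
  have A: "A \<ge> 0" and u': "\<And>s. s \<ge> A \<Longrightarrow> (u has_vector_derivative du s) (at s)"
    and du': "\<And>s. s \<ge> A \<Longrightarrow> (du has_vector_derivative (of_real (W s) + of_real (\<epsilon>\<^sup>2)) * u s) (at s)"
    and u0: "(u \<longlongrightarrow> 0) at_top" and du0: "(du \<longlongrightarrow> 0) at_top"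
    using sol by (auto simp: decaying_sol_def power_mult_distrib)
  note est = outgoing_estimates[OF sol _ x small, simplified, OF \<epsilon>(1)]
  \<comment> \<open>The correction \<open>\<epsilon> * \<rho>inf * u\<close> makes the Wronskian
    nearly stationary: \<open>du\<close> is close to \<open>- \<epsilon> * u\<close>, so in the
    derivative the main term \<epsilon>^2 \<rho>inf u cancels and only quantities controlled by
    \<open>d\<close> remain. \<open>J\<close> vanishes at infinity.\<close>
  define J where "J = (\<lambda>s. of_real (\<rho> s) * du s - of_real (\<rho>1 s) * u s + of_real (\<epsilon> * \<rho>inf) * u s)"
  define J1 where "J1 = (\<lambda>s. of_real (\<epsilon>\<^sup>2 * (\<rho> s - \<rho>inf)) * u s + of_real (\<epsilon> * \<rho>inf) * (du s + of_real \<epsilon> * u s))"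
  have J': "(J has_vector_derivative J1 s) (at s)" if s: "s \<ge> A" for s
  proof -
    have r: "((\<lambda>s. complex_of_real (\<rho> s)) has_vector_derivative of_real (\<rho>1 s)) (at s)"
      "((\<lambda>s. complex_of_real (\<rho>1 s)) has_vector_derivative of_real (W s * \<rho> s)) (at s)"
      using \<rho>[of s] s A
      by (auto intro!: has_vector_derivative_of_real simp: has_real_derivative_iff_has_vector_derivative
          simp del: of_real_mult)
    show ?thesis unfolding J_def J1_def
      by (rule derivative_eq_intros r u'[OF s] du'[OF s] refl)+
         (simp add: algebra_simps power2_eq_square)
  qed
  define k where "k = (2 + 2 * C * \<rho>inf) * C * cmod (u x)"
  have k: "k \<ge> 0" using C inf by (auto simp: k_def)
  have J1: "cmod (J1 s) \<le> \<epsilon> * k * d1 s" if s: "s \<ge> x" for s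
  proof -
    have s0: "s \<ge> 0" using s x A by simp
    have ds: "d s \<ge> 0" "d s \<le> C * d1 s" by (auto intro: d_nonneg[OF s0] d_le[OF s0])
    have "cmod (J1 s) \<le> cmod (of_real (\<epsilon>\<^sup>2 * (\<rho> s - \<rho>inf)) * u s) + cmod (of_real (\<epsilon> * \<rho>inf) * (du s + of_real \<epsilon> * u s))"
      unfolding J1_def by (rule norm_triangle_ineq)
    also have "\<dots> = \<epsilon>\<^sup>2 * \<bar>\<rho> s - \<rho>inf\<bar> * cmod (u s) + \<epsilon> * \<rho>inf * cmod (du s + of_real \<epsilon> * u s)"
      using \<epsilon> inf by (simp add: norm_mult abs_mult del: of_real_mult)
    also have "\<dots> \<le> \<epsilon> * d s * (2 * cmod (u x)) + \<epsilon> * \<rho>inf * (2 * C * d s * cmod (u x))"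
    \<comment> \<open>\<open>\<epsilon> \<le> 1\<close> trades \<epsilon>^2 for \<epsilon>: the
      whole bound then carries one factor \<epsilon>, which is divided out in
      \<open>resolvent_limit\<close>.\<close>
    proof (intro add_mono mult_mono)
      show "\<epsilon>\<^sup>2 \<le> \<epsilon>" using \<epsilon> by (simp add: power2_eq_square mult_left_le)
      show "cmod (du s + of_real \<epsilon> * u s) \<le> 2 * C * d s * cmod (u x)"
        using est(2)[OF s] by (simp add: algebra_simps)
    qed (use s0 \<epsilon> inf \<rho>_lim(1)[OF s0] est(1)[OF s] ds in auto)
    also have "\<dots> = \<epsilon> * ((2 + 2 * C * \<rho>inf) * cmod (u x)) * d s" by (simp add: algebra_simps)
    also have "\<dots> \<le> \<epsilon> * ((2 + 2 * C * \<rho>inf) * cmod (u x)) * (C * d1 s)"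
      using ds \<epsilon> C inf by (intro mult_left_mono) auto
    finally show ?thesis by (simp add: k_def algebra_simps)
  qed
  have *: "cmod (J y - J x) \<le> \<epsilon> * k * d x" if y: "y \<ge> x" for y
  proof -
    have "cmod (J y - J x) \<le> - (\<epsilon> * k * d y) - - (\<epsilon> * k * d x)"
      using x A J1 by (intro norm_diff_le_of_deriv_bound[OF y J', where g' = "\<lambda>s. \<epsilon> * k * d1 s"])
        (auto intro!: derivative_eq_intros d_deriv)
    then show ?thesis using d_nonneg[of y] y x A \<epsilon> k by (smt (verit) mult_nonneg_nonneg)
  qed
  have "(\<rho> \<longlongrightarrow> \<rho>inf) at_top"
  proof -
    have "((\<lambda>s. \<rho> s - \<rho>inf) \<longlongrightarrow> 0) at_top"
      by (rule Lim_null_comparison[OF _ d_lim])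
         (use \<rho>_lim(1) in \<open>auto intro: eventually_at_top_linorderI[of 0]\<close>)
    then show ?thesis by (simp add: LIM_zero_iff)
  qed
  then have "(J \<longlongrightarrow> of_real \<rho>inf * 0 - of_real 0 * 0 + of_real (\<epsilon> * \<rho>inf) * 0) at_top"
    unfolding J_def by (intro tendsto_intros u0 du0 \<rho>_lim)
  then have "((\<lambda>y. cmod (J y - J x)) \<longlongrightarrow> cmod (0 - J x)) at_top" by (intro tendsto_intros) simp
  then have "cmod (0 - J x) \<le> \<epsilon> * k * d x"
    by (rule tendsto_upperbound) (use * in \<open>blast intro: eventually_at_top_linorderI[of x]\<close>, simp)
  then have "cmod (J x) \<le> \<epsilon> * k * d x" by simp
  then show ?thesis unfolding J_def k_def by (simp add: mult_ac)
qed

end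

section \<open>Square integrable functions and weak solutions\<close>

lemma has_vector_derivative_of_indefinite_integral:
  fixes K g :: "real \<Rightarrow> 'a::euclidean_space"
  assumes x: "a < x" "x < b" and g: "continuous_on {a..b} g"
    and K: "\<And>y. a \<le> y \<Longrightarrow> y \<le> b \<Longrightarrow> K y - K a = (LINT s:{a..y}|lborel. g s)"
  shows "(K has_vector_derivative g x) (at x)"
proof -
  have eq: "K a + integral {a..y} g = K y" if "a \<le> y" "y \<le> b" for y
  proof -
    have "set_integrable lborel {a..y} g"
      by (rule borel_integrable_atLeastAtMost') (use g that in \<open>auto elim: continuous_on_subset\<close>)
    then show ?thesis using K[OF that] set_borel_integral_eq_integral(2) by (metis add.commute diff_add_cancel)
  qed
  have "((\<lambda>y. integral {a..y} g) has_vector_derivative g x) (at x within {a..b})"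
    by (rule integral_has_vector_derivative[OF g]) (use x in auto)
  moreover have "at x within {a..b} = at x"
    using x by (intro at_within_interior) auto
  ultimately have "((\<lambda>y. K a + integral {a..y} g) has_vector_derivative g x) (at x)"
    by (auto intro!: derivative_eq_intros)
  then show ?thesis
    by (rule has_vector_derivative_transform_within_open[of _ _ _ "{a<..<b}"]) (use x eq in auto)
qed

lemma continuous_on_indefinite_integral:
  fixes K g :: "real \<Rightarrow> 'a::euclidean_space"
  assumes g: "\<And>a b. set_integrable lborel {a..b} g"
    and K: "\<And>a b. a \<le> b \<Longrightarrow> K b - K a = (LINT s:{a..b}|lborel. g s)"
  shows "continuous_on UNIV K"
proof (rule continuous_at_imp_continuous_on, rule ballI)
  fix x :: real
  have eq: "K (x - 1) + integral {x-1..y} g = K y" if "x - 1 \<le> y" for y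
    using K[OF that] set_borel_integral_eq_integral(2)[OF g] by (metis add.commute diff_add_cancel)
  have "continuous_on {x-1..x+1} (\<lambda>y. integral {x-1..y} g)"
    by (intro indefinite_integral_continuous_1 set_borel_integral_eq_integral(1)[OF g])
  then have "continuous_on {x-1..x+1} (\<lambda>y. K (x-1) + integral {x-1..y} g)" by (intro continuous_intros)
  then have "continuous_on {x-1..x+1} K"
    by (rule continuous_on_eq) (use eq in auto)
  then have "continuous_on {x-1<..<x+1} K" by (rule continuous_on_subset) auto
  then show "isCont K x" by (subst (asm) continuous_on_eq_continuous_at) auto
qed

text \<open>Integrating from minus infinity turns square integrability into the bounded
  antiderivative that \<open>second_order_decay\<close> asks for.\<close>

lemma bounded_antiderivative:
  fixes h :: "real \<Rightarrow> real"
  assumes int: "integrable lborel h" and cont: "continuous_on UNIV h" and h: "\<And>x. h x \<ge> 0"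
  obtains H where "\<And>x. (H has_real_derivative h x) (at x)" "\<And>x. \<bar>H x\<bar> \<le> integral\<^sup>L lborel h"
proof
  have [measurable]: "h \<in> borel_measurable borel" using cont by (rule borel_measurable_continuous_onI)
  have si: "set_integrable lborel A h" if "A \<in> sets borel" for A
    using integrable_mult_indicator[OF _ int, of A] that by (simp add: set_integrable_def)
  define H where "H = (\<lambda>x. LINT s:{..x}|lborel. h s)"
  show "\<bar>H x\<bar> \<le> integral\<^sup>L lborel h" for x
  proof -
    have "H x \<ge> 0" unfolding H_def set_lebesgue_integral_def
      by (rule integral_nonneg_AE) (use h in auto)
    moreover have "H x \<le> integral\<^sup>L lborel h"
      using si[of "{..x}"] unfolding H_def set_lebesgue_integral_def
      by (intro integral_mono int) (use h in \<open>auto simp: set_integrable_def indicator_def\<close>)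
    ultimately show ?thesis by simp
  qed
  fix x
  have "(H has_vector_derivative h x) (at x)"
  proof (rule has_vector_derivative_of_indefinite_integral[of "x - 1" x "x + 1"])
    fix y assume y: "x - 1 \<le> y"
    have "H y = H (x - 1) + (LINT s:{x-1<..y}|lborel. h s)"
    proof -
      have "{..y} = {..x-1} \<union> {x-1<..y}" using y by auto
      then show ?thesis unfolding H_def
        using set_integral_Un[of "{..x-1}" "{x-1<..y}" lborel h, OF _ si si]
        by (simp add: disjoint_iff)
    qed
    also have "(LINT s:{x-1<..y}|lborel. h s) = (LINT s:{x-1..y}|lborel. h s)"
    proof (rule set_integral_cong_set)
      show "AE s in lborel. (s \<in> {x-1..y}) = (s \<in> {x-1<..y})"
        using AE_lborel_singleton[of "x - 1"] by eventually_elim auto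
    qed (auto simp: set_borel_measurable_def)
    finally show "H y - H (x - 1) = (LINT s:{x-1..y}|lborel. h s)" by simp
  qed (use cont in \<open>auto elim: continuous_on_subset\<close>)
  then show "(H has_real_derivative h x) (at x)"
    by (simp add: has_real_derivative_iff_has_vector_derivative)
qed

section \<open>Local L^1 and L^2 estimates on bounded intervals\<close>

lemma set_integral_cong_AE_integrable:
  fixes f g :: "real \<Rightarrow> complex"
  assumes "set_integrable lborel A f" "g \<in> borel_measurable borel" "A \<in> sets borel" "AE x in lborel. f x = g x"
  shows "(LINT x:A|lborel. f x) = (LINT x:A|lborel. g x)" "set_integrable lborel A g"
proof -
  have m: "(\<lambda>x. indicator A x *\<^sub>R f x) \<in> borel_measurable lborel" "(\<lambda>x. indicator A x *\<^sub>R g x) \<in> borel_measurable lborel"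
    subgoal by (rule borel_measurable_integrable[OF assms(1)[unfolded set_integrable_def]])
    subgoal using assms(2,3) by measurable
    done
  have ae: "AE x in lborel. indicator A x *\<^sub>R f x = indicator A x *\<^sub>R g x"
    using assms(4) by eventually_elim simp
  show "(LINT x:A|lborel. f x) = (LINT x:A|lborel. g x)"
    unfolding set_lebesgue_integral_def by (rule integral_cong_AE[OF m ae])
  show "set_integrable lborel A g"
    using assms(1) integrable_cong_AE[OF m ae] unfolding set_integrable_def by blast
qed

text \<open>The L^1 form of local convergence bounds integrals of the equation directly and yields
  subsequences that converge almost everywhere; the L^2 control of the operators is converted into
  it.\<close>

definition L1_seminorm :: "real \<Rightarrow> (real \<Rightarrow> complex) \<Rightarrow> real" where
  "L1_seminorm b f = (LINT x:{-b..b}|lborel. cmod (f x))"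

text \<open>The third bound integrates s \<le> 1 + s^2. It is not homogeneous in \<open>f\<close>;
  it serves to show that a family stays bounded.\<close>

lemma L2_locD:
  assumes "f \<in> L2_loc"
  shows "f \<in> borel_measurable borel" "set_integrable lborel {-b..b} f" "L1_seminorm b f \<le> 2 * \<bar>b\<bar> + (L2_seminorm b f)\<^sup>2"
proof -
  show m[measurable]: "f \<in> borel_measurable borel" using assms by (simp add: L2_loc_def)
  have i2: "set_integrable lborel {-b..b} (\<lambda>x. (cmod (f x))\<^sup>2)" using assms by (simp add: L2_loc_def)
  have i1: "set_integrable lborel {-b..b} (\<lambda>x. 1 :: real)" by (rule borel_integrable_atLeastAtMost') auto
  have i3: "set_integrable lborel {-b..b} (\<lambda>x. 1 + (cmod (f x))\<^sup>2)" by (rule set_integral_add(1)[OF i1 i2])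
  have le: "cmod (f x) \<le> 1 + (cmod (f x))\<^sup>2" for x
    using zero_le_power2[of "cmod (f x) - 1"] by (simp add: power2_diff) (smt (verit) zero_le_power2)
  show i: "set_integrable lborel {-b..b} f"
    by (rule set_integrable_bound[OF i3]) (auto simp: set_borel_measurable_def intro: order_trans[OF le] abs_ge_self)
  have "L1_seminorm b f \<le> (LINT x:{-b..b}|lborel. 1 + (cmod (f x))\<^sup>2)"
    unfolding L1_seminorm_def by (rule set_integral_mono[OF _ i3]) (use i le in \<open>auto intro: set_integrable_norm\<close>)
  also have "\<dots> = (LINT x:{-b..b}|lborel. (1::real)) + (LINT x:{-b..b}|lborel. (cmod (f x))\<^sup>2)"
    by (rule set_integral_add(2)[OF i1 i2])
  also have "(LINT x:{-b..b}|lborel. (1::real)) \<le> 2 * \<bar>b\<bar>"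
    by (cases "b \<ge> 0") (simp_all add: set_lebesgue_integral_def)
  also have "(LINT x:{-b..b}|lborel. (cmod (f x))\<^sup>2) = (L2_seminorm b f)\<^sup>2"
    unfolding L2_seminorm_def
    by (subst real_sqrt_pow2) (auto simp: set_lebesgue_integral_def intro!: integral_nonneg_AE)
  finally show "L1_seminorm b f \<le> 2 * \<bar>b\<bar> + (L2_seminorm b f)\<^sup>2" by simp
qed

lemma cmod_add_power2_le: "(cmod (a + b))\<^sup>2 \<le> 2 * (cmod a)\<^sup>2 + 2 * (cmod b)\<^sup>2"
proof -
  have "(cmod (a + b))\<^sup>2 \<le> (cmod a + cmod b)\<^sup>2" by (intro power_mono norm_triangle_ineq) auto
  also have "\<dots> \<le> 2 * (cmod a)\<^sup>2 + 2 * (cmod b)\<^sup>2"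
    using zero_le_power2[of "cmod a - cmod b"] by (simp add: power2_sum power2_diff)
  finally show ?thesis .
qed

lemma L2_loc_add: "f \<in> L2_loc \<Longrightarrow> g \<in> L2_loc \<Longrightarrow> (\<lambda>x. f x + g x) \<in> L2_loc"
  unfolding L2_loc_def
proof (safe, goal_cases)
  case 1 then show ?case by simp
next
  case (2 a)
  have [measurable]: "f \<in> borel_measurable borel" "g \<in> borel_measurable borel" using 2 by auto
  have "set_integrable lborel {-a..a} (\<lambda>x. 2 * (cmod (f x))\<^sup>2 + 2 * (cmod (g x))\<^sup>2)" using 2 by auto
  then show ?case
    by (rule set_integrable_bound)
       (auto simp: set_borel_measurable_def intro!: order_trans[OF cmod_add_power2_le] abs_ge_self)
qed

lemma L2_loc_mult: "f \<in> L2_loc \<Longrightarrow> (\<lambda>x. c * f x) \<in> L2_loc"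
  by (auto simp: L2_loc_def norm_mult power_mult_distrib)

lemma L2_loc_diff: "f \<in> L2_loc \<Longrightarrow> g \<in> L2_loc \<Longrightarrow> (\<lambda>x. f x - g x) \<in> L2_loc"
  using L2_loc_add[of f "\<lambda>x. - 1 * g x"] L2_loc_mult[of g "- 1"] by simp

lemma L2_subset_L2_loc: "f \<in> L2 \<Longrightarrow> f \<in> L2_loc"
  unfolding L2_def L2_loc_def
  using integrable_mult_indicator[of "{-a..a}" lborel "\<lambda>x. (cmod (f x))\<^sup>2" for a]
  by (auto simp: set_integrable_def)

lemma set_integrable_L2:
  assumes "f \<in> L2" shows "set_integrable lborel {a..b} f"
proof -
  have "set_integrable lborel {- max \<bar>a\<bar> \<bar>b\<bar>..max \<bar>a\<bar> \<bar>b\<bar>} f"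
    by (rule L2_locD(2)[OF L2_subset_L2_loc[OF assms]])
  then show ?thesis by (rule set_integrable_subset) auto
qed

lemma set_integrable_continuous_mult:
  fixes f g :: "real \<Rightarrow> complex"
  assumes c: "continuous_on {a..b} c" and f: "set_integrable lborel {a..b} f" "f \<in> borel_measurable borel"
    and m: "c \<in> borel_measurable borel"
  shows "set_integrable lborel {a..b} (\<lambda>x. c x * f x)"
proof -
  have [measurable]: "f \<in> borel_measurable borel" "c \<in> borel_measurable borel" using f m by auto
  have "bounded (c ` {a..b})" by (intro compact_imp_bounded compact_continuous_image c) auto
  then obtain B where B: "\<And>x. x \<in> {a..b} \<Longrightarrow> cmod (c x) \<le> B" unfolding bounded_iff by blast
  have "set_integrable lborel {a..b} (\<lambda>x. of_real B * f x)" using f by simp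
  then show ?thesis
    by (rule set_integrable_bound)
       (auto simp: set_borel_measurable_def norm_mult intro!: mult_right_mono order_trans[OF B abs_ge_self])
qed

text \<open>\<open>r1\<close> plays the role of \<alpha>^2 = dr/dx. As the derivative of the bounded
  function \<open>r\<close> it is an integrable weight, and the potential and the approach of
  \<open>r\<close> to its limits are measured against it.\<close>

locale regge_wheeler =
  fixes r r1 r2 a :: "real \<Rightarrow> real" and rm rp C :: real and l :: nat
  assumes rm: "0 < rm" and C: "C > 0"
    and r_bounds: "\<And>x. rm < r x" "\<And>x. r x < rp"
    and r_deriv: "\<And>x. (r has_real_derivative r1 x) (at x)"
    and r1_deriv: "\<And>x. (r1 has_real_derivative r2 x) (at x)"
    and r1_le: "\<And>x. r1 x \<le> C"
    and a_cont: "continuous_on UNIV a" and a_pos: "\<And>x. a x > 0"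
    and potential_le: "\<And>x. \<bar>r2 x / r x + (a x)\<^sup>2 / (r x)\<^sup>2 * real (l * (l + 1))\<bar> \<le> C * r1 x"
    and right_le: "\<And>x. x \<ge> 0 \<Longrightarrow> rp - r x \<le> C * r1 x"
    and left_le: "\<And>x. x \<le> 0 \<Longrightarrow> r x - rm \<le> C * r1 x"
    and r_lim: "(r \<longlongrightarrow> rp) at_top" "(r \<longlongrightarrow> rm) at_bot"
    and r1_lim: "(r1 \<longlongrightarrow> 0) at_top" "(r1 \<longlongrightarrow> 0) at_bot"
begin

section \<open>Divergence form and Schroedinger form of the equation\<close>

definition V where "V x = (a x)\<^sup>2 / (r x)\<^sup>2 * real (l * (l + 1))"
text \<open>With u = r \<phi> one has - (1/r) (r^2 \<phi>')' = - u'' + (r''/r) u, so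
  \<open>W\<close> is the full potential when P is written as D_x^2 + W.\<close>

definition W where "W x = r2 x / r x + V x"

lemma r_pos: "r x > 0" using r_bounds(1)[of x] rm by simp

lemma r_nz [simp]: "r x \<noteq> 0" using r_pos[of x] by simp

lemma W_le: "\<bar>W x\<bar> \<le> C * r1 x" using potential_le by (simp add: W_def V_def)

lemma V_nonneg: "V x \<ge> 0" by (simp add: V_def)

lemma r_cont: "continuous_on S r"
  using r_deriv by (intro continuous_at_imp_continuous_on ballI DERIV_isCont) auto

lemma V_cont: "continuous_on S V"
  unfolding V_def by (intro continuous_intros r_cont continuous_on_subset[OF a_cont]) auto

lemma measurable_rV [measurable]: "r \<in> borel_measurable borel" "V \<in> borel_measurable borel"
  by (auto intro!: borel_measurable_continuous_onI r_cont V_cont)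

sublocale right: half_line W "\<lambda>x. rp - r x" r1 C
proof
  show "((\<lambda>x. rp - r x) \<longlongrightarrow> 0) at_top" using tendsto_diff[OF tendsto_const r_lim(1), of rp] by simp
qed (use C W_le r_bounds right_le in \<open>auto intro!: derivative_eq_intros r_deriv simp: less_imp_le\<close>)

text \<open>The reflection of the line exchanges the two ends and makes the left one an end of the
  same type. A solution reflects to \<open>u (- x)\<close> with derivative
  \<open>- du (- x)\<close>, the source of the minus signs in later statements.\<close>

sublocale left: half_line "\<lambda>x. W (- x)" "\<lambda>x. r (- x) - rm" "\<lambda>x. r1 (- x)" C
proof
  show "((\<lambda>x. r (- x) - rm) \<longlongrightarrow> 0) at_top"
    using tendsto_diff[OF filterlim_compose[OF r_lim(2) filterlim_uminus_at_bot_at_top] tendsto_const, of rm] by simp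
  show "((\<lambda>x. r (- x) - rm) has_real_derivative - r1 (- x)) (at x)" for x
    using DERIV_chain'[OF DERIV_minus[OF DERIV_ident] r_deriv[of "- x"]]
    by (auto intro!: derivative_eq_intros)
qed (use C W_le r_bounds left_le in \<open>auto simp: less_imp_le\<close>)

text \<open>A function \<open>u = r \<phi>\<close> solves \<open>(P - z\<^sup>2) u = f\<close> iff \<open>K = r\<^sup>2 \<phi>'\<close> has the derivative below.\<close>

definition weak_sol :: "complex \<Rightarrow> (real \<Rightarrow> complex) \<Rightarrow> (real \<Rightarrow> complex) \<Rightarrow> (real \<Rightarrow> complex) \<Rightarrow> bool" where
  "weak_sol z f \<phi> K \<longleftrightarrow> continuous_on UNIV K \<and>
     (\<forall>x. (\<phi> has_vector_derivative K x / of_real ((r x)\<^sup>2)) (at x)) \<and>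
     (\<forall>b c. b \<le> c \<longrightarrow> K c - K b =
        (LINT x:{b..c}|lborel. of_real (r x) * ((of_real (V x) - z\<^sup>2) * (of_real (r x) * \<phi> x) - f x)))"

lemma weak_sol_cont:
  assumes "weak_sol z f \<phi> K" shows "continuous_on S \<phi>" "continuous_on S K"
proof -
  show "continuous_on S \<phi>"
    using assms by (intro continuous_at_imp_continuous_on ballI)
      (auto simp: weak_sol_def intro: has_vector_derivative_continuous)
  show "continuous_on S K" using assms by (auto simp: weak_sol_def elim: continuous_on_subset)
qed

text \<open>Elements of the domain are only classes modulo null sets; the absolutely continuous
  representatives \<open>F\<close> of u / r and \<open>G\<close> of r^2 D_x (u / r) provide \<phi>
  and K.\<close>

lemma P_op_weak_sol:
  assumes P: "P_op r a l u (\<lambda>x. f x + z\<^sup>2 * u x)" and f: "f \<in> borel_measurable borel"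
  obtains \<phi> K where "weak_sol z f \<phi> K" "AE x in lborel. u x = of_real (r x) * \<phi> x"
proof -
  obtain w1 w2 where w: "weak_Dx (\<lambda>x. u x / of_real (r x)) w1" "weak_Dx (\<lambda>x. of_real ((r x)\<^sup>2) * w1 x) w2"
    and v: "AE x in lborel. f x + z\<^sup>2 * u x = w2 x / of_real (r x) + of_real (V x) * u x"
    using P unfolding P_op_def V_def by blast
  obtain F where iw1: "\<And>b c. set_integrable lborel {b..c} (\<lambda>x. \<i> * w1 x)"
    and F: "AE x in lborel. u x / of_real (r x) = F x" "\<And>b c. b \<le> c \<Longrightarrow> F c - F b = (LINT x:{b..c}|lborel. \<i> * w1 x)"
    using w(1) unfolding weak_Dx_def weak_deriv_def by blast
  obtain G where iw2: "\<And>b c. set_integrable lborel {b..c} (\<lambda>x. \<i> * w2 x)"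
    and G: "AE x in lborel. of_real ((r x)\<^sup>2) * w1 x = G x" "\<And>b c. b \<le> c \<Longrightarrow> G c - G b = (LINT x:{b..c}|lborel. \<i> * w2 x)"
    using w(2) unfolding weak_Dx_def weak_deriv_def by blast
  \<comment> \<open>Since D_x = - i d/dx, \<open>G\<close> represents - i r^2 \<phi>', and
    multiplication by i restores r^2 \<phi>'.\<close>
  define K where "K = (\<lambda>x. \<i> * G x)"
  have contG: "continuous_on UNIV G" by (rule continuous_on_indefinite_integral[OF iw2 G(2)])
  then have contK: "continuous_on UNIV K" unfolding K_def by (intro continuous_intros)
  have contF: "continuous_on UNIV F" by (rule continuous_on_indefinite_integral[OF iw1 F(2)])
  have [measurable]: "F \<in> borel_measurable borel" "f \<in> borel_measurable borel"
    using contF f by (auto intro!: borel_measurable_continuous_onI)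
  have u: "AE x in lborel. u x = of_real (r x) * F x" using F(1) by eventually_elim (auto simp: field_simps)
  have contK': "continuous_on S (\<lambda>x. K x / of_real ((r x)\<^sup>2))" for S
    by (intro continuous_intros continuous_on_subset[OF contK] r_cont) auto
  have "(F has_vector_derivative K x / of_real ((r x)\<^sup>2)) (at x)" for x
  proof (rule has_vector_derivative_of_indefinite_integral[of "x-1" x "x+1"])
    fix y assume y: "x - 1 \<le> y"
    have "AE s in lborel. \<i> * w1 s = K s / of_real ((r s)\<^sup>2)"
      using G(1) by eventually_elim (auto simp: K_def field_simps)
    from set_integral_cong_AE_integrable(1)[OF iw1 borel_measurable_continuous_onI[OF contK'] _ this]
    show "F y - F (x-1) = (LINT s:{x-1..y}|lborel. K s / of_real ((r s)\<^sup>2))" using F(2)[OF y] by simp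
  qed (use contK' in auto)
  moreover have "K c - K b = (LINT x:{b..c}|lborel. of_real (r x) * ((of_real (V x) - z\<^sup>2) * (of_real (r x) * F x) - f x))"
    if "b \<le> c" for b c
  proof -
    have ae: "AE x in lborel. \<i> * (\<i> * w2 x) = of_real (r x) * ((of_real (V x) - z\<^sup>2) * (of_real (r x) * F x) - f x)"
      using u v
    proof eventually_elim
      case (elim x)
      have "w2 x = of_real (r x) * (f x + z\<^sup>2 * u x - of_real (V x) * u x)" unfolding elim(2) by simp
      then show ?case unfolding elim(1) by (simp add: algebra_simps)
    qed
    have i: "set_integrable lborel {b..c} (\<lambda>x. \<i> * (\<i> * w2 x))"
      by (rule set_integrable_mult_right) (rule iw2)
    have "(LINT x:{b..c}|lborel. \<i> * (\<i> * w2 x)) = (LINT x:{b..c}|lborel. of_real (r x) * ((of_real (V x) - z\<^sup>2) * (of_real (r x) * F x) - f x))"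
      by (rule set_integral_cong_AE_integrable(1)[OF i _ _ ae]) auto
    moreover have "K c - K b = \<i> * (LINT x:{b..c}|lborel. \<i> * w2 x)"
      unfolding K_def G(2)[OF that, symmetric] by (simp add: algebra_simps)
    ultimately show ?thesis by (simp only: set_integral_mult_right)
  qed
  ultimately show thesis using that[of F K] contK u by (auto simp: weak_sol_def)
qed

definition sol_u :: "(real \<Rightarrow> complex) \<Rightarrow> real \<Rightarrow> complex" where
  "sol_u \<phi> x = of_real (r x) * \<phi> x"

definition sol_du :: "(real \<Rightarrow> complex) \<Rightarrow> (real \<Rightarrow> complex) \<Rightarrow> real \<Rightarrow> complex" where
  "sol_du \<phi> K x = of_real (r1 x) * \<phi> x + K x / of_real (r x)"

lemma sol_u_deriv:
  assumes "weak_sol z f \<phi> K"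
  shows "(sol_u \<phi> has_vector_derivative sol_du \<phi> K x) (at x)"
proof -
  have "(\<phi> has_vector_derivative K x / of_real ((r x)\<^sup>2)) (at x)" using assms by (simp add: weak_sol_def)
  moreover have "((\<lambda>x. complex_of_real (r x)) has_vector_derivative of_real (r1 x)) (at x)"
    using r_deriv[of x] by (auto intro!: has_vector_derivative_of_real simp: has_real_derivative_iff_has_vector_derivative)
  ultimately have "((\<lambda>x. of_real (r x) * \<phi> x) has_vector_derivative
      of_real (r x) * (K x / of_real ((r x)\<^sup>2)) + of_real (r1 x) * \<phi> x) (at x)"
    by (intro has_vector_derivative_mult)
  moreover have "sol_u \<phi> = (\<lambda>x. of_real (r x) * \<phi> x)" by (auto simp: sol_u_def)
  ultimately show ?thesis by (simp add: sol_du_def power2_eq_square add.commute)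
qed

text \<open>For a source in L^2 the function \<open>K\<close> is merely absolutely continuous. Where
  the source vanishes nearby, the integrand agrees almost everywhere with a continuous function, and
  \<open>K\<close> is differentiable.\<close>

lemma weak_sol_K_deriv:
  assumes sol: "weak_sol z f \<phi> K" and e: "e > 0"
    and f: "AE s in lborel. s \<in> {x-e..x+e} \<longrightarrow> f s = 0" "f \<in> borel_measurable borel"
  shows "(K has_vector_derivative of_real (r x) * ((of_real (V x) - z\<^sup>2) * sol_u \<phi> x)) (at x)"
proof (rule has_vector_derivative_of_indefinite_integral[of "x-e" x "x+e"])
  note c = weak_sol_cont[OF sol]
  show "continuous_on {x-e..x+e} (\<lambda>x. of_real (r x) * ((of_real (V x) - z\<^sup>2) * sol_u \<phi> x))"
    unfolding sol_u_def by (intro continuous_intros c r_cont V_cont)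
  fix y assume y: "x - e \<le> y" "y \<le> x + e"
  have [measurable]: "f \<in> borel_measurable borel" "\<phi> \<in> borel_measurable borel"
    using f(2) c by (auto intro!: borel_measurable_continuous_onI)
  have "K y - K (x - e) = (LINT x:{x-e..y}|lborel. of_real (r x) * ((of_real (V x) - z\<^sup>2) * (of_real (r x) * \<phi> x) - f x))"
    using sol y by (simp add: weak_sol_def)
  also have "\<dots> = (LINT s:{x-e..y}|lborel. of_real (r s) * ((of_real (V s) - z\<^sup>2) * sol_u \<phi> s))"
    unfolding sol_u_def
    by (rule set_lebesgue_integral_cong_AE) (use f(1) y in \<open>auto elim!: eventually_mono\<close>)
  finally show "K y - K (x - e) = \<dots>" .
qed (use e in auto)

text \<open>The two terms r' K / r^2 produced by the product rule cancel; what remains is the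
  Schroedinger form with potential \<open>W\<close>.\<close>

lemma sol_du_deriv:
  assumes sol: "weak_sol z f \<phi> K" and K: "(K has_vector_derivative of_real (r x) * ((of_real (V x) - z\<^sup>2) * sol_u \<phi> x)) (at x)"
  shows "(sol_du \<phi> K has_vector_derivative (of_real (W x) - z\<^sup>2) * sol_u \<phi> x) (at x)"
proof -
  have phi: "(\<phi> has_vector_derivative K x / of_real ((r x)\<^sup>2)) (at x)" using sol by (simp add: weak_sol_def)
  have r: "((\<lambda>x. complex_of_real (inverse (r x))) has_vector_derivative of_real (- r1 x / (r x)\<^sup>2)) (at x)"
    "((\<lambda>x. complex_of_real (r1 x)) has_vector_derivative of_real (r2 x)) (at x)"
    using r_deriv[of x] r1_deriv[of x]
    by (auto intro!: has_vector_derivative_of_real derivative_eq_intros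
      simp: has_real_derivative_iff_has_vector_derivative[symmetric] power2_eq_square field_simps simp del: of_real_inverse of_real_divide of_real_mult of_real_minus of_real_power)
  have "((\<lambda>x. of_real (r1 x) * \<phi> x + K x * of_real (inverse (r x))) has_vector_derivative
     (of_real (r1 x) * (K x / of_real ((r x)\<^sup>2)) + of_real (r2 x) * \<phi> x) +
     (K x * of_real (- r1 x / (r x)\<^sup>2) + of_real (r x) * ((of_real (V x) - z\<^sup>2) * sol_u \<phi> x) * of_real (inverse (r x)))) (at x)"
    by (intro derivative_intros has_vector_derivative_mult r phi K)
  moreover have "(of_real (r1 x) * (K x / of_real ((r x)\<^sup>2)) + of_real (r2 x) * \<phi> x) +
     (K x * of_real (- r1 x / (r x)\<^sup>2) + of_real (r x) * ((of_real (V x) - z\<^sup>2) * sol_u \<phi> x) * of_real (inverse (r x)))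
     = (of_real (W x) - z\<^sup>2) * sol_u \<phi> x"
    by (simp add: W_def sol_u_def field_simps)
  moreover have "sol_du \<phi> K = (\<lambda>x. of_real (r1 x) * \<phi> x + K x * of_real (inverse (r x)))"
    by (auto simp: sol_du_def divide_inverse)
  ultimately show ?thesis by simp
qed

text \<open>The coefficient W - z^2 is bounded, so \<open>second_order_decay\<close> applies at both
  ends to a square integrable solution. The margin 1 in \<open>A + 1\<close> keeps a neighbourhood
  of each point away from the support of \<open>f\<close>.\<close>

lemma weak_sol_decaying:
  assumes sol: "weak_sol z f \<phi> K" and ae: "AE x in lborel. u x = of_real (r x) * \<phi> x"
    and u: "u \<in> L2" and f: "AE x in lborel. x \<notin> {-A..A} \<longrightarrow> f x = 0" "f \<in> borel_measurable borel" and A: "A \<ge> 0"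
  shows "right.decaying_sol z (A + 1) (sol_u \<phi>) (sol_du \<phi> K)"
    and "left.decaying_sol z (A + 1) (\<lambda>x. sol_u \<phi> (- x)) (\<lambda>x. - sol_du \<phi> K (- x))"
proof -
  note u' = sol_u_deriv[OF sol]
  have du': "(sol_du \<phi> K has_vector_derivative (of_real (W x) - z\<^sup>2) * sol_u \<phi> x) (at x)" if "\<bar>x\<bar> \<ge> A + 1" for x
  proof (rule sol_du_deriv[OF sol weak_sol_K_deriv[OF sol _ _ f(2)]])
    show "AE s in lborel. s \<in> {x - 1/2..x + 1/2} \<longrightarrow> f s = 0" using f(1)
      by eventually_elim (use that in auto)
  qed auto
  have mu: "((\<lambda>x. sol_u \<phi> (- x)) has_vector_derivative - sol_du \<phi> K (- x)) (at x)" for x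
    using vector_diff_chain_at[OF has_vector_derivative_minus[OF has_vector_derivative_id] u'[of "- x"]]
    by (simp add: o_def)
  have mdu: "((\<lambda>x. - sol_du \<phi> K (- x)) has_vector_derivative (of_real (W (- x)) - z\<^sup>2) * sol_u \<phi> (- x)) (at x)"
    if "x \<ge> A + 1" for x
    using has_vector_derivative_minus[OF vector_diff_chain_at[OF has_vector_derivative_minus[OF has_vector_derivative_id] du'[of "- x"]]] that A
    by (simp add: o_def)
  define h where "h = (\<lambda>x. (cmod (sol_u \<phi> x))\<^sup>2)"
  have contu: "continuous_on UNIV (sol_u \<phi>)"
    unfolding sol_u_def by (intro continuous_intros weak_sol_cont[OF sol] r_cont)
  then have ch: "continuous_on UNIV h" unfolding h_def by (intro continuous_intros)
  have "integrable lborel (\<lambda>x. (cmod (u x))\<^sup>2)" using u by (simp add: L2_def)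
  moreover have "AE x in lborel. (cmod (u x))\<^sup>2 = h x" using ae by eventually_elim (simp add: h_def sol_u_def)
  ultimately have "integrable lborel h"
    using integrable_cong_AE[of "\<lambda>x. (cmod (u x))\<^sup>2" lborel h] ch u
    by (auto simp: borel_measurable_continuous_onI L2_def)
  then obtain H where H: "\<And>x. (H has_real_derivative h x) (at x)" and Hb: "\<And>x. \<bar>H x\<bar> \<le> integral\<^sup>L lborel h"
    using bounded_antiderivative[OF _ ch] by (auto simp: h_def)
  have mH: "((\<lambda>x. - H (- x)) has_real_derivative h (- x)) (at x)" for x
    using DERIV_minus[OF DERIV_chain'[OF DERIV_minus[OF DERIV_ident] H[of "- x"]]] by simp
  \<comment> \<open>The product \<open>C * C\<close> comes from
    \<open>\<bar>W x\<bar> \<le> C * r1 x\<close> and \<open>r1 x \<le> C\<close>.\<close>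
  define \<beta> where "\<beta> = C * C + (cmod z)\<^sup>2"
  have B: "cmod (of_real (W x) - z\<^sup>2) \<le> \<beta>" for x
  proof -
    have "cmod (of_real (W x) - z\<^sup>2) \<le> \<bar>W x\<bar> + (cmod z)\<^sup>2"
      using norm_triangle_ineq4[of "of_real (W x)" "z\<^sup>2"] by (simp add: norm_power)
    also have "\<bar>W x\<bar> \<le> C * C" using W_le[of x] mult_left_mono[OF r1_le[of x], of C] C by linarith
    finally show ?thesis by (simp add: \<beta>_def)
  qed
  have "(sol_u \<phi> \<longlongrightarrow> 0) at_top" "(sol_du \<phi> K \<longlongrightarrow> 0) at_top"
    using second_order_decay[OF u' du' B H[unfolded h_def] Hb, of "A + 1"] A by auto
  then show "right.decaying_sol z (A + 1) (sol_u \<phi>) (sol_du \<phi> K)"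
    unfolding right.decaying_sol_def using u' du' A by auto
  have "((\<lambda>x. sol_u \<phi> (- x)) \<longlongrightarrow> 0) at_top" "((\<lambda>x. - sol_du \<phi> K (- x)) \<longlongrightarrow> 0) at_top"
    using second_order_decay[OF mu mdu B mH[unfolded h_def], of "A + 1" "integral\<^sup>L lborel h"] Hb by auto
  then show "left.decaying_sol z (A + 1) (\<lambda>x. sol_u \<phi> (- x)) (\<lambda>x. - sol_du \<phi> K (- x))"
    unfolding left.decaying_sol_def using mu mdu A by auto
qed

end

section \<open>Limits of solutions\<close>

lemma antiderivative_on_open_interval:
  fixes g :: "real \<Rightarrow> 'a::banach"
  assumes "continuous_on {a..b} g"
  obtains G where "\<And>x. x \<in> {a<..<b} \<Longrightarrow> (G has_vector_derivative g x) (at x)"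
proof -
  obtain G where G: "\<And>x. x \<in> {a..b} \<Longrightarrow> (G has_vector_derivative g x) (at x within {a..b})"
    using antiderivative_continuous[OF assms] by blast
  show thesis
  proof (rule that)
    fix x assume "x \<in> {a<..<b}"
    then show "(G has_vector_derivative g x) (at x)"
      using G[of x] at_within_interior[of x "{a..b}"] by auto
  qed
qed

lemma L1_seminorm_AE_subseq:
  assumes int: "\<And>n. set_integrable lborel {-b..b} (h n)" and lim: "(\<lambda>n. L1_seminorm b (h n)) \<longlonglongrightarrow> 0"
  obtains s :: "nat \<Rightarrow> nat" where "strict_mono s" "AE x in lborel. x \<in> {-b..b} \<longrightarrow> (\<lambda>n. h (s n) x) \<longlonglongrightarrow> 0"
proof -
  have "\<exists>s::nat\<Rightarrow>nat. strict_mono s \<and> (AE x in lborel. (\<lambda>n. indicator {-b..b} x *\<^sub>R h (s n) x) \<longlonglongrightarrow> 0)"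
  proof (rule tendsto_L1_AE_subseq)
    show "integrable lborel (\<lambda>x. indicator {-b..b} x *\<^sub>R h n x)" for n
      using int by (simp add: set_integrable_def)
    show "(\<lambda>n. LINT x|lborel. norm (indicator {-b..b} x *\<^sub>R h n x)) \<longlonglongrightarrow> 0"
      using lim by (simp add: L1_seminorm_def set_lebesgue_integral_def)
  qed
  then obtain s :: "nat \<Rightarrow> nat" where s: "strict_mono s" "AE x in lborel. (\<lambda>n. indicator {-b..b} x *\<^sub>R h (s n) x) \<longlonglongrightarrow> 0"
    by blast
  show thesis
    by (rule that[OF s(1)]) (use s(2) in \<open>auto elim!: eventually_mono\<close>)
qed

lemma AE_real_interval_obtain:
  fixes a b :: real
  assumes "AE x in lborel. P x" "a < b"
  obtains x where "a < x" "x < b" "P x"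
proof -
  have "\<not> (AE x in lborel. x \<notin> {a<..<b})"
  proof
    assume "AE x in lborel. x \<notin> {a<..<b}"
    then have "{a<..<b} \<in> null_sets lborel"
      by (subst (asm) AE_iff_null_sets[symmetric]) auto
    then show False using \<open>a < b\<close> by (auto simp: null_sets_def)
  qed
  moreover have "AE x in lborel. x \<notin> {a<..<b}" if "\<not> thesis"
    using assms(1) by eventually_elim (use \<open>\<And>x. a < x \<Longrightarrow> x < b \<Longrightarrow> P x \<Longrightarrow> thesis\<close> that in auto)
  ultimately show thesis by blast
qed

lemma L1_seminorm_integral_bound:
  assumes "set_integrable lborel {-b..b} h" "{c..d} \<subseteq> {-b..b}"
  shows "cmod (LINT x:{c..d}|lborel. h x) \<le> L1_seminorm b h"
proof -
  have "set_integrable lborel {c..d} h" by (rule set_integrable_subset[OF assms(1)]) (use assms in auto)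
  then have "cmod (LINT x:{c..d}|lborel. h x) \<le> (LINT x:{c..d}|lborel. cmod (h x))"
    by (rule set_integral_norm_bound)
  also have "\<dots> \<le> L1_seminorm b h"
    unfolding L1_seminorm_def set_lebesgue_integral_def
    using set_integrable_norm[OF assms(1)] set_integrable_norm[OF set_integrable_subset[OF assms(1) _ assms(2)]] assms(2)
    by (intro integral_mono) (auto simp: set_integrable_def indicator_def)
  finally show ?thesis .
qed

lemma L1_seminorm_nonneg: "L1_seminorm b f \<ge> 0"
  by (simp add: L1_seminorm_def set_lebesgue_integral_def)

context regge_wheeler
begin

text \<open>The equation upgrades local L^1 convergence to pointwise convergence. Increments of
  \<open>c n * K n\<close> converge as integrals, which leaves one unknown initial value for
  \<open>c n * K n\<close> and one for \<open>c n * \<phi> n\<close>; both are read off at two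
  points of almost everywhere convergence. Since \<open>c n\<close> tends to 0, the source
  disappears in the limit.\<close>

lemma limit_weak_sol:
  assumes sol: "\<And>n. weak_sol (z n) f (\<phi> n) (K n)"
    and f: "f \<in> L2_loc" and U: "U \<in> L2_loc"
    and z: "z \<longlonglongrightarrow> z0" and c: "c \<longlonglongrightarrow> 0"
    and lim: "\<And>b. (\<lambda>n. L1_seminorm b (\<lambda>x. c n * sol_u (\<phi> n) x - U x)) \<longlonglongrightarrow> 0"
  obtains s \<phi>' K' where "strict_mono (s :: nat \<Rightarrow> nat)"
    "\<And>x. (\<lambda>n. c (s n) * \<phi> (s n) x) \<longlonglongrightarrow> \<phi>' x" "\<And>x. (\<lambda>n. c (s n) * K (s n) x) \<longlonglongrightarrow> K' x"
    "weak_sol z0 (\<lambda>_. 0) \<phi>' K'" "AE x in lborel. U x = sol_u \<phi>' x"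
proof -
  have U_m[measurable]: "U \<in> borel_measurable borel" and f_m[measurable]: "f \<in> borel_measurable borel"
    using L2_locD(1) f U by auto
  have [measurable]: "\<phi> n \<in> borel_measurable borel" for n
    using weak_sol_cont(1)[OF sol, of UNIV n] by (rule borel_measurable_continuous_onI)
  have contu: "continuous_on S (sol_u (\<phi> n))" for n S
    unfolding sol_u_def by (intro continuous_intros weak_sol_cont(1)[OF sol] r_cont)
  have [measurable]: "sol_u (\<phi> n) \<in> borel_measurable borel" for n
    using contu by (rule borel_measurable_continuous_onI)
  \<comment> \<open>At this stage \<open>U\<close> is only known as an element of L^2_loc, so the
    limiting right-hand side is formed with \<open>U\<close> and rewritten with
    \<open>sol_u \<phi>'\<close> at the end.\<close>
  define g where "g = (\<lambda>x. of_real (r x) * (of_real (V x) - z0\<^sup>2) * U x)"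
  define gn where "gn = (\<lambda>n x. of_real (r x) * ((of_real (V x) - (z n)\<^sup>2) * (c n * sol_u (\<phi> n) x) - c n * f x))"
  define h where "h = (\<lambda>n x. c n * sol_u (\<phi> n) x - U x)"
  have hlim: "(\<lambda>n. L1_seminorm b (h n)) \<longlonglongrightarrow> 0" for b
    using lim by (simp add: h_def)
  have ih: "set_integrable lborel {-b..b} (h n)" for n b
    unfolding h_def
    by (intro set_integral_diff L2_locD(2)[OF U] borel_integrable_atLeastAtMost' continuous_intros contu)
  have iU: "set_integrable lborel {-b..b} U" and if': "set_integrable lborel {-b..b} f" for b
    by (rule L2_locD(2)[OF U], rule L2_locD(2)[OF f])
  have ig': "set_integrable lborel {-b..b} g" for b
    unfolding g_def
    by (rule set_integrable_continuous_mult[OF _ iU U_m])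
       (auto intro!: continuous_intros r_cont V_cont borel_measurable_continuous_onI)
  have ig: "set_integrable lborel {b..d} g" for b d
    by (rule set_integrable_subset[OF ig'[of "max \<bar>b\<bar> \<bar>d\<bar>"]]) auto
  have ign: "set_integrable lborel {-b..b} (gn n)" for b n
  proof -
    have "set_integrable lborel {-b..b} (\<lambda>x. of_real (r x) * ((of_real (V x) - (z n)\<^sup>2) * (c n * sol_u (\<phi> n) x)) - (of_real (r x) * c n) * f x)"
      by (intro set_integral_diff set_integrable_continuous_mult[OF _ if' f_m] borel_integrable_atLeastAtMost')
         (auto intro!: continuous_intros r_cont V_cont contu borel_measurable_continuous_onI)
    then show ?thesis unfolding gn_def by (simp add: algebra_simps)
  qed
  have KK: "c n * K n d - c n * K n b = (LINT x:{b..d}|lborel. gn n x)" if "b \<le> d" for n b d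
  proof -
    have "c n * K n d - c n * K n b = c n * (K n d - K n b)" by (simp add: algebra_simps)
    also have "\<dots> = (LINT x:{b..d}|lborel. c n * (of_real (r x) * ((of_real (V x) - (z n)\<^sup>2) * (of_real (r x) * \<phi> n x) - f x)))"
      using sol[of n] that unfolding weak_sol_def by (subst set_integral_mult_right) simp
    also have "\<dots> = (LINT x:{b..d}|lborel. gn n x)"
      by (intro set_lebesgue_integral_cong) (auto simp: gn_def sol_u_def algebra_simps)
    finally show ?thesis .
  qed
  define e where "e = (\<lambda>b n. L1_seminorm b (\<lambda>x. gn n x - g x))"
  have e0: "e b \<longlonglongrightarrow> 0" for b
  proof -
    have "bounded (V ` {-b..b})" by (intro compact_imp_bounded compact_continuous_image V_cont) auto
    then obtain Vb where "\<forall>y\<in>V ` {-b..b}. norm y \<le> Vb" unfolding bounded_iff by blast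
    then have Vb: "\<bar>V x\<bar> \<le> Vb" if "x \<in> {-b..b}" for x using that by simp
    \<comment> \<open>Three sources of error: the distance to \<open>U\<close>, the change of the
      spectral parameter, and the rescaled source.\<close>
    define E where "E = (\<lambda>n. rp * (Vb + (cmod (z n))\<^sup>2) * L1_seminorm b (h n)
        + rp * cmod ((z n)\<^sup>2 - z0\<^sup>2) * L1_seminorm b U + rp * cmod (c n) * L1_seminorm b f)"
    have "E \<longlonglongrightarrow> rp * (Vb + (cmod z0)\<^sup>2) * 0 + rp * cmod (z0\<^sup>2 - z0\<^sup>2) * L1_seminorm b U + rp * cmod 0 * L1_seminorm b f"
      unfolding E_def by (intro tendsto_intros z c hlim)
    then have E: "E \<longlonglongrightarrow> 0" by simp
    have "e b n \<le> E n" for n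
    proof -
      have le: "cmod (gn n x - g x) \<le> rp * (Vb + (cmod (z n))\<^sup>2) * cmod (h n x)
        + rp * cmod ((z n)\<^sup>2 - z0\<^sup>2) * cmod (U x) + rp * cmod (c n) * cmod (f x)" if x: "x \<in> {-b..b}" for x
      proof -
        have eq: "gn n x - g x = (of_real (r x) * (of_real (V x) - (z n)\<^sup>2) * h n x
            - of_real (r x) * ((z n)\<^sup>2 - z0\<^sup>2) * U x) - of_real (r x) * c n * f x"
          by (simp add: gn_def g_def h_def algebra_simps)
        have "cmod (gn n x - g x) \<le> cmod (of_real (r x) * (of_real (V x) - (z n)\<^sup>2) * h n x)
            + cmod (of_real (r x) * ((z n)\<^sup>2 - z0\<^sup>2) * U x) + cmod (of_real (r x) * c n * f x)"
          unfolding eq by (intro order_trans[OF norm_triangle_ineq4] add_mono norm_triangle_ineq4 order_refl)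
        also have "\<dots> \<le> rp * (Vb + (cmod (z n))\<^sup>2) * cmod (h n x)
            + rp * cmod ((z n)\<^sup>2 - z0\<^sup>2) * cmod (U x) + rp * cmod (c n) * cmod (f x)"
          unfolding norm_mult
        proof (intro add_mono mult_mono)
          show "cmod (of_real (V x) - (z n)\<^sup>2) \<le> Vb + (cmod (z n))\<^sup>2"
            using norm_triangle_ineq4[of "of_real (V x)" "(z n)\<^sup>2"] Vb[OF x] by (simp add: norm_power)
          show "cmod (of_real (r x)) \<le> rp" using r_bounds(2)[of x] r_pos[of x] by simp
          then show "cmod (of_real (r x)) \<le> rp" "cmod (of_real (r x)) \<le> rp" by auto
          show "0 \<le> rp" "0 \<le> rp" "0 \<le> rp" using r_bounds(2)[of x] r_pos[of x] by simp_all
          show "0 \<le> rp * (Vb + (cmod (z n))\<^sup>2)"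
            using r_bounds(2)[of x] r_pos[of x] Vb[OF x] by (intro mult_nonneg_nonneg add_nonneg_nonneg) auto
          show "0 \<le> rp * cmod ((z n)\<^sup>2 - z0\<^sup>2)" "0 \<le> rp * cmod (c n)"
            using r_bounds(2)[of x] r_pos[of x] by auto
        qed auto
        finally show ?thesis .
      qed
      note n1 = set_integrable_norm[OF ih[of b n]] set_integrable_norm[OF iU[of b]] set_integrable_norm[OF if'[of b]]
      have "e b n \<le> (LINT x:{-b..b}|lborel. rp * (Vb + (cmod (z n))\<^sup>2) * cmod (h n x)
        + rp * cmod ((z n)\<^sup>2 - z0\<^sup>2) * cmod (U x) + rp * cmod (c n) * cmod (f x))"
        unfolding e_def L1_seminorm_def
        by (intro set_integral_mono set_integrable_norm set_integral_diff(1)[OF ign ig'] set_integral_add(1) set_integrable_mult_right n1)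
           (use le in auto)
      also have "\<dots> = E n"
        unfolding E_def L1_seminorm_def using n1
        by (simp add: set_integral_add set_integrable_mult_right)
      finally show ?thesis .
    qed
    then show ?thesis
      by (intro tendsto_sandwich[OF _ _ tendsto_const E]) (auto simp: e_def L1_seminorm_nonneg)
  qed
  have Klim: "(\<lambda>n. c n * K n d - c n * K n b) \<longlonglongrightarrow> (LINT x:{b..d}|lborel. g x)"
    and Kerr: "\<And>B n. {b..d} \<subseteq> {-B..B} \<Longrightarrow> cmod ((c n * K n d - c n * K n b) - (LINT x:{b..d}|lborel. g x)) \<le> e B n"
    if bd: "b \<le> d" for b d
  proof -
    show *: "cmod ((c n * K n d - c n * K n b) - (LINT x:{b..d}|lborel. g x)) \<le> e B n" if B: "{b..d} \<subseteq> {-B..B}" for B n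
    proof -
      have i: "set_integrable lborel {b..d} (gn n)" "set_integrable lborel {b..d} g"
        by (rule set_integrable_subset[OF ign[of B] _ B], simp) (rule ig)
      show ?thesis unfolding KK[OF bd] e_def
        using L1_seminorm_integral_bound[OF set_integral_diff(1)[OF ign[of B n] ig'[of B]] B]
        by (simp add: set_integral_diff(2)[OF i])
    qed
    define B where "B = max \<bar>b\<bar> \<bar>d\<bar>"
    have sB: "{b..d} \<subseteq> {-B..B}" by (auto simp: B_def)
    have "(\<lambda>n. (c n * K n d - c n * K n b) - (LINT x:{b..d}|lborel. g x)) \<longlonglongrightarrow> 0"
      by (rule Lim_null_comparison[OF always_eventually e0[of B]]) (intro allI *[OF sB])
    then show "(\<lambda>n. c n * K n d - c n * K n b) \<longlonglongrightarrow> (LINT x:{b..d}|lborel. g x)"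
      by (simp add: LIM_zero_iff)
  qed
  \<comment> \<open>\<open>\<rho>\<close> is an antiderivative of 1 / r^2, the profile that an
    unknown value of \<open>K\<close> at \<open>- B\<close> contributes to \<open>\<phi>\<close>.
    Subtracting this contribution gives convergence before anything is known about
    \<open>c n * K n (-B)\<close>.\<close>
  have key: "\<exists>\<rho> \<Gamma> G. (\<forall>y\<in>{-B<..<B}. (\<rho> has_vector_derivative 1 / (r y)\<^sup>2) (at y) \<and>
        (\<Gamma> has_vector_derivative G y / of_real ((r y)\<^sup>2)) (at y) \<and>
        (\<lambda>n. c n * K n y - c n * K n (-B)) \<longlonglongrightarrow> G y) \<and>
      (\<forall>x\<in>{-B<..<B}. \<forall>y\<in>{-B<..<B}. x \<le> y \<longrightarrow>
        (\<lambda>n. (c n * \<phi> n y - c n * \<phi> n x) - c n * K n (-B) * of_real (\<rho> y - \<rho> x)) \<longlonglongrightarrow> \<Gamma> y - \<Gamma> x)" for B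
  proof -
    define G where "G = (\<lambda>y. LINT x:{-B..y}|lborel. g x)"
    have contG: "continuous_on {-B..B} G"
    proof (rule continuous_on_eq)
      show "continuous_on {-B..B} (\<lambda>y. integral {-B..y} g)"
        by (intro indefinite_integral_continuous_1 set_borel_integral_eq_integral(1)[OF ig])
      show "integral {-B..y} g = G y" for y
        unfolding G_def by (rule set_borel_integral_eq_integral(2)[OF ig, symmetric])
    qed
    obtain \<rho> where \<rho>: "\<And>y. y \<in> {-B<..<B} \<Longrightarrow> (\<rho> has_vector_derivative 1 / (r y)\<^sup>2) (at y)"
      by (rule antiderivative_on_open_interval[of "-B" B "\<lambda>y. 1 / (r y)\<^sup>2"])
         (auto intro!: continuous_intros r_cont)
    have "continuous_on {-B..B} (\<lambda>y. G y / of_real ((r y)\<^sup>2))"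
      by (intro continuous_intros r_cont contG) auto
    then obtain \<Gamma> where \<Gamma>: "\<And>y. y \<in> {-B<..<B} \<Longrightarrow> (\<Gamma> has_vector_derivative G y / of_real ((r y)\<^sup>2)) (at y)"
      using antiderivative_on_open_interval by blast
    have lim2: "(\<lambda>n. (c n * \<phi> n y - c n * \<phi> n x) - c n * K n (-B) * of_real (\<rho> y - \<rho> x)) \<longlonglongrightarrow> \<Gamma> y - \<Gamma> x"
      if x: "x \<in> {-B<..<B}" and y: "y \<in> {-B<..<B}" and xy: "x \<le> y" for x y
    proof -
      define D where "D = (\<lambda>n s. c n * \<phi> n s - c n * K n (-B) * of_real (\<rho> s) - \<Gamma> s)"
      have "cmod (D n y - D n x) \<le> e B n / rm\<^sup>2 * y - e B n / rm\<^sup>2 * x" for n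
      proof (rule norm_diff_le_of_deriv_bound[OF xy])
        fix s assume s: "x \<le> s" "s \<le> y"
        have sB: "s \<in> {-B<..<B}" using s x y by auto
        have \<rho>': "((\<lambda>s. complex_of_real (\<rho> s)) has_vector_derivative of_real (1 / (r s)\<^sup>2)) (at s)"
          by (intro has_vector_derivative_of_real) (use \<rho>[OF sB] in \<open>simp add: has_real_derivative_iff_has_vector_derivative\<close>)
        have \<phi>': "(\<phi> n has_vector_derivative K n s / of_real ((r s)\<^sup>2)) (at s)"
          using sol[of n] by (simp add: weak_sol_def)
        show "(D n has_vector_derivative c n * (K n s / of_real ((r s)\<^sup>2)) - c n * K n (-B) * of_real (1 / (r s)\<^sup>2) - G s / of_real ((r s)\<^sup>2)) (at s)"
          unfolding D_def by (intro derivative_intros has_vector_derivative_mult_right \<rho>' \<phi>' \<Gamma>[OF sB])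
        have "cmod (c n * (K n s / of_real ((r s)\<^sup>2)) - c n * K n (-B) * of_real (1 / (r s)\<^sup>2) - G s / of_real ((r s)\<^sup>2))
           = cmod (((c n * K n s - c n * K n (-B)) - G s) / of_real ((r s)\<^sup>2))"
          by (simp add: diff_divide_distrib)
        also have "\<dots> = cmod ((c n * K n s - c n * K n (-B)) - G s) / (r s)\<^sup>2"
          by (simp add: norm_divide norm_power)
        also have "\<dots> \<le> e B n / rm\<^sup>2"
        proof (rule frac_le)
          show "cmod ((c n * K n s - c n * K n (-B)) - G s) \<le> e B n"
            unfolding G_def by (rule Kerr) (use sB in auto)
          show "rm\<^sup>2 \<le> (r s)\<^sup>2" using r_bounds(1)[of s] rm by (intro power_mono) auto
        qed (use rm in \<open>auto simp: e_def L1_seminorm_nonneg\<close>)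
        finally show "cmod (c n * (K n s / of_real ((r s)\<^sup>2)) - c n * K n (-B) * of_real (1 / (r s)\<^sup>2) - G s / of_real ((r s)\<^sup>2)) \<le> e B n / rm\<^sup>2" .
      qed (rule DERIV_cmult_Id)
      moreover have "(\<lambda>n. e B n / rm\<^sup>2 * y - e B n / rm\<^sup>2 * x) \<longlonglongrightarrow> 0 / rm\<^sup>2 * y - 0 / rm\<^sup>2 * x"
        by (intro tendsto_intros e0) (use rm in auto)
      ultimately have "(\<lambda>n. D n y - D n x) \<longlonglongrightarrow> 0"
        by (intro Lim_null_comparison[of "\<lambda>n. D n y - D n x" "\<lambda>n. e B n / rm\<^sup>2 * y - e B n / rm\<^sup>2 * x"]) auto
      then have "(\<lambda>n. (D n y - D n x) + (\<Gamma> y - \<Gamma> x)) \<longlonglongrightarrow> 0 + (\<Gamma> y - \<Gamma> x)" by (intro tendsto_intros)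
      then show ?thesis by (simp add: D_def algebra_simps)
    qed
    have "(\<lambda>n. c n * K n y - c n * K n (-B)) \<longlonglongrightarrow> G y" if "y \<in> {-B<..<B}" for y
      unfolding G_def by (rule Klim) (use that in auto)
    then show ?thesis using \<rho> \<Gamma> lim2 by blast
  qed
  \<comment> \<open>\<open>x1\<close> and \<open>x2\<close> do not depend on \<open>B\<close>, so
    one subsequence serves every interval; the halves (-1, 0) and (0, 1) ensure
    \<open>x1 < x2\<close>.\<close>
  obtain s where s: "strict_mono s" and s_ae: "AE x in lborel. x \<in> {-1..1} \<longrightarrow> (\<lambda>n. h (s n) x) \<longlonglongrightarrow> 0"
    using L1_seminorm_AE_subseq[of 1 h, OF ih] hlim[of 1] by blast
  obtain x1 where x1: "-1 < x1" "x1 < 0" "(\<lambda>n. h (s n) x1) \<longlonglongrightarrow> 0"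
    using AE_real_interval_obtain[OF s_ae, of "-1" 0] by auto
  obtain x2 where x2: "0 < x2" "x2 < 1" "(\<lambda>n. h (s n) x2) \<longlonglongrightarrow> 0"
    using AE_real_interval_obtain[OF s_ae, of 0 1] by auto
  note sub = LIMSEQ_subseq_LIMSEQ[OF _ s, unfolded o_def]
  have \<phi>_pt: "(\<lambda>n. c (s n) * \<phi> (s n) x) \<longlonglongrightarrow> U x / of_real (r x)" if "(\<lambda>n. h (s n) x) \<longlonglongrightarrow> 0" for x
  proof -
    have "(\<lambda>n. (h (s n) x + U x) / of_real (r x)) \<longlonglongrightarrow> (0 + U x) / of_real (r x)"
      by (intro tendsto_intros that) auto
    then show ?thesis by (simp add: h_def sol_u_def)
  qed
  have conv: "\<exists>k L \<rho> \<Gamma> G. (\<forall>y\<in>{-B<..<B}. (\<rho> has_vector_derivative 1 / (r y)\<^sup>2) (at y) \<and>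
        (\<Gamma> has_vector_derivative G y / of_real ((r y)\<^sup>2)) (at y) \<and>
        (\<lambda>n. c (s n) * K (s n) y) \<longlonglongrightarrow> k + G y \<and>
        (\<lambda>n. c (s n) * \<phi> (s n) y) \<longlonglongrightarrow> L + k * of_real (\<rho> y) + \<Gamma> y)" if B: "B \<ge> 1" for B
  proof -
    obtain \<rho> \<Gamma> G where \<rho>: "\<And>y. y \<in> {-B<..<B} \<Longrightarrow> (\<rho> has_vector_derivative 1 / (r y)\<^sup>2) (at y)"
      and \<Gamma>: "\<And>y. y \<in> {-B<..<B} \<Longrightarrow> (\<Gamma> has_vector_derivative G y / of_real ((r y)\<^sup>2)) (at y)"
      and G: "\<And>y. y \<in> {-B<..<B} \<Longrightarrow> (\<lambda>n. c n * K n y - c n * K n (-B)) \<longlonglongrightarrow> G y"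
      and \<phi>d: "\<And>x y. x \<in> {-B<..<B} \<Longrightarrow> y \<in> {-B<..<B} \<Longrightarrow> x \<le> y \<Longrightarrow>
        (\<lambda>n. (c n * \<phi> n y - c n * \<phi> n x) - c n * K n (-B) * of_real (\<rho> y - \<rho> x)) \<longlonglongrightarrow> \<Gamma> y - \<Gamma> x"
      using key[of B] by blast
    have xB: "x1 \<in> {-B<..<B}" "x2 \<in> {-B<..<B}" using x1 x2 B by auto
    have "\<rho> x1 < \<rho> x2"
    proof (rule DERIV_pos_imp_increasing[of x1 x2 \<rho>])
      show "\<exists>y. (\<rho> has_real_derivative y) (at x) \<and> 0 < y" if "x1 \<le> x" "x \<le> x2" for x
        using \<rho>[of x] that xB r_pos[of x]
        by (intro exI[of _ "1 / (r x)\<^sup>2"]) (auto simp: has_real_derivative_iff_has_vector_derivative)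
    qed (use x1 x2 in auto)
    then have \<rho>ne: "complex_of_real (\<rho> x2 - \<rho> x1) \<noteq> 0" by simp
    define kn where "kn = (\<lambda>n. c (s n) * K (s n) (-B))"
    \<comment> \<open>The only value compatible with the increment of the limit between
      \<open>x1\<close> and \<open>x2\<close>; the division is possible because
      \<open>\<rho>\<close> is strictly increasing.\<close>
    define k where "k = (U x2 / of_real (r x2) - U x1 / of_real (r x1) - (\<Gamma> x2 - \<Gamma> x1)) / of_real (\<rho> x2 - \<rho> x1)"
    have k: "kn \<longlonglongrightarrow> k"
    proof -
      have "(\<lambda>n. (c (s n) * \<phi> (s n) x2 - c (s n) * \<phi> (s n) x1
           - ((c (s n) * \<phi> (s n) x2 - c (s n) * \<phi> (s n) x1) - c (s n) * K (s n) (-B) * of_real (\<rho> x2 - \<rho> x1))) / of_real (\<rho> x2 - \<rho> x1)) \<longlonglongrightarrow> k"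
        unfolding k_def
        by (intro tendsto_intros \<phi>_pt x1(3) x2(3) sub[OF \<phi>d[OF xB]] \<rho>ne) (use x1 x2 in auto)
      then show ?thesis using \<rho>ne by (simp add: kn_def)
    qed
    define L where "L = U x1 / of_real (r x1) - k * of_real (\<rho> x1) - \<Gamma> x1"
    have "(\<lambda>n. c (s n) * \<phi> (s n) y) \<longlonglongrightarrow> L + k * of_real (\<rho> y) + \<Gamma> y" if y: "y \<in> {-B<..<B}" for y
    proof (cases "x1 \<le> y")
      case True
      have "(\<lambda>n. ((c (s n) * \<phi> (s n) y - c (s n) * \<phi> (s n) x1) - c (s n) * K (s n) (-B) * of_real (\<rho> y - \<rho> x1))
          + c (s n) * \<phi> (s n) x1 + kn n * of_real (\<rho> y - \<rho> x1)) \<longlonglongrightarrow> (\<Gamma> y - \<Gamma> x1) + U x1 / of_real (r x1) + k * of_real (\<rho> y - \<rho> x1)"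
        by (intro tendsto_add sub[OF \<phi>d[OF xB(1) y True]] \<phi>_pt x1(3) tendsto_mult k tendsto_const)
      then show ?thesis by (simp add: kn_def L_def algebra_simps)
    next
      case False
      then have "y \<le> x1" by simp
      have "(\<lambda>n. c (s n) * \<phi> (s n) x1 - ((c (s n) * \<phi> (s n) x1 - c (s n) * \<phi> (s n) y) - c (s n) * K (s n) (-B) * of_real (\<rho> x1 - \<rho> y))
          - kn n * of_real (\<rho> x1 - \<rho> y)) \<longlonglongrightarrow> U x1 / of_real (r x1) - (\<Gamma> x1 - \<Gamma> y) - k * of_real (\<rho> x1 - \<rho> y)"
        by (intro tendsto_diff sub[OF \<phi>d[OF y xB(1) \<open>y \<le> x1\<close>]] \<phi>_pt x1(3) tendsto_mult k tendsto_const)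
      then show ?thesis by (simp add: kn_def L_def algebra_simps)
    qed
    moreover have "(\<lambda>n. c (s n) * K (s n) y) \<longlonglongrightarrow> k + G y" if y: "y \<in> {-B<..<B}" for y
      using tendsto_add[OF k sub[OF G[OF y]]] by (simp add: kn_def)
    ultimately show ?thesis using \<rho> \<Gamma> by blast
  qed
  \<comment> \<open>Defining the limits by \<open>lim\<close> glues the formulas found on the
    intervals (-B, B), whose constants and antiderivatives depend on \<open>B\<close>.\<close>
  define \<phi>' where "\<phi>' = (\<lambda>y. lim (\<lambda>n. c (s n) * \<phi> (s n) y))"
  define K' where "K' = (\<lambda>y. lim (\<lambda>n. c (s n) * K (s n) y))"
  have in_B: "\<exists>B\<ge>1. y \<in> {-B<..<B}" for y :: real
    by (intro exI[of _ "\<bar>y\<bar> + 1"]) auto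
  have \<phi>': "(\<lambda>n. c (s n) * \<phi> (s n) y) \<longlonglongrightarrow> \<phi>' y" and K': "(\<lambda>n. c (s n) * K (s n) y) \<longlonglongrightarrow> K' y" for y
  proof -
    obtain B where "B \<ge> 1" "y \<in> {-B<..<B}" using in_B by blast
    with conv[of B] show "(\<lambda>n. c (s n) * \<phi> (s n) y) \<longlonglongrightarrow> \<phi>' y" "(\<lambda>n. c (s n) * K (s n) y) \<longlonglongrightarrow> K' y"
      unfolding \<phi>'_def K'_def by (metis convergentI convergent_LIMSEQ_iff)+
  qed
  have \<phi>'_deriv: "(\<phi>' has_vector_derivative K' y / of_real ((r y)\<^sup>2)) (at y)" for y
  proof -
    obtain B where B: "B \<ge> 1" "y \<in> {-B<..<B}" using in_B by blast
    obtain k L \<rho> \<Gamma> G where \<rho>: "\<And>y. y \<in> {-B<..<B} \<Longrightarrow> (\<rho> has_vector_derivative 1 / (r y)\<^sup>2) (at y)"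
      and \<Gamma>: "\<And>y. y \<in> {-B<..<B} \<Longrightarrow> (\<Gamma> has_vector_derivative G y / of_real ((r y)\<^sup>2)) (at y)"
      and G: "\<And>y. y \<in> {-B<..<B} \<Longrightarrow> (\<lambda>n. c (s n) * K (s n) y) \<longlonglongrightarrow> k + G y"
      and p: "\<And>y. y \<in> {-B<..<B} \<Longrightarrow> (\<lambda>n. c (s n) * \<phi> (s n) y) \<longlonglongrightarrow> L + k * of_real (\<rho> y) + \<Gamma> y"
      using conv[OF B(1)] by blast
    have \<rho>': "((\<lambda>s. complex_of_real (\<rho> s)) has_vector_derivative of_real (1 / (r y)\<^sup>2)) (at y)"
      by (intro has_vector_derivative_of_real) (use \<rho>[OF B(2)] in \<open>simp add: has_real_derivative_iff_has_vector_derivative\<close>)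
    have "((\<lambda>y. L + k * of_real (\<rho> y) + \<Gamma> y) has_vector_derivative 0 + k * of_real (1 / (r y)\<^sup>2) + G y / of_real ((r y)\<^sup>2)) (at y)"
      by (intro derivative_intros has_vector_derivative_mult_right \<rho>' \<Gamma>[OF B(2)])
    moreover have "0 + k * of_real (1 / (r y)\<^sup>2) + G y / of_real ((r y)\<^sup>2) = K' y / of_real ((r y)\<^sup>2)"
      using LIMSEQ_unique[OF K' G[OF B(2)]] by (simp add: add_divide_distrib)
    ultimately have "((\<lambda>y. L + k * of_real (\<rho> y) + \<Gamma> y) has_vector_derivative K' y / of_real ((r y)\<^sup>2)) (at y)"
      by simp
    then show ?thesis
      by (rule has_vector_derivative_transform_within_open[of _ _ _ "{-B<..<B}"])
         (use B LIMSEQ_unique[OF p \<phi>'] in auto)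
  qed
  have Kd: "K' d - K' b = (LINT x:{b..d}|lborel. g x)" if "b \<le> d" for b d
    by (rule LIMSEQ_unique[OF tendsto_diff[OF K' K'] sub[OF Klim[OF that]]])
  have Uae: "AE x in lborel. U x = sol_u \<phi>' x"
  proof -
    \<comment> \<open>On each interval a further subsequence converges almost everywhere to
      \<open>U\<close>; the limit along \<open>s\<close> already exists at every point, so the two
      agree.\<close>
    have "AE x in lborel. x \<in> {- real m..real m} \<longrightarrow> U x = sol_u \<phi>' x" for m
    proof -
      have "(\<lambda>n. L1_seminorm (real m) (h (s n))) \<longlonglongrightarrow> 0" by (rule sub[OF hlim])
      then obtain q where q: "strict_mono q" "AE x in lborel. x \<in> {- real m..real m} \<longrightarrow> (\<lambda>n. h (s (q n)) x) \<longlonglongrightarrow> 0"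
        using L1_seminorm_AE_subseq[of "real m" "\<lambda>n. h (s n)", OF ih] by blast
      from q(2) show ?thesis
      proof eventually_elim
        case (elim x)
        show ?case
        proof
          assume "x \<in> {- real m..real m}"
          with elim have 1: "(\<lambda>n. h (s (q n)) x) \<longlonglongrightarrow> 0" by simp
          have "(\<lambda>n. of_real (r x) * (c (s (q n)) * \<phi> (s (q n)) x) - U x) \<longlonglongrightarrow> of_real (r x) * \<phi>' x - U x"
            by (intro tendsto_intros LIMSEQ_subseq_LIMSEQ[OF \<phi>' q(1), unfolded o_def])
          then have "(\<lambda>n. h (s (q n)) x) \<longlonglongrightarrow> sol_u \<phi>' x - U x"
            by (simp add: h_def sol_u_def mult_ac)
          from LIMSEQ_unique[OF this 1] show "U x = sol_u \<phi>' x" by simp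
        qed
      qed
    qed
    then have "AE x in lborel. \<forall>m. x \<in> {- real m..real m} \<longrightarrow> U x = sol_u \<phi>' x"
      unfolding AE_all_countable by blast
    then show ?thesis
    proof eventually_elim
      case (elim x)
      obtain m where "\<bar>x\<bar> \<le> real m" using real_arch_simple by blast
      then have "x \<in> {- real m..real m}" by auto
      then show ?case using elim by blast
    qed
  qed
  have cont': "continuous_on S (sol_u \<phi>')" for S
    unfolding sol_u_def using \<phi>'_deriv
    by (intro continuous_intros r_cont continuous_at_imp_continuous_on) (auto intro: has_vector_derivative_continuous)
  have "weak_sol z0 (\<lambda>_. 0) \<phi>' K'"
    unfolding weak_sol_def
  proof (intro conjI allI impI)
    show "continuous_on UNIV K'" by (rule continuous_on_indefinite_integral[OF ig Kd])
    show "(\<phi>' has_vector_derivative K' x / of_real ((r x)\<^sup>2)) (at x)" for x by (rule \<phi>'_deriv)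
    fix b d :: real assume "b \<le> d"
    have [measurable]: "sol_u \<phi>' \<in> borel_measurable borel" using cont' by (rule borel_measurable_continuous_onI)
    have "AE x in lborel. g x = of_real (r x) * (of_real (V x) - z0\<^sup>2) * sol_u \<phi>' x"
      using Uae by eventually_elim (simp add: g_def)
    then have "(LINT x:{b..d}|lborel. g x) = (LINT x:{b..d}|lborel. of_real (r x) * (of_real (V x) - z0\<^sup>2) * sol_u \<phi>' x)"
      by (intro set_integral_cong_AE_integrable(1)[OF ig]) auto
    then show "K' d - K' b = (LINT x:{b..d}|lborel. of_real (r x) * ((of_real (V x) - z0\<^sup>2) * (of_real (r x) * \<phi>' x) - 0))"
      unfolding Kd[OF \<open>b \<le> d\<close>] by (simp add: sol_u_def mult.assoc)
  qed
  then show thesis using that[OF s \<phi>' K' _ Uae] by blast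
qed

end

section \<open>Solutions at real energies\<close>

context regge_wheeler
begin

lemma homogeneous_K_deriv:
  assumes "weak_sol z (\<lambda>_. 0) \<phi> K"
  shows "(K has_vector_derivative of_real (r x) * ((of_real (V x) - z\<^sup>2) * sol_u \<phi> x)) (at x)"
  by (rule weak_sol_K_deriv[OF assms, of 1]) auto

lemma homogeneous_du_deriv:
  assumes "weak_sol z (\<lambda>_. 0) \<phi> K"
  shows "(sol_du \<phi> K has_vector_derivative (of_real (W x) - z\<^sup>2) * sol_u \<phi> x) (at x)"
  by (rule sol_du_deriv[OF assms homogeneous_K_deriv[OF assms]])

lemma r1_nonneg: "r1 x \<ge> 0"
  using order_trans[OF abs_ge_zero W_le[of x]] C by (simp add: zero_le_mult_iff)

text \<open>The energy \<open>\<bar>u'\<bar>\<^sup>2 + t\<^sup>2 \<bar>u\<bar>\<^sup>2\<close> has logarithmic derivative at most \<open>C r' / \<bar>t\<bar>\<close>.\<close>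

lemma energy_zero:
  assumes sol: "weak_sol (of_real t) (\<lambda>_. 0) \<phi> K" and t: "t \<noteq> 0"
    and zero: "(sol_u \<phi> x0 = 0 \<and> sol_du \<phi> K x0 = 0) \<or>
      ((sol_u \<phi> \<longlongrightarrow> 0) at_top \<and> (sol_du \<phi> K \<longlongrightarrow> 0) at_top)"
  shows "\<phi> x = 0"
proof -
  define u where "u = sol_u \<phi>"
  define du where "du = sol_du \<phi> K"
  have u': "(u has_vector_derivative du x) (at x)" for x
    unfolding u_def du_def by (rule sol_u_deriv[OF sol])
  have du': "(du has_vector_derivative (of_real (W x) - (of_real t)\<^sup>2) * u x) (at x)" for x
    unfolding u_def du_def by (rule homogeneous_du_deriv[OF sol])
  define E where "E = (\<lambda>x. (cmod (du x))\<^sup>2 + t\<^sup>2 * (cmod (u x))\<^sup>2)"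
  define E1 where "E1 = (\<lambda>x. 2 * W x * Re (cnj (du x) * u x))"
  have E': "(E has_real_derivative E1 x) (at x)" for x
  proof -
    have "(E has_real_derivative 2 * Re (cnj (du x) * ((of_real (W x) - (of_real t)\<^sup>2) * u x))
        + t\<^sup>2 * (2 * Re (cnj (u x) * du x))) (at x)"
      unfolding E_def
      by (intro DERIV_add DERIV_cmult has_vector_derivative_cmod_power2 u' du')
    moreover have "2 * Re (cnj (du x) * ((of_real (W x) - (of_real t)\<^sup>2) * u x))
        + t\<^sup>2 * (2 * Re (cnj (u x) * du x)) = E1 x"
    proof -
      have "(of_real (W x) - (of_real t)\<^sup>2 :: complex) = of_real (W x - t\<^sup>2)" by simp
      then show ?thesis unfolding E1_def by (simp del: of_real_diff add: algebra_simps)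
    qed
    ultimately show ?thesis by simp
  qed
  \<comment> \<open>From 2 |u'| |t u| \<le> E; the division by |t| reflects the degeneration of this
    energy at t = 0.\<close>
  define \<kappa> where "\<kappa> = C / \<bar>t\<bar>"
  have E_nonneg: "E x \<ge> 0" for x by (simp add: E_def)
  have E1_le: "\<bar>E1 x\<bar> \<le> \<kappa> * r1 x * E x" for x
  proof -
    have "\<bar>E1 x\<bar> = 2 * \<bar>W x\<bar> * \<bar>Re (cnj (du x) * u x)\<bar>" by (simp add: E1_def abs_mult)
    also have "\<dots> \<le> 2 * (C * r1 x) * (cmod (du x) * cmod (u x))"
      using W_le[of x] C r1_nonneg[of x] abs_Re_le_cmod[of "cnj (du x) * u x"]
      by (intro mult_mono) (auto simp: norm_mult)
    also have "\<dots> = \<kappa> * r1 x * (2 * cmod (du x) * (\<bar>t\<bar> * cmod (u x)))"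
      using t by (simp add: \<kappa>_def field_simps)
    also have "\<dots> \<le> \<kappa> * r1 x * E x"
    proof (rule mult_left_mono)
      show "2 * cmod (du x) * (\<bar>t\<bar> * cmod (u x)) \<le> E x"
        using zero_le_power2[of "cmod (du x) - \<bar>t\<bar> * cmod (u x)"]
        by (simp add: E_def power2_diff power_mult_distrib)
      show "0 \<le> \<kappa> * r1 x" using C r1_nonneg by (simp add: \<kappa>_def)
    qed
    finally show ?thesis .
  qed
  have deriv: "((\<lambda>x. E x * exp (k * r x)) has_real_derivative exp (k * r x) * (E1 x + k * r1 x * E x)) (at x)" for k x
    by (auto intro!: derivative_eq_intros E' r_deriv simp: algebra_simps)
  \<comment> \<open>As \<open>\<kappa> * r1\<close> is the derivative of
    \<open>\<kappa> * r\<close>, the Gronwall factors are exponentials of the bounded function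
    \<open>r\<close>. They neither vanish nor blow up at infinity, so a zero limit of
    \<open>E\<close> there acts like a zero at a finite point.\<close>
  have up: "E x * exp (\<kappa> * r x) \<le> E y * exp (\<kappa> * r y)" if "x \<le> y" for x y
  proof (rule DERIV_nonneg_imp_nondecreasing[OF that, where f = "\<lambda>x. E x * exp (\<kappa> * r x)"])
    fix s
    have "0 \<le> E1 s + \<kappa> * r1 s * E s" using E1_le[of s] by linarith
    then show "\<exists>y. ((\<lambda>x. E x * exp (\<kappa> * r x)) has_real_derivative y) (at s) \<and> 0 \<le> y"
      using deriv[of \<kappa> s] by (blast intro: mult_nonneg_nonneg exp_ge_zero)
  qed
  have down: "E y * exp (- \<kappa> * r y) \<le> E x * exp (- \<kappa> * r x)" if "x \<le> y" for x y
  proof (rule DERIV_nonpos_imp_nonincreasing[OF that, where f = "\<lambda>x. E x * exp (- \<kappa> * r x)"])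
    fix s
    have "E1 s + - \<kappa> * r1 s * E s \<le> 0" using E1_le[of s] by linarith
    then show "\<exists>y. ((\<lambda>x. E x * exp (- \<kappa> * r x)) has_real_derivative y) (at s) \<and> y \<le> 0"
      using deriv[of "- \<kappa>" s] by (blast intro: mult_nonneg_nonpos exp_ge_zero)
  qed
  have "E x \<le> 0"
    using zero
  proof
    assume "sol_u \<phi> x0 = 0 \<and> sol_du \<phi> K x0 = 0"
    then have "E x0 = 0" by (simp add: E_def u_def du_def)
    then show ?thesis
      using up[of x x0] down[of x0 x] by (cases "x \<le> x0") (auto simp: mult_le_0_iff)
  next
    assume lim: "(sol_u \<phi> \<longlongrightarrow> 0) at_top \<and> (sol_du \<phi> K \<longlongrightarrow> 0) at_top"
    have "((\<lambda>x. E x * exp (\<kappa> * r x)) \<longlongrightarrow> ((cmod 0)\<^sup>2 + t\<^sup>2 * (cmod 0)\<^sup>2) * exp (\<kappa> * rp)) at_top"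
      unfolding E_def u_def du_def by (intro tendsto_intros r_lim) (use lim in auto)
    then have "E x * exp (\<kappa> * r x) \<le> ((cmod 0)\<^sup>2 + t\<^sup>2 * (cmod 0)\<^sup>2) * exp (\<kappa> * rp)"
      by (rule tendsto_lowerbound) (use up in \<open>blast intro: eventually_at_top_linorderI[of x]\<close>, simp)
    then show ?thesis by (simp add: mult_le_0_iff)
  qed
  moreover have "0 \<le> t\<^sup>2 * (cmod (u x))\<^sup>2" "0 \<le> (cmod (du x))\<^sup>2" by simp_all
  ultimately have "t\<^sup>2 * (cmod (u x))\<^sup>2 = 0" unfolding E_def by linarith
  then show ?thesis using t by (simp add: u_def sol_u_def)
qed

lemma zero_energy_constant:
  assumes sol: "weak_sol 0 (\<lambda>_. 0) \<phi> K"
    and lim: "((\<lambda>x. K x * cnj (\<phi> x)) \<longlongrightarrow> 0) at_top" "((\<lambda>x. K x * cnj (\<phi> x)) \<longlongrightarrow> 0) at_bot"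
  shows "K x = 0" "V x = 0 \<or> \<phi> x = 0" "\<exists>c. \<forall>x. \<phi> x = c"
proof -
  have \<phi>': "(\<phi> has_vector_derivative K x / of_real ((r x)\<^sup>2)) (at x)" for x
    using sol by (simp add: weak_sol_def)
  have K': "(K has_vector_derivative of_real (r x) * (of_real (V x) * (of_real (r x) * \<phi> x))) (at x)" for x
    using homogeneous_K_deriv[OF sol] by (simp add: sol_u_def)
  define g where "g = (\<lambda>x. Re (K x * cnj (\<phi> x)))"
  \<comment> \<open>For u = r \<phi> this is V |u|^2 + r^2 |\<phi>'|^2. Once \<open>g\<close>
    vanishes identically, both nonnegative terms do: the second makes \<phi> constant, the first
    gives the alternative between \<open>V\<close> and \<phi>.\<close>
  define g1 where "g1 = (\<lambda>x. V x * (cmod (of_real (r x) * \<phi> x))\<^sup>2 + (cmod (K x))\<^sup>2 / (r x)\<^sup>2)"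
  have g': "(g has_real_derivative g1 x) (at x)" for x
  proof -
    have 1: "(g has_real_derivative Re (K x * cnj (K x / of_real ((r x)\<^sup>2))
        + of_real (r x) * (of_real (V x) * (of_real (r x) * \<phi> x)) * cnj (\<phi> x))) (at x)"
      unfolding g_def by (intro has_field_derivative_Re derivative_intros K' \<phi>')
    have 2: "K x * cnj (K x / of_real ((r x)\<^sup>2)) + of_real (r x) * (of_real (V x) * (of_real (r x) * \<phi> x)) * cnj (\<phi> x)
      = of_real (g1 x)"
      unfolding g1_def norm_mult power_mult_distrib of_real_add of_real_mult of_real_divide complex_norm_square
      by (simp add: power2_eq_square)
    from 1 show ?thesis unfolding 2 by simp
  qed
  have g1: "g1 x \<ge> 0" for x using V_nonneg[of x] by (simp add: g1_def)
  have mono: "g x \<le> g y" if "x \<le> y" for x y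
    using g' g1 by (intro DERIV_nonneg_imp_nondecreasing[OF that]) blast
  have gl: "(g \<longlongrightarrow> 0) at_top" "(g \<longlongrightarrow> 0) at_bot"
    unfolding g_def using tendsto_Re[OF lim(1)] tendsto_Re[OF lim(2)] by simp_all
  have g0: "g x = 0" for x
  proof (rule antisym)
    show "g x \<le> 0" by (rule tendsto_lowerbound[OF gl(1)])
       (use mono in \<open>blast intro: eventually_at_top_linorderI[of x]\<close>, simp)
    show "0 \<le> g x" by (rule tendsto_upperbound[OF gl(2)])
       (use mono in \<open>blast intro: eventually_at_bot_linorderI[of x]\<close>, simp)
  qed
  have "g = (\<lambda>_. 0)" using g0 by auto
  then have g10: "g1 x = 0" for x using g'[of x] DERIV_unique[OF _ DERIV_const[of 0]] by auto
  have "V x * (cmod (of_real (r x) * \<phi> x))\<^sup>2 = 0 \<and> (cmod (K x))\<^sup>2 / (r x)\<^sup>2 = 0" for x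
    using g10[of x] V_nonneg[of x] unfolding g1_def by (subst (asm) add_nonneg_eq_0_iff) auto
  then have KV: "K x = 0" "V x = 0 \<or> \<phi> x = 0" for x by auto
  then show "K x = 0" "V x = 0 \<or> \<phi> x = 0" by auto
  have "(\<phi> has_vector_derivative 0) (at x within UNIV)" for x using \<phi>'[of x] KV(1)[of x] by simp
  then have "\<exists>c. \<forall>x\<in>UNIV. \<phi> x = c" by (rule has_vector_derivative_zero_constant[OF convex_UNIV]) blast
  then show "\<exists>c. \<forall>x. \<phi> x = c" by blast
qed

text \<open>\<open>K\<close> is the Wronskian r u' - r' u; this identity connects the weak form of
  the equation with \<open>zero_energy_flux\<close>.\<close>

lemma K_eq: "K x = of_real (r x) * sol_du \<phi> K x - of_real (r1 x) * sol_u \<phi> x"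
  by (simp add: sol_u_def sol_du_def algebra_simps)

text \<open>Boundedness of u is enough, because both terms of the Wronskian then tend to 0. This
  covers the state r itself, which does not decay.\<close>

lemma K_cnj_tendsto_0:
  assumes "(sol_du \<phi> K \<longlongrightarrow> 0) F" "(r1 \<longlongrightarrow> 0) F" "eventually (\<lambda>x. cmod (sol_u \<phi> x) \<le> B) F"
  shows "((\<lambda>x. K x * cnj (\<phi> x)) \<longlongrightarrow> 0) F"
proof (rule Lim_null_comparison)
  show "eventually (\<lambda>x. cmod (K x * cnj (\<phi> x)) \<le> (rp * cmod (sol_du \<phi> K x) + \<bar>r1 x\<bar> * B) * (B / rm)) F"
    using assms(3)
  proof eventually_elim
    case (elim x)
    have "cmod (K x) \<le> cmod (of_real (r x) * sol_du \<phi> K x) + cmod (of_real (r1 x) * sol_u \<phi> x)"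
      by (subst K_eq[of K x \<phi>]) (rule norm_triangle_ineq4)
    also have "\<dots> \<le> rp * cmod (sol_du \<phi> K x) + \<bar>r1 x\<bar> * B"
      unfolding norm_mult using r_bounds(2)[of x] r_pos[of x] elim by (intro add_mono mult_mono) auto
    finally have 1: "cmod (K x) \<le> \<dots>" .
    have "rm * cmod (\<phi> x) \<le> r x * cmod (\<phi> x)" using r_bounds(1)[of x] by (intro mult_right_mono) auto
    also have "\<dots> \<le> B" using elim r_pos[of x] by (simp add: sol_u_def norm_mult)
    finally have 2: "cmod (\<phi> x) \<le> B / rm" using rm by (simp add: field_simps)
    show ?case unfolding norm_mult complex_mod_cnj
      using 1 2 by (intro mult_mono) (auto intro: order_trans[OF norm_ge_zero])
  qed
  have "((\<lambda>x. (rp * cmod (sol_du \<phi> K x) + \<bar>r1 x\<bar> * B) * (B / rm)) \<longlongrightarrow> (rp * cmod 0 + \<bar>0\<bar> * B) * (B / rm)) F"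
    by (intro tendsto_intros assms) (use rm in auto)
  then show "((\<lambda>x. (rp * cmod (sol_du \<phi> K x) + \<bar>r1 x\<bar> * B) * (B / rm)) \<longlongrightarrow> 0) F" by simp
qed

text \<open>These are the inequalities inherited from the upper half plane, with one threshold for
  both ends. Unlike an asymptotic form e^(itx) they keep their strength at t = 0, where they bound
  u' by the distance of r to its limit.\<close>

definition outgoing :: "real \<Rightarrow> (real \<Rightarrow> complex) \<Rightarrow> (real \<Rightarrow> complex) \<Rightarrow> bool" where
  "outgoing t \<phi> K \<longleftrightarrow> (\<exists>x0\<ge>0. \<forall>x\<ge>x0. \<forall>y\<ge>x.
     cmod (sol_u \<phi> y) \<le> 2 * cmod (sol_u \<phi> x) \<and>
     cmod (sol_du \<phi> K y - \<i> * of_real t * sol_u \<phi> y) \<le> 2 * C * (rp - r y) * cmod (sol_u \<phi> x) \<and>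
     cmod (sol_u \<phi> (- y)) \<le> 2 * cmod (sol_u \<phi> (- x)) \<and>
     cmod (- sol_du \<phi> K (- y) - \<i> * of_real t * sol_u \<phi> (- y)) \<le> 2 * C * (r (- y) - rm) * cmod (sol_u \<phi> (- x)))"

text \<open>The flux \<open>Im (cnj u u')\<close> is constant, whereas an outgoing solution makes it
  \<open>\<approx> t \<bar>u\<bar>\<^sup>2\<close> at \<open>\<infinity>\<close> and \<open>\<approx> - t \<bar>u\<bar>\<^sup>2\<close> at \<open>- \<infinity>\<close>.\<close>

lemma outgoing_nonzero_energy:
  assumes sol: "weak_sol (of_real t) (\<lambda>_. 0) \<phi> K" and t: "t \<noteq> 0" and out: "outgoing t \<phi> K"
  shows "\<phi> x = 0"
proof -
  define u where "u = sol_u \<phi>"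
  define du where "du = sol_du \<phi> K"
  obtain x0 where x0: "x0 \<ge> 0" "\<And>x. x \<ge> x0 \<Longrightarrow> cmod (du x - \<i> * of_real t * u x) \<le> 2 * C * (rp - r x) * cmod (u x)"
    "\<And>x. x \<ge> x0 \<Longrightarrow> cmod (- du (- x) - \<i> * of_real t * u (- x)) \<le> 2 * C * (r (- x) - rm) * cmod (u (- x))"
    using out unfolding outgoing_def u_def du_def by blast
  define J where "J = (\<lambda>x. Im (cnj (u x) * du x))"
  have J': "(J has_real_derivative 0) (at x)" for x
  proof -
    have "(J has_real_derivative Im (cnj (u x) * ((of_real (W x) - (of_real t)\<^sup>2) * u x) + cnj (du x) * du x)) (at x)"
      unfolding J_def u_def du_def
      by (intro has_field_derivative_Im derivative_intros sol_u_deriv[OF sol] homogeneous_du_deriv[OF sol])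
    moreover have "cnj (u x) * ((of_real (W x) - (of_real t)\<^sup>2) * u x) + cnj (du x) * du x
       = of_real ((W x - t\<^sup>2) * (cmod (u x))\<^sup>2 + (cmod (du x))\<^sup>2)"
      unfolding of_real_add of_real_mult complex_norm_square by (simp add: algebra_simps)
    ultimately show ?thesis by (simp del: of_real_add of_real_mult)
  qed
  have "(\<exists>c. \<forall>x\<in>UNIV. J x = c)"
    by (rule has_field_derivative_zero_constant) (use J' in \<open>auto intro: has_field_derivative_at_within\<close>)
  then have J_eq: "J x = J y" for x y by auto
  \<comment> \<open>Far out the defect of u' - i t u, relative to |u|, drops below |t|, which gives
    the flux a definite sign.\<close>
  have "eventually (\<lambda>x. 2 * C * (rp - r x) < \<bar>t\<bar>) at_top"
  proof -
    have "((\<lambda>x. 2 * C * (rp - r x)) \<longlongrightarrow> 2 * C * 0) at_top" by (intro tendsto_intros right.d_lim)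
    then show ?thesis using order_tendstoD(2)[of _ "2 * C * 0" at_top "\<bar>t\<bar>"] t by simp
  qed
  moreover have "eventually (\<lambda>x. 2 * C * (r (- x) - rm) < \<bar>t\<bar>) at_top"
  proof -
    have "((\<lambda>x. 2 * C * (r (- x) - rm)) \<longlongrightarrow> 2 * C * 0) at_top" by (intro tendsto_intros left.d_lim)
    then show ?thesis using order_tendstoD(2)[of _ "2 * C * 0" at_top "\<bar>t\<bar>"] t by simp
  qed
  ultimately have "eventually (\<lambda>x. 2 * C * (rp - r x) < \<bar>t\<bar> \<and> 2 * C * (r (- x) - rm) < \<bar>t\<bar> \<and> x \<ge> x0) at_top"
    using eventually_ge_at_top[of x0] by eventually_elim auto
  then obtain x where x: "2 * C * (rp - r x) < \<bar>t\<bar>" "2 * C * (r (- x) - rm) < \<bar>t\<bar>" "x \<ge> x0"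
    by (auto simp: eventually_at_top_linorder)
  \<comment> \<open>With dv = i t v + q the flux is t |v|^2 + Im (cnj v q); the factor
    \<open>sgn t\<close> treats both signs of t at once.\<close>
  have key: "sgn t * Im (cnj v * dv) \<ge> (\<bar>t\<bar> - b) * (cmod v)\<^sup>2"
    if q: "cmod (dv - \<i> * of_real t * v) \<le> b * cmod v" for v dv b
  proof -
    define q where "q = dv - \<i> * of_real t * v"
    have "cnj v * dv = \<i> * of_real (t * (cmod v)\<^sup>2) + cnj v * q"
      unfolding q_def of_real_mult complex_norm_square by (simp add: algebra_simps)
    then have "Im (cnj v * dv) = t * (cmod v)\<^sup>2 + Im (cnj v * q)" by (simp del: of_real_mult)
    moreover have "sgn t * t = \<bar>t\<bar>" by (simp add: abs_sgn mult.commute)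
    ultimately have "sgn t * Im (cnj v * dv) = \<bar>t\<bar> * (cmod v)\<^sup>2 + sgn t * Im (cnj v * q)"
      by (simp only: distrib_left mult.assoc[symmetric])
    moreover have "\<bar>sgn t * Im (cnj v * q)\<bar> \<le> cmod v * (b * cmod v)"
    proof -
      have "\<bar>sgn t * Im (cnj v * q)\<bar> \<le> \<bar>Im (cnj v * q)\<bar>" by (simp add: abs_mult sgn_if)
      also have "\<dots> \<le> cmod v * cmod q" using abs_Im_le_cmod[of "cnj v * q"] by (simp add: norm_mult)
      also have "\<dots> \<le> cmod v * (b * cmod v)" using q unfolding q_def by (intro mult_left_mono) auto
      finally show ?thesis .
    qed
    ultimately show ?thesis by (simp add: algebra_simps power2_eq_square)
  qed
  have k1: "sgn t * J x \<ge> (\<bar>t\<bar> - 2 * C * (rp - r x)) * (cmod (u x))\<^sup>2"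
    unfolding J_def by (rule key[OF x0(2)[OF x(3)]])
  have k2: "- (sgn t * J (- x)) \<ge> (\<bar>t\<bar> - 2 * C * (r (- x) - rm)) * (cmod (u (- x)))\<^sup>2"
  proof -
    have "- (sgn t * J (- x)) = sgn t * Im (cnj (u (- x)) * - du (- x))"
      by (simp add: J_def algebra_simps)
    then show ?thesis using key[OF x0(3)[OF x(3)]] by simp
  qed
  \<comment> \<open>At \<open>- x\<close> the outward derivative is \<open>- du (- x)\<close>, so
    the flux has the opposite sign there. Constancy of \<open>J\<close> then forces
    \<open>u x = 0\<close>, and the outgoing bound forces \<open>du x = 0\<close> at the same
    point.\<close>
  have "sgn t * J (- x) \<le> 0"
  proof -
    have "0 \<le> (\<bar>t\<bar> - 2 * C * (r (- x) - rm)) * (cmod (u (- x)))\<^sup>2"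
      using x(2) by (intro mult_nonneg_nonneg) auto
    from order_trans[OF this k2] show ?thesis by simp
  qed
  then have "(\<bar>t\<bar> - 2 * C * (rp - r x)) * (cmod (u x))\<^sup>2 \<le> 0" using k1 J_eq[of x "- x"] by simp
  then have ux: "u x = 0" using x(1) by (simp add: mult_le_0_iff)
  then have "du x = 0" using x0(2)[OF x(3)] by simp
  with ux show ?thesis using energy_zero[OF sol t, of x] by (simp add: u_def du_def)
qed

text \<open>With the base point fixed at \<open>x0\<close>, the outgoing bounds keep u bounded and
  make u' tend to 0 together with the distance of r to its limit.\<close>

lemma outgoing_zero_energy:
  assumes sol: "weak_sol 0 (\<lambda>_. 0) \<phi> K" and out: "outgoing 0 \<phi> K"
  shows "((\<lambda>x. K x * cnj (\<phi> x)) \<longlongrightarrow> 0) at_top" "((\<lambda>x. K x * cnj (\<phi> x)) \<longlongrightarrow> 0) at_bot"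
proof -
  define u where "u = sol_u \<phi>"
  define du where "du = sol_du \<phi> K"
  obtain x0 where x0: "\<And>x. x \<ge> x0 \<Longrightarrow> cmod (u x) \<le> 2 * cmod (u x0)"
    "\<And>x. x \<ge> x0 \<Longrightarrow> cmod (du x) \<le> 2 * C * (rp - r x) * cmod (u x0)"
    "\<And>x. x \<ge> x0 \<Longrightarrow> cmod (u (- x)) \<le> 2 * cmod (u (- x0))"
    "\<And>x. x \<ge> x0 \<Longrightarrow> cmod (du (- x)) \<le> 2 * C * (r (- x) - rm) * cmod (u (- x0))"
    using out unfolding outgoing_def u_def du_def by simp blast
  have "(du \<longlongrightarrow> 0) at_top"
  proof (rule Lim_null_comparison)
    show "\<forall>\<^sub>F x in at_top. cmod (du x) \<le> 2 * C * (rp - r x) * cmod (u x0)"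
      using x0(2) by (blast intro: eventually_at_top_linorderI[of x0])
    show "((\<lambda>x. 2 * C * (rp - r x) * cmod (u x0)) \<longlongrightarrow> 0) at_top"
      by (intro tendsto_mult_left_zero tendsto_mult_right_zero right.d_lim)
  qed
  then show "((\<lambda>x. K x * cnj (\<phi> x)) \<longlongrightarrow> 0) at_top"
    unfolding u_def du_def
    by (rule K_cnj_tendsto_0[OF _ r1_lim(1), where B = "2 * cmod (u x0)"])
       (use x0(1) in \<open>auto intro!: eventually_at_top_linorderI[of x0] simp: u_def\<close>)
  have "((\<lambda>x. du (- x)) \<longlongrightarrow> 0) at_top"
  proof (rule Lim_null_comparison)
    show "\<forall>\<^sub>F x in at_top. cmod (du (- x)) \<le> 2 * C * (r (- x) - rm) * cmod (u (- x0))"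
      using x0(4) by (blast intro: eventually_at_top_linorderI[of x0])
    show "((\<lambda>x. 2 * C * (r (- x) - rm) * cmod (u (- x0))) \<longlongrightarrow> 0) at_top"
      by (intro tendsto_mult_left_zero tendsto_mult_right_zero left.d_lim)
  qed
  then have "(du \<longlongrightarrow> 0) at_bot" by (simp add: filterlim_at_bot_mirror)
  then show "((\<lambda>x. K x * cnj (\<phi> x)) \<longlongrightarrow> 0) at_bot"
    unfolding u_def du_def
  proof (rule K_cnj_tendsto_0[OF _ r1_lim(2), where B = "2 * cmod (u (- x0))"])
    show "\<forall>\<^sub>F x in at_bot. cmod (sol_u \<phi> x) \<le> 2 * cmod (u (- x0))"
    proof (rule eventually_at_bot_linorderI[of "- x0"])
      fix x assume "x \<le> - x0"
      then show "cmod (sol_u \<phi> x) \<le> 2 * cmod (u (- x0))" using x0(3)[of "- x"] by (simp add: u_def)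
    qed
  qed
qed

text \<open>For t \<noteq> 0 decay at one end is already enough for \<open>energy_zero\<close>. At t
  = 0 the solution is a multiple of r, which is bounded away from 0, so that decay makes the factor
  vanish.\<close>

lemma no_eigenvalue:
  assumes sol: "weak_sol (of_real t) (\<lambda>_. 0) \<phi> K" and ae: "AE x in lborel. u x = sol_u \<phi> x"
    and u: "u \<in> L2"
  shows "\<phi> x = 0"
proof -
  have "right.decaying_sol (of_real t) (0 + 1) (sol_u \<phi>) (sol_du \<phi> K)"
    "left.decaying_sol (of_real t) (0 + 1) (\<lambda>x. sol_u \<phi> (- x)) (\<lambda>x. - sol_du \<phi> K (- x))"
    using weak_sol_decaying[OF sol _ u, of 0] ae by (auto simp: sol_u_def)
  then have lim: "(sol_u \<phi> \<longlongrightarrow> 0) at_top" "(sol_du \<phi> K \<longlongrightarrow> 0) at_top"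
     "((\<lambda>x. sol_u \<phi> (- x)) \<longlongrightarrow> 0) at_top" "((\<lambda>x. - sol_du \<phi> K (- x)) \<longlongrightarrow> 0) at_top"
    by (auto simp: right.decaying_sol_def left.decaying_sol_def)
  show ?thesis
  proof (cases "t = 0")
    case False
    show ?thesis by (rule energy_zero[OF sol False]) (use lim in auto)
  next
    case True
    then have sol0: "weak_sol 0 (\<lambda>_. 0) \<phi> K" using sol by simp
    have bot: "(sol_u \<phi> \<longlongrightarrow> 0) at_bot" "(sol_du \<phi> K \<longlongrightarrow> 0) at_bot"
      using lim(3) tendsto_minus[OF lim(4)] by (simp_all add: filterlim_at_bot_mirror)
    have small: "eventually (\<lambda>x. cmod (sol_u \<phi> x) \<le> 1) F" if "(sol_u \<phi> \<longlongrightarrow> 0) F" for F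
      using tendstoD[OF that, of 1] by (auto elim!: eventually_mono)
    obtain c where c: "\<And>x. \<phi> x = c"
      using zero_energy_constant(3)[OF sol0 K_cnj_tendsto_0[OF lim(2) r1_lim(1) small[OF lim(1)]]
          K_cnj_tendsto_0[OF bot(2) r1_lim(2) small[OF bot(1)]]] by blast
    have "(sol_u \<phi> \<longlongrightarrow> of_real rp * c) at_top"
      unfolding sol_u_def c by (intro tendsto_intros r_lim)
    from tendsto_unique[OF _ this lim(1)] have "of_real rp * c = 0" by simp
    then show ?thesis using c r_bounds(2)[of 0] r_pos[of 0] by auto
  qed
qed

end

section \<open>Limits of the resolvent\<close>

text \<open>For negative \<open>A\<close> the interval is empty; \<open>max A 0\<close> lets later
  arguments work with a nonnegative radius.\<close>

lemma L2_onD: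
  assumes "f \<in> L2_on A"
  shows "f \<in> L2" "AE x in lborel. x \<notin> {-max A 0..max A 0} \<longrightarrow> f x = 0"
proof -
  show "f \<in> L2" using assms by (simp add: L2_on_def)
  have "AE x in lborel. x \<notin> {-A..A} \<longrightarrow> f x = 0" using assms by (simp add: L2_on_def)
  then show "AE x in lborel. x \<notin> {-max A 0..max A 0} \<longrightarrow> f x = 0" by eventually_elim auto
qed

lemma L1_seminorm_cong_AE:
  assumes "f \<in> borel_measurable borel" "g \<in> borel_measurable borel" "AE x in lborel. f x = g x"
  shows "L1_seminorm b f = L1_seminorm b g"
  unfolding L1_seminorm_def
  by (rule set_lebesgue_integral_cong_AE) (use assms in \<open>auto elim!: eventually_mono\<close>)

context regge_wheeler
begin

lemma V_pos: "l \<ge> 1 \<Longrightarrow> V x > 0"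
  using a_pos[of x] r_pos[of x] unfolding V_def
  by (intro mult_pos_pos divide_pos_pos zero_less_power) (auto intro: add_pos_nonneg)

lemma L2_inner_eq_set_integral:
  assumes f: "AE x in lborel. x \<notin> {-A..A} \<longrightarrow> f x = 0" "f \<in> borel_measurable borel" and x: "x \<ge> A"
  shows "L2_inner (\<lambda>y. of_real (r y)) f = (LINT y:{-x..x}|lborel. of_real (r y) * f y)"
proof -
  have [measurable]: "f \<in> borel_measurable borel" by fact
  show ?thesis
    unfolding L2_inner_def set_lebesgue_integral_def complex_cnj_complex_of_real
  proof (rule integral_cong_AE)
    show "AE y in lborel. of_real (r y) * f y = indicator {-x..x} y *\<^sub>R (of_real (r y) * f y)"
      using f(1) by eventually_elim (use x in \<open>auto simp: indicator_def\<close>)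
  qed auto
qed

text \<open>The \<open>u n\<close> are replaced by continuous representatives, so that the outgoing
  bounds, uniform in n, pass to a limit. Since the limit \<open>U\<close> is prescribed, a
  subsequence is enough to identify it.\<close>

lemma resolvent_limit:
  fixes t :: real and \<epsilon> :: "nat \<Rightarrow> real"
  assumes f: "f \<in> L2_on A" and j: "j \<ge> 1"
    and \<epsilon>: "\<And>n. 0 < \<epsilon> n" "\<And>n. \<epsilon> n \<le> 1" "\<epsilon> \<longlonglongrightarrow> 0"
    and u: "\<And>n. u n \<in> L2" "\<And>n. P_op r a l (u n) (\<lambda>x. f x + (of_real t + \<i> * of_real (\<epsilon> n))\<^sup>2 * u n x)"
    and U: "U \<in> L2_loc" and lim: "\<And>b. (\<lambda>n. L1_seminorm b (\<lambda>x. (\<i> * of_real (\<epsilon> n)) ^ j * u n x - U x)) \<longlonglongrightarrow> 0"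
  shows "t \<noteq> 0 \<or> l \<ge> 1 \<Longrightarrow> AE x in lborel. U x = 0"
    and "t = 0 \<Longrightarrow> l = 0 \<Longrightarrow> AE x in lborel. U x =
      (if j = 1 then \<i> / of_real (rp\<^sup>2 + rm\<^sup>2) else 0) * of_real (r x) * L2_inner (\<lambda>y. of_real (r y)) f"
proof -
  define z where "z = (\<lambda>n. of_real t + \<i> * of_real (\<epsilon> n))"
  define c where "c = (\<lambda>n. (\<i> * of_real (\<epsilon> n)) ^ j)"
  define A0 where "A0 = max A 0"
  have A0: "A0 \<ge> 0" by (simp add: A0_def)
  have fL2: "f \<in> L2" and f0: "AE x in lborel. x \<notin> {-A0..A0} \<longrightarrow> f x = 0"
    unfolding A0_def using L2_onD[OF f] by auto
  have fm[measurable]: "f \<in> borel_measurable borel" using fL2 by (simp add: L2_def)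
  have Um[measurable]: "U \<in> borel_measurable borel" using U by (simp add: L2_loc_def)
  have um[measurable]: "u n \<in> borel_measurable borel" for n using u(1)[of n] by (simp add: L2_def)
  have "\<forall>n. \<exists>\<phi> K. weak_sol (z n) f \<phi> K \<and> (AE x in lborel. u n x = sol_u \<phi> x)"
    unfolding sol_u_def z_def using P_op_weak_sol[OF u(2) fm] by metis
  then obtain \<phi> K where sol: "\<And>n. weak_sol (z n) f (\<phi> n) (K n)" and ae: "\<And>n. AE x in lborel. u n x = sol_u (\<phi> n) x"
    by metis
  have contu: "continuous_on S (sol_u (\<phi> n))" for n S
    unfolding sol_u_def by (intro continuous_intros weak_sol_cont(1)[OF sol] r_cont)
  have [measurable]: "sol_u (\<phi> n) \<in> borel_measurable borel" for n
    using contu by (rule borel_measurable_continuous_onI)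
  have hlim: "(\<lambda>n. L1_seminorm b (\<lambda>x. c n * sol_u (\<phi> n) x - U x)) \<longlonglongrightarrow> 0" for b
  proof -
    have "L1_seminorm b (\<lambda>x. (\<i> * of_real (\<epsilon> n)) ^ j * u n x - U x) = L1_seminorm b (\<lambda>x. c n * sol_u (\<phi> n) x - U x)" for n
      by (rule L1_seminorm_cong_AE) (use ae[of n] in \<open>auto simp: c_def elim!: eventually_mono\<close>)
    then show ?thesis using lim[of b] by simp
  qed
  have "z \<longlonglongrightarrow> of_real t + \<i> * of_real 0" unfolding z_def by (intro tendsto_intros \<epsilon>)
  then have zlim: "z \<longlonglongrightarrow> of_real t" by simp
  have "c \<longlonglongrightarrow> (\<i> * of_real 0) ^ j" unfolding c_def by (intro tendsto_intros \<epsilon>)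
  then have clim: "c \<longlonglongrightarrow> 0" using j by (simp add: power_0_left)
  obtain s \<phi>' K' where s: "strict_mono (s :: nat \<Rightarrow> nat)"
    and \<phi>': "\<And>x. (\<lambda>n. c (s n) * \<phi> (s n) x) \<longlonglongrightarrow> \<phi>' x" and K': "\<And>x. (\<lambda>n. c (s n) * K (s n) x) \<longlonglongrightarrow> K' x"
    and sol': "weak_sol (of_real t) (\<lambda>_. 0) \<phi>' K'" and ae': "AE x in lborel. U x = sol_u \<phi>' x"
    by (rule limit_weak_sol[OF sol L2_subset_L2_loc[OF fL2] U zlim clim hlim], rule that)
  note sub = LIMSEQ_subseq_LIMSEQ[OF _ s, unfolded o_def]
  have ulim: "(\<lambda>n. c (s n) * sol_u (\<phi> (s n)) x) \<longlonglongrightarrow> sol_u \<phi>' x" for x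
  proof -
    have "(\<lambda>n. of_real (r x) * (c (s n) * \<phi> (s n) x)) \<longlonglongrightarrow> of_real (r x) * \<phi>' x" by (intro tendsto_intros \<phi>')
    then show ?thesis by (simp add: sol_u_def mult_ac)
  qed
  have dulim: "(\<lambda>n. c (s n) * sol_du (\<phi> (s n)) (K (s n)) x) \<longlonglongrightarrow> sol_du \<phi>' K' x" for x
  proof -
    have "(\<lambda>n. of_real (r1 x) * (c (s n) * \<phi> (s n) x) + c (s n) * K (s n) x / of_real (r x)) \<longlonglongrightarrow> of_real (r1 x) * \<phi>' x + K' x / of_real (r x)"
      by (intro tendsto_intros \<phi>' K') auto
    then show ?thesis by (simp add: sol_du_def algebra_simps)
  qed
  have decr: "right.decaying_sol (z n) (A0 + 1) (sol_u (\<phi> n)) (sol_du (\<phi> n) (K n))"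
    and decl: "left.decaying_sol (z n) (A0 + 1) (\<lambda>x. sol_u (\<phi> n) (- x)) (\<lambda>x. - sol_du (\<phi> n) (K n) (- x))" for n
    using weak_sol_decaying[OF sol[of n] _ u(1)[of n] f0 fm A0] ae[of n] by (auto simp: sol_u_def)
  have Imz: "Im (z n) > 0" for n using \<epsilon> by (simp add: z_def)
  \<comment> \<open>Independent of \<open>n\<close>: beyond the support of the source, and far
    enough for the absorption argument at both ends.\<close>
  obtain x0 where x0: "x0 \<ge> A0 + 1" and small: "\<And>x. x \<ge> x0 \<Longrightarrow> C\<^sup>2 * (rp - r x) \<le> 1 / 2"
    "\<And>x. x \<ge> x0 \<Longrightarrow> C\<^sup>2 * (r (- x) - rm) \<le> 1 / 2"
  proof -
    have "eventually (\<lambda>x. C\<^sup>2 * (rp - r x) < 1 / 2) at_top"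
      by (rule order_tendstoD(2)[OF tendsto_mult_right_zero[OF right.d_lim]]) simp
    moreover have "eventually (\<lambda>x. C\<^sup>2 * (r (- x) - rm) < 1 / 2) at_top"
      by (rule order_tendstoD(2)[OF tendsto_mult_right_zero[OF left.d_lim]]) simp
    ultimately have "eventually (\<lambda>x. x \<ge> A0 + 1 \<and> C\<^sup>2 * (rp - r x) < 1 / 2 \<and> C\<^sup>2 * (r (- x) - rm) < 1 / 2) at_top"
      using eventually_ge_at_top[of "A0 + 1"] by eventually_elim auto
    then show thesis using that unfolding eventually_at_top_linorder by (meson order_refl less_imp_le)
  qed
  have "outgoing t \<phi>' K'"
    unfolding outgoing_def
  proof (intro exI[of _ x0] conjI allI impI)
    show "0 \<le> x0" using x0 A0 by simp
    fix x y assume x: "x0 \<le> x" and y: "x \<le> y"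
    have Ax: "A0 + 1 \<le> x" using x x0 by simp
    note R = right.outgoing_estimates_limit[OF decr[of "s _"] Imz sub[OF zlim] ulim dulim Ax small(1)[OF x] y]
    show "cmod (sol_u \<phi>' y) \<le> 2 * cmod (sol_u \<phi>' x)" by (rule R(1))
    show "cmod (sol_du \<phi>' K' y - \<i> * of_real t * sol_u \<phi>' y) \<le> 2 * C * (rp - r y) * cmod (sol_u \<phi>' x)"
      by (rule R(2))
    have mdulim: "(\<lambda>n. c (s n) * - sol_du (\<phi> (s n)) (K (s n)) (- x)) \<longlonglongrightarrow> - sol_du \<phi>' K' (- x)" for x
      using tendsto_minus[OF dulim[of "- x"]] by simp
    note L = left.outgoing_estimates_limit[OF decl[of "s _"] Imz sub[OF zlim], where c = "\<lambda>n. c (s n)", OF ulim mdulim Ax small(2)[OF x] y]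
    show "cmod (sol_u \<phi>' (- y)) \<le> 2 * cmod (sol_u \<phi>' (- x))" by (rule L(1))
    show "cmod (- sol_du \<phi>' K' (- y) - \<i> * of_real t * sol_u \<phi>' (- y)) \<le> 2 * C * (r (- y) - rm) * cmod (sol_u \<phi>' (- x))"
      by (rule L(2))
  qed
  note out = this
  show "AE x in lborel. U x = 0" if "t \<noteq> 0 \<or> l \<ge> 1"
  proof -
    have "\<phi>' x = 0" for x
    proof (cases "t = 0")
      case False
      then show ?thesis by (rule outgoing_nonzero_energy[OF sol' _ out])
    next
      case True
      then have "V x > 0" using that V_pos by auto
      then show ?thesis
        using zero_energy_constant(2)[of \<phi>' K' x] outgoing_zero_energy[of \<phi>' K'] sol' out True by auto
    qed
    then show ?thesis using ae' by (auto simp: sol_u_def)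
  qed
  assume t: "t = 0" and l: "l = 0"
  have V0: "V x = 0" for x unfolding V_def by (simp add: l)
  obtain C0 where C0: "\<And>x. \<phi>' x = C0"
    using zero_energy_constant(3)[of \<phi>' K'] outgoing_zero_energy[of \<phi>' K'] sol' out t by auto
  have z: "z n = \<i> * of_real (\<epsilon> n)" for n using t by (simp add: z_def)
  have z2: "- (z n)\<^sup>2 = of_real ((\<epsilon> n)\<^sup>2)" for n by (simp add: z power_mult_distrib)
  define F where "F = L2_inner (\<lambda>y. of_real (r y)) f"
  \<comment> \<open>Limit of (i \<epsilon>)^j / \<epsilon>, the weight of the source once the flux
    identity is divided by \<epsilon>.\<close>
  define \<omega> :: complex where "\<omega> = (if j = 1 then \<i> else 0)"
  have \<omega>: "(\<lambda>n. c n / of_real (\<epsilon> n)) \<longlonglongrightarrow> \<omega>"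
  proof -
    have "c n / of_real (\<epsilon> n) = \<i> ^ j * of_real (\<epsilon> n) ^ (j - 1)" for n
      using \<epsilon>(1)[of n] j by (cases j) (auto simp: c_def power_mult_distrib)
    moreover have "(\<lambda>n. \<i> ^ j * of_real (\<epsilon> n) ^ (j - 1)) \<longlonglongrightarrow> \<i> ^ j * of_real 0 ^ (j - 1)"
      by (intro tendsto_intros \<epsilon>)
    moreover have "\<i> ^ j * of_real 0 ^ (j - 1) = \<omega>" using j by (auto simp: \<omega>_def power_0_left)
    ultimately show ?thesis by (simp only:)
  qed
  define \<kappa>p where "\<kappa>p = (2 + 2 * C * rp) * C"
  define \<kappa>m where "\<kappa>m = (2 + 2 * C * rm) * C"
  have rp: "rp > 0" using r_bounds(2)[of 0] r_pos[of 0] by simp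
  \<comment> \<open>At fixed \<open>x\<close> the term \<open>\<epsilon> * I\<close> vanishes in the
    limit because the integral over the bounded interval converges; the remaining errors carry
    \<open>rp - r x\<close> or \<open>r (- x) - rm\<close> and vanish as x grows.\<close>
  have bound: "cmod (- \<omega> * F + of_real rp * (of_real (r x) * C0) + of_real rm * (of_real (r (- x)) * C0))
      \<le> \<kappa>p * (rp - r x) * cmod (of_real (r x) * C0) + \<kappa>m * (r (- x) - rm) * cmod (of_real (r (- x)) * C0)" if x: "x \<ge> x0" for x
  proof -
    have Ax: "A0 + 1 \<le> x" using x x0 by simp
    define I where "I = (\<lambda>n. LINT y:{-x..x}|lborel. of_real (r y) * (c n * sol_u (\<phi> n) y))"
    define IU where "IU = (LINT y:{-x..x}|lborel. of_real (r y) * U y)"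
    have iU: "set_integrable lborel {-x..x} (\<lambda>y. of_real (r y) * U y)"
      by (rule set_integrable_continuous_mult[OF _ L2_locD(2)[OF U] Um])
         (auto intro!: continuous_intros r_cont borel_measurable_continuous_onI)
    have ih: "set_integrable lborel {-x..x} (\<lambda>y. c n * sol_u (\<phi> n) y - U y)" for n
      by (intro set_integral_diff L2_locD(2)[OF U] borel_integrable_atLeastAtMost' continuous_intros contu)
    have irh: "set_integrable lborel {-x..x} (\<lambda>y. of_real (r y) * (c n * sol_u (\<phi> n) y - U y))" for n
      by (rule set_integrable_continuous_mult[OF _ ih])
         (auto intro!: continuous_intros r_cont borel_measurable_continuous_onI)
    have iru: "set_integrable lborel {-x..x} (\<lambda>y. of_real (r y) * (c n * sol_u (\<phi> n) y))" for n
      by (intro borel_integrable_atLeastAtMost' continuous_intros contu r_cont)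
    have irf: "set_integrable lborel {-x..x} (\<lambda>y. of_real (r y) * f y)"
      by (rule set_integrable_continuous_mult[OF _ set_integrable_L2[OF fL2] fm])
         (auto intro!: continuous_intros r_cont borel_measurable_continuous_onI)
    have Ilim: "I \<longlonglongrightarrow> IU"
    proof -
      have "cmod (I n - IU) \<le> rp * L1_seminorm x (\<lambda>y. c n * sol_u (\<phi> n) y - U y)" for n
      proof -
        have "I n - IU = (LINT y:{-x..x}|lborel. of_real (r y) * (c n * sol_u (\<phi> n) y - U y))"
          unfolding I_def IU_def set_integral_diff(2)[OF iru iU, symmetric] by (simp add: algebra_simps)
        also have "cmod \<dots> \<le> (LINT y:{-x..x}|lborel. cmod (of_real (r y) * (c n * sol_u (\<phi> n) y - U y)))"
          by (rule set_integral_norm_bound[OF irh])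
        also have "\<dots> \<le> (LINT y:{-x..x}|lborel. rp * cmod (c n * sol_u (\<phi> n) y - U y))"
          by (intro set_integral_mono set_integrable_norm irh set_integrable_mult_right ih)
             (use r_bounds(2) r_pos in \<open>auto simp: norm_mult less_imp_le intro!: mult_right_mono\<close>)
        also have "\<dots> = rp * L1_seminorm x (\<lambda>y. c n * sol_u (\<phi> n) y - U y)"
          unfolding L1_seminorm_def by (rule set_integral_mult_right)
        finally show ?thesis .
      qed
      moreover have "(\<lambda>n. rp * L1_seminorm x (\<lambda>y. c n * sol_u (\<phi> n) y - U y)) \<longlonglongrightarrow> rp * 0"
        by (intro tendsto_intros hlim)
      ultimately have "(\<lambda>n. I n - IU) \<longlonglongrightarrow> 0"
        by (intro Lim_null_comparison[of "\<lambda>n. I n - IU" "\<lambda>n. rp * L1_seminorm x (\<lambda>y. c n * sol_u (\<phi> n) y - U y)"]) auto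
      then show ?thesis by (simp add: LIM_zero_iff)
    qed
    have Kd: "c n * (K n x - K n (- x)) = of_real ((\<epsilon> n)\<^sup>2) * I n - c n * F" for n
    proof -
      have "K n x - K n (- x) = (LINT y:{-x..x}|lborel. of_real (r y) * ((of_real (V y) - (z n)\<^sup>2) * (of_real (r y) * \<phi> n y) - f y))"
        using sol[of n] Ax A0 by (simp add: weak_sol_def)
      also have "\<dots> = (LINT y:{-x..x}|lborel. of_real ((\<epsilon> n)\<^sup>2) * (of_real (r y) * sol_u (\<phi> n) y) - of_real (r y) * f y)"
        by (intro set_lebesgue_integral_cong) (auto simp: V0 z2 sol_u_def algebra_simps)
      also have "\<dots> = (LINT y:{-x..x}|lborel. of_real ((\<epsilon> n)\<^sup>2) * (of_real (r y) * sol_u (\<phi> n) y)) - (LINT y:{-x..x}|lborel. of_real (r y) * f y)"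
        by (intro set_integral_diff irf borel_integrable_atLeastAtMost' continuous_intros contu r_cont)
      also have "(LINT y:{-x..x}|lborel. of_real (r y) * f y) = F"
        unfolding F_def by (rule L2_inner_eq_set_integral[OF f0 fm, symmetric]) (use Ax in simp)
      also have "c n * ((LINT y:{-x..x}|lborel. of_real ((\<epsilon> n)\<^sup>2) * (of_real (r y) * sol_u (\<phi> n) y)) - F)
          = of_real ((\<epsilon> n)\<^sup>2) * I n - c n * F"
      proof -
        have "I n = c n * (LINT y:{-x..x}|lborel. of_real (r y) * sol_u (\<phi> n) y)"
          unfolding I_def by (subst set_integral_mult_right[symmetric]) (simp add: mult_ac)
        then show ?thesis by (subst set_integral_mult_right) (simp add: algebra_simps)
      qed
      finally show ?thesis .
    qed
    have est: "cmod (of_real (\<epsilon> n) * I n - c n / of_real (\<epsilon> n) * F + of_real rp * (c n * sol_u (\<phi> n) x) + of_real rm * (c n * sol_u (\<phi> n) (- x)))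
       \<le> \<kappa>p * (rp - r x) * cmod (c n * sol_u (\<phi> n) x) + \<kappa>m * (r (- x) - rm) * cmod (c n * sol_u (\<phi> n) (- x))" for n
    proof -
      have W: "W y * r y = r2 y" for y by (simp add: W_def V0)
      have e0: "\<epsilon> n \<noteq> 0" using \<epsilon>(1)[of n] by simp
      define Rt where "Rt = of_real (r x) * sol_du (\<phi> n) (K n) x - of_real (r1 x) * sol_u (\<phi> n) x + of_real (\<epsilon> n * rp) * sol_u (\<phi> n) x"
      define Lt where "Lt = of_real (r (- x)) * - sol_du (\<phi> n) (K n) (- x) - of_real (- r1 (- x)) * sol_u (\<phi> n) (- x) + of_real (\<epsilon> n * rm) * sol_u (\<phi> n) (- x)"
      have R: "cmod Rt \<le> \<epsilon> n * (\<kappa>p * (rp - r x) * cmod (sol_u (\<phi> n) x))"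
        unfolding Rt_def \<kappa>p_def
        by (rule right.zero_energy_flux[OF decr[of n, unfolded z] \<epsilon>(1,2) Ax small(1)[OF x] r_deriv])
           (use rp r_bounds r1_lim in \<open>auto simp: W r1_deriv less_imp_le abs_if\<close>)
      have L: "cmod Lt \<le> \<epsilon> n * (\<kappa>m * (r (- x) - rm) * cmod (sol_u (\<phi> n) (- x)))"
        unfolding Lt_def \<kappa>m_def
      proof (rule left.zero_energy_flux[OF decl[of n, unfolded z] \<epsilon>(1,2) Ax small(2)[OF x], where \<rho> = "\<lambda>x. r (- x)"])
        show "((\<lambda>x. r (- x)) has_real_derivative - r1 (- y)) (at y)" for y
          using DERIV_chain'[OF DERIV_minus[OF DERIV_ident] r_deriv[of "- y"]] by simp
        show "((\<lambda>x. - r1 (- x)) has_real_derivative W (- y) * r (- y)) (at y)" for y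
          using DERIV_minus[OF DERIV_chain'[OF DERIV_minus[OF DERIV_ident] r1_deriv[of "- y"]]] by (simp add: W)
        show "((\<lambda>x. - r1 (- x)) \<longlongrightarrow> 0) at_top"
          using tendsto_minus[OF r1_lim(2)] by (simp add: filterlim_at_bot_mirror)
      qed (use rm r_bounds in \<open>auto simp: less_imp_le abs_if\<close>)
      \<comment> \<open>Adding the outward fluxes at both ends yields the increment of the Wronskian
        \<open>K\<close> plus boundary values of \<open>u\<close>; \<open>Kd\<close> then brings in
        the source.\<close>
      have sum: "Rt + Lt = K n x - K n (- x) + of_real (\<epsilon> n) * (of_real rp * sol_u (\<phi> n) x + of_real rm * sol_u (\<phi> n) (- x))"
        unfolding Rt_def Lt_def K_eq[of "K n" x "\<phi> n"] K_eq[of "K n" "- x" "\<phi> n"] by (simp add: algebra_simps)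
      have "of_real (\<epsilon> n) * I n - c n / of_real (\<epsilon> n) * F + of_real rp * (c n * sol_u (\<phi> n) x) + of_real rm * (c n * sol_u (\<phi> n) (- x))
         = (of_real ((\<epsilon> n)\<^sup>2) * I n - c n * F + of_real (\<epsilon> n) * c n * (of_real rp * sol_u (\<phi> n) x + of_real rm * sol_u (\<phi> n) (- x))) / of_real (\<epsilon> n)"
        using e0 by (simp add: field_simps power2_eq_square)
      also have "\<dots> = c n * (Rt + Lt) / of_real (\<epsilon> n)"
        unfolding Kd[symmetric] sum by (simp add: algebra_simps)
      also have "cmod \<dots> = cmod (c n) * cmod (Rt + Lt) / \<epsilon> n"
        using \<epsilon>(1)[of n] by (simp add: norm_mult norm_divide)
      also have "\<dots> \<le> cmod (c n) * (\<epsilon> n * (\<kappa>p * (rp - r x) * cmod (sol_u (\<phi> n) x)) + \<epsilon> n * (\<kappa>m * (r (- x) - rm) * cmod (sol_u (\<phi> n) (- x)))) / \<epsilon> n"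
        using \<epsilon>(1)[of n] by (intro divide_right_mono mult_left_mono order_trans[OF norm_triangle_ineq add_mono[OF R L]]) auto
      also have "\<dots> = \<kappa>p * (rp - r x) * cmod (c n * sol_u (\<phi> n) x) + \<kappa>m * (r (- x) - rm) * cmod (c n * sol_u (\<phi> n) (- x))"
        using e0 by (simp add: field_simps norm_mult)
      finally show ?thesis .
    qed
    have "(\<lambda>n. cmod (of_real (\<epsilon> (s n)) * I (s n) - c (s n) / of_real (\<epsilon> (s n)) * F + of_real rp * (c (s n) * sol_u (\<phi> (s n)) x) + of_real rm * (c (s n) * sol_u (\<phi> (s n)) (- x))))
       \<longlonglongrightarrow> cmod (of_real 0 * IU - \<omega> * F + of_real rp * sol_u \<phi>' x + of_real rm * sol_u \<phi>' (- x))"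
      by (intro tendsto_intros ulim sub[OF Ilim] sub[OF \<omega>] sub[OF \<epsilon>(3)])
    moreover have "(\<lambda>n. \<kappa>p * (rp - r x) * cmod (c (s n) * sol_u (\<phi> (s n)) x) + \<kappa>m * (r (- x) - rm) * cmod (c (s n) * sol_u (\<phi> (s n)) (- x)))
       \<longlonglongrightarrow> \<kappa>p * (rp - r x) * cmod (sol_u \<phi>' x) + \<kappa>m * (r (- x) - rm) * cmod (sol_u \<phi>' (- x))"
      by (intro tendsto_intros ulim)
    ultimately have "cmod (of_real 0 * IU - \<omega> * F + of_real rp * sol_u \<phi>' x + of_real rm * sol_u \<phi>' (- x))
      \<le> \<kappa>p * (rp - r x) * cmod (sol_u \<phi>' x) + \<kappa>m * (r (- x) - rm) * cmod (sol_u \<phi>' (- x))"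
      using est by (intro LIMSEQ_le) auto
    then show ?thesis by (simp add: sol_u_def C0)
  qed
  have rmlim: "((\<lambda>x. r (- x)) \<longlongrightarrow> rm) at_top" using r_lim(2) by (simp add: filterlim_at_bot_mirror)
  \<comment> \<open>As x tends to infinity the inequality becomes an equation for \<open>C0\<close>.
    Each end contributes its limiting radius twice, once from the outgoing condition and once from u
    = r \<phi>, whence rp^2 + rm^2.\<close>
  have "cmod (- \<omega> * F + of_real rp * (of_real rp * C0) + of_real rm * (of_real rm * C0))
      \<le> \<kappa>p * (rp - rp) * cmod (of_real rp * C0) + \<kappa>m * (rm - rm) * cmod (of_real rm * C0)"
  proof (rule tendsto_le)
    show "((\<lambda>x. \<kappa>p * (rp - r x) * cmod (of_real (r x) * C0) + \<kappa>m * (r (- x) - rm) * cmod (of_real (r (- x)) * C0)) \<longlongrightarrow> \<kappa>p * (rp - rp) * cmod (of_real rp * C0) + \<kappa>m * (rm - rm) * cmod (of_real rm * C0)) at_top"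
      by (intro tendsto_intros r_lim rmlim)
    show "((\<lambda>x. cmod (- \<omega> * F + of_real rp * (of_real (r x) * C0) + of_real rm * (of_real (r (- x)) * C0))) \<longlongrightarrow> cmod (- \<omega> * F + of_real rp * (of_real rp * C0) + of_real rm * (of_real rm * C0))) at_top"
      by (intro tendsto_intros r_lim rmlim)
    show "\<forall>\<^sub>F x in at_top. cmod (- \<omega> * F + of_real rp * (of_real (r x) * C0) + of_real rm * (of_real (r (- x)) * C0))
      \<le> \<kappa>p * (rp - r x) * cmod (of_real (r x) * C0) + \<kappa>m * (r (- x) - rm) * cmod (of_real (r (- x)) * C0)"
      using bound by (rule eventually_at_top_linorderI)
  qed simp
  then have "- \<omega> * F + of_real rp * (of_real rp * C0) + of_real rm * (of_real rm * C0) = 0" by simp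
  then have "C0 * of_real (rp\<^sup>2 + rm\<^sup>2) = \<omega> * F" by (simp add: algebra_simps power2_eq_square)
  moreover have "complex_of_real (rp\<^sup>2 + rm\<^sup>2) \<noteq> 0"
    unfolding of_real_eq_0_iff using rm rp by (simp add: add_pos_pos less_imp_neq[symmetric])
  ultimately have "C0 = \<omega> / of_real (rp\<^sup>2 + rm\<^sup>2) * F" by (simp add: field_simps)
  then have "sol_u \<phi>' x = (if j = 1 then \<i> / of_real (rp\<^sup>2 + rm\<^sup>2) else 0) * of_real (r x) * F" for x
    by (simp add: sol_u_def C0 \<omega>_def)
  then show "AE x in lborel. U x = (if j = 1 then \<i> / of_real (rp\<^sup>2 + rm\<^sup>2) else 0) * of_real (r x) * L2_inner (\<lambda>y. of_real (r y)) f"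
    using ae' unfolding F_def by simp
qed

end

section \<open>Laurent coefficients\<close>

lemma L1_seminorm_mult: "L1_seminorm b (\<lambda>x. c * f x) = cmod c * L1_seminorm b f"
  by (simp add: L1_seminorm_def norm_mult)

lemma L1_seminorm_add:
  assumes "f \<in> L2_loc" "g \<in> L2_loc"
  shows "L1_seminorm b (\<lambda>x. f x + g x) \<le> L1_seminorm b f + L1_seminorm b g"
proof -
  note i = set_integrable_norm[OF L2_locD(2)[OF assms(1), of b]] set_integrable_norm[OF L2_locD(2)[OF assms(2), of b]]
  have "L1_seminorm b (\<lambda>x. f x + g x) \<le> (LINT x:{-b..b}|lborel. cmod (f x) + cmod (g x))"
    unfolding L1_seminorm_def
    by (intro set_integral_mono set_integral_add(1)[OF i] set_integrable_norm L2_locD(2) L2_loc_add assms norm_triangle_ineq)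
  also have "\<dots> = L1_seminorm b f + L1_seminorm b g"
    unfolding L1_seminorm_def by (rule set_integral_add(2)[OF i])
  finally show ?thesis .
qed

lemma L2_loc_zero: "(\<lambda>_. 0) \<in> L2_loc"
  by (auto simp: L2_loc_def set_integrable_def)

lemma L1_seminorm_sum:
  assumes "finite I" "\<And>i. i \<in> I \<Longrightarrow> g i \<in> L2_loc"
  shows "(\<lambda>x. \<Sum>i\<in>I. g i x) \<in> L2_loc" "L1_seminorm b (\<lambda>x. \<Sum>i\<in>I. g i x) \<le> (\<Sum>i\<in>I. L1_seminorm b (g i))"
proof -
  have "(\<lambda>x. \<Sum>i\<in>I. g i x) \<in> L2_loc \<and> L1_seminorm b (\<lambda>x. \<Sum>i\<in>I. g i x) \<le> (\<Sum>i\<in>I. L1_seminorm b (g i))"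
    using assms
  proof (induction I rule: finite_induct)
    case empty
    show ?case by (simp add: L2_loc_zero) (simp add: L1_seminorm_def)
  next
    case (insert i I)
    then have 1: "g i \<in> L2_loc" "(\<lambda>x. \<Sum>i\<in>I. g i x) \<in> L2_loc"
      and 2: "L1_seminorm b (\<lambda>x. \<Sum>i\<in>I. g i x) \<le> (\<Sum>i\<in>I. L1_seminorm b (g i))" by auto
    show ?case
      using L2_loc_add[OF 1] L1_seminorm_add[OF 1, of b] 2 insert.hyps by simp
  qed
  then show "(\<lambda>x. \<Sum>i\<in>I. g i x) \<in> L2_loc" "L1_seminorm b (\<lambda>x. \<Sum>i\<in>I. g i x) \<le> (\<Sum>i\<in>I. L1_seminorm b (g i))"
    by auto
qed

text \<open>Differentiability at \<open>z0\<close> with tolerance 1 already bounds the difference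
  quotients on a punctured disc, hence \<open>H w f\<close> itself.\<close>

lemma holomorphic_family_locally_bounded:
  assumes H: "holomorphic_family H (ball z0 e)" and e: "e > 0" and f: "f \<in> L2_on a"
  obtains d Q where "d > 0" "\<And>w. dist w z0 < d \<Longrightarrow> w \<in> ball z0 e \<Longrightarrow> w \<noteq> z0 \<Longrightarrow> L1_seminorm b (H w f) \<le> Q"
proof -
  have fc: "f \<in> L2_comp" using f by (auto simp: L2_comp_def)
  have Hloc: "H w f \<in> L2_loc" if "w \<in> ball z0 e" for w
    using H fc that by (simp add: holomorphic_family_def comp_loc_op_def)
  have "z0 \<in> ball z0 e" using e by simp
  from H[unfolded holomorphic_family_def, THEN conjunct2, rule_format, OF this]
  obtain D where D: "comp_loc_op D" and lim: "\<forall>a b. \<forall>e'>0. \<exists>d>0. \<forall>w\<in>ball z0 e. w \<noteq> z0 \<longrightarrow> dist w z0 < d \<longrightarrow>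
      (\<forall>f\<in>L2_on a. L2_seminorm b (\<lambda>x. (H w f x - H z0 f x) / (w - z0) - D f x) \<le> e' * L2_norm f)"
    by (elim exE conjE) (rule that)
  obtain d where d: "d > 0" and dw: "\<And>w. w \<in> ball z0 e \<Longrightarrow> w \<noteq> z0 \<Longrightarrow> dist w z0 < d \<Longrightarrow>
      L2_seminorm b (\<lambda>x. (H w f x - H z0 f x) / (w - z0) - D f x) \<le> 1 * L2_norm f"
    using lim[rule_format, of 1 a b] f by auto
  have Df: "D f \<in> L2_loc" using D fc by (simp add: comp_loc_op_def)
  have H0: "H z0 f \<in> L2_loc" using Hloc e by simp
  define Q where "Q = L1_seminorm b (H z0 f) + d * ((2 * \<bar>b\<bar> + (L2_norm f)\<^sup>2) + L1_seminorm b (D f))"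
  have "L1_seminorm b (H w f) \<le> Q" if w: "dist w z0 < d" "w \<in> ball z0 e" "w \<noteq> z0" for w
  proof -
    define g where "g = (\<lambda>x. (H w f x - H z0 f x) / (w - z0) - D f x)"
    have g: "g \<in> L2_loc"
      using L2_loc_diff[OF L2_loc_mult[OF L2_loc_diff[OF Hloc[OF w(2)] H0], of "inverse (w - z0)"] Df]
      by (simp add: g_def divide_inverse mult.commute)
    have g_le: "L1_seminorm b g \<le> 2 * \<bar>b\<bar> + (L2_norm f)\<^sup>2"
    proof -
      have "(L2_seminorm b g)\<^sup>2 \<le> (L2_norm f)\<^sup>2"
        using dw[OF w(2,3,1)] unfolding g_def
        by (intro power_mono) (auto simp: L2_seminorm_def set_lebesgue_integral_def intro!: integral_nonneg_AE)
      then show ?thesis using L2_locD(3)[OF g, of b] by simp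
    qed
    have eq: "H w f = (\<lambda>x. H z0 f x + (w - z0) * (g x + D f x))"
      using w(3) by (auto simp: g_def)
    have "L1_seminorm b (H w f) \<le> L1_seminorm b (H z0 f) + L1_seminorm b (\<lambda>x. (w - z0) * (g x + D f x))"
      unfolding eq by (intro L1_seminorm_add H0 L2_loc_mult L2_loc_add g Df)
    also have "L1_seminorm b (\<lambda>x. (w - z0) * (g x + D f x)) = cmod (w - z0) * L1_seminorm b (\<lambda>x. g x + D f x)"
      by (rule L1_seminorm_mult)
    also have "\<dots> \<le> d * ((2 * \<bar>b\<bar> + (L2_norm f)\<^sup>2) + L1_seminorm b (D f))"
      using w(1) d g_le by (intro mult_mono order_trans[OF L1_seminorm_add[OF g Df]] add_mono) (auto simp: dist_norm L1_seminorm_nonneg)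
    finally show ?thesis by (simp add: Q_def)
  qed
  then show thesis using that d by blast
qed

text \<open>After multiplication by (z - z0)^j, terms of index below j carry a positive power of z -
  z0, those above vanish by hypothesis, and the holomorphic part is bounded. The default 0 of
  \<open>B\<close> for j > N allows a principal part shorter than j, even an empty one.\<close>

lemma laurent_limit:
  assumes pp: "laurent_principal_part R z0 N A" and f: "f \<in> L2_on a" and j: "j \<ge> 1"
    and zero: "\<And>i. i \<in> {1..N} \<Longrightarrow> i > j \<Longrightarrow> AE x in lborel. A i f x = 0"
    and B: "B = (if j \<le> N then A j f else (\<lambda>_. 0))"
  obtains e where "e > 0" "B \<in> L2_loc"
    "\<And>(\<epsilon> :: nat \<Rightarrow> real) u b. (\<And>n. 0 < \<epsilon> n \<and> \<epsilon> n < e) \<Longrightarrow> \<epsilon> \<longlonglongrightarrow> 0 \<Longrightarrow> (\<And>n. u n \<in> L2) \<Longrightarrow>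
      (\<And>n. AE x in lborel. R (z0 + \<i> * of_real (\<epsilon> n)) f x = u n x) \<Longrightarrow>
      (\<lambda>n. L1_seminorm b (\<lambda>x. (\<i> * of_real (\<epsilon> n)) ^ j * u n x - B x)) \<longlonglongrightarrow> 0"
proof -
  have fc: "f \<in> L2_comp" using f by (auto simp: L2_comp_def)
  have Aloc: "A i f \<in> L2_loc" if "i \<in> {1..N}" for i
    using pp fc that by (simp add: laurent_principal_part_def comp_loc_op_def)
  obtain e H where e: "e > 0" and H: "holomorphic_family H (ball z0 e)"
    and R: "\<And>z. z \<in> ball z0 e - {z0} \<Longrightarrow> AE x in lborel. R z f x = (\<Sum>j=1..N. A j f x / (z - z0) ^ j) + H z f x"
    using pp fc unfolding laurent_principal_part_def by blast
  have Hloc: "H w f \<in> L2_loc" if "w \<in> ball z0 e" for w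
    using H fc that by (simp add: holomorphic_family_def comp_loc_op_def)
  have Bloc: "B \<in> L2_loc" using Aloc[of j] j by (auto simp: B L2_loc_zero)
  show thesis
  proof (rule that[OF e Bloc])
    fix \<epsilon> :: "nat \<Rightarrow> real" and u b
    assume \<epsilon>: "\<And>n. 0 < \<epsilon> n \<and> \<epsilon> n < e" "\<epsilon> \<longlonglongrightarrow> 0" and u: "\<And>n. u n \<in> L2"
      and Ru: "\<And>n. AE x in lborel. R (z0 + \<i> * of_real (\<epsilon> n)) f x = u n x"
    define w where "w = (\<lambda>n. \<i> * complex_of_real (\<epsilon> n))"
    have w: "w n \<noteq> 0" "cmod (w n) = \<epsilon> n" "z0 + w n \<in> ball z0 e - {z0}" for n
      using \<epsilon>(1)[of n] by (auto simp: w_def norm_mult dist_norm)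
    have "w \<longlonglongrightarrow> \<i> * of_real 0" unfolding w_def by (intro tendsto_intros \<epsilon>)
    then have w0: "w \<longlonglongrightarrow> 0" by simp
    obtain d Q where d: "d > 0" and Q: "\<And>v. dist v z0 < d \<Longrightarrow> v \<in> ball z0 e \<Longrightarrow> v \<noteq> z0 \<Longrightarrow> L1_seminorm b (H v f) \<le> Q"
      using holomorphic_family_locally_bounded[OF H e f] by blast
    define S where "S = (\<lambda>n i x. (if i < j then w n ^ (j - i) else 0) * A i f x)"
    have Sloc: "S n i \<in> L2_loc" if "i \<in> {1..N}" for n i
      unfolding S_def by (rule L2_loc_mult[OF Aloc[OF that]])
    have ae: "AE x in lborel. w n ^ j * u n x - B x = (\<Sum>i=1..N. S n i x) + w n ^ j * H (z0 + w n) f x" for n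
    proof -
      have "AE x in lborel. \<forall>i\<in>{1..N}. i > j \<longrightarrow> A i f x = 0"
        using zero by (intro AE_finite_allI) (auto intro: AE_impI)
      then show ?thesis
        using R[OF w(3)[of n]] Ru[of n]
      proof eventually_elim
        case (elim x)
        have "w n ^ j * (A i f x / w n ^ i) = S n i x + (if i = j then B x else 0)" if i: "i \<in> {1..N}" for i
        proof (cases "i < j")
          case True
          then show ?thesis using w(1)[of n] by (simp add: S_def power_diff)
        next
          case False
          then show ?thesis using elim(1) i w(1)[of n] by (cases "i = j") (auto simp: S_def B)
        qed
        then have "w n ^ j * (\<Sum>i=1..N. A i f x / w n ^ i) = (\<Sum>i=1..N. S n i x) + (\<Sum>i=1..N. if i = j then B x else 0)"
          unfolding sum_distrib_left sum.distrib[symmetric] by (intro sum.cong) auto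
        moreover have "(\<Sum>i=1..N. if i = j then B x else 0) = B x"
          using j by (auto simp: B)
        moreover have "u n x = (\<Sum>i=1..N. A i f x / w n ^ i) + H (z0 + w n) f x"
          using elim(2,3) by (simp add: w_def)
        ultimately show ?case by (simp add: distrib_left)
      qed
    qed
    define E where "E = (\<lambda>n. (\<Sum>i=1..N. cmod (if i < j then w n ^ (j - i) else 0) * L1_seminorm b (A i f)) + cmod (w n) ^ j * Q)"
    have le: "L1_seminorm b (\<lambda>x. w n ^ j * u n x - B x) \<le> E n" if n: "\<epsilon> n < d" for n
    proof -
      have Hn: "H (z0 + w n) f \<in> L2_loc" using Hloc w(3)[of n] by blast
      have meas: "(\<lambda>x. w n ^ j * u n x - B x) \<in> borel_measurable borel"
        by (intro L2_locD(1) L2_loc_diff L2_loc_mult L2_subset_L2_loc u Bloc)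
      have loc2: "(\<lambda>x. \<Sum>i=1..N. S n i x) \<in> L2_loc" by (rule L1_seminorm_sum(1)) (use Sloc in auto)
      have "L1_seminorm b (\<lambda>x. w n ^ j * u n x - B x) = L1_seminorm b (\<lambda>x. (\<Sum>i=1..N. S n i x) + w n ^ j * H (z0 + w n) f x)"
        by (rule L1_seminorm_cong_AE[OF meas L2_locD(1)[OF L2_loc_add[OF loc2 L2_loc_mult[OF Hn]]] ae])
      also have "\<dots> \<le> L1_seminorm b (\<lambda>x. \<Sum>i=1..N. S n i x) + L1_seminorm b (\<lambda>x. w n ^ j * H (z0 + w n) f x)"
        by (rule L1_seminorm_add[OF loc2 L2_loc_mult[OF Hn]])
      also have "\<dots> \<le> (\<Sum>i=1..N. L1_seminorm b (S n i)) + cmod (w n ^ j) * Q"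
        unfolding L1_seminorm_mult
      proof (intro add_mono mult_left_mono L1_seminorm_sum(2))
        show "L1_seminorm b (H (z0 + w n) f) \<le> Q"
          by (rule Q) (use w[of n] n in \<open>auto simp: dist_norm\<close>)
      qed (use Sloc in auto)
      also have "\<dots> = E n" unfolding E_def S_def L1_seminorm_mult by (simp add: norm_power)
      finally show ?thesis .
    qed
    have "E \<longlonglongrightarrow> (\<Sum>i=1..N. cmod 0 * L1_seminorm b (A i f)) + cmod 0 ^ j * Q"
      unfolding E_def
    proof (intro tendsto_intros w0)
      fix i
      have "(\<lambda>n. w n ^ (j - i)) \<longlonglongrightarrow> 0" if "i < j"
        using tendsto_power[OF w0, of "j - i"] that by (simp add: power_0_left)
      then show "(\<lambda>n. if i < j then w n ^ (j - i) else 0) \<longlonglongrightarrow> 0" by (cases "i < j") auto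
    qed
    then have E: "E \<longlonglongrightarrow> 0" using j by (simp add: power_0_left)
    have "(\<lambda>n. L1_seminorm b (\<lambda>x. w n ^ j * u n x - B x)) \<longlonglongrightarrow> 0"
    proof (rule tendsto_sandwich[OF _ _ tendsto_const E])
      show "\<forall>\<^sub>F n in sequentially. L1_seminorm b (\<lambda>x. w n ^ j * u n x - B x) \<le> E n"
        using order_tendstoD(2)[OF \<epsilon>(2) d] by eventually_elim (rule le)
    qed (simp add: L1_seminorm_nonneg)
    then show "(\<lambda>n. L1_seminorm b (\<lambda>x. (\<i> * of_real (\<epsilon> n)) ^ j * u n x - B x)) \<longlonglongrightarrow> 0"
      by (simp add: w_def)
  qed
qed

lemma L2_norm_eq_0:
  assumes "f \<in> L2" "L2_norm f \<le> 0"
  shows "AE x in lborel. f x = 0"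
proof -
  have i: "integrable lborel (\<lambda>x. (cmod (f x))\<^sup>2)" using assms(1) by (simp add: L2_def)
  have "(LINT x|lborel. (cmod (f x))\<^sup>2) \<ge> 0" by (intro integral_nonneg_AE) auto
  with assms(2) have "(LINT x|lborel. (cmod (f x))\<^sup>2) = 0" by (simp add: L2_norm_def)
  then have "AE x in lborel. (cmod (f x))\<^sup>2 = 0"
    by (subst (asm) integral_nonneg_eq_0_iff_AE[OF i]) auto
  then show ?thesis by eventually_elim simp
qed

context regge_wheeler
begin

text \<open>Approaching the real point vertically from above keeps z in the upper half plane, where
  \<open>R z f\<close> is the L^2 resolvent and solves the equation on the whole line.\<close>

lemma laurent_coefficient:
  assumes ext: "meromorphic_resolvent_extension (P_op r a l) R"
    and pp: "laurent_principal_part R (of_real t) N A" and f: "f \<in> L2_comp" and j: "j \<ge> 1"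
    and zero: "\<And>i. i \<in> {1..N} \<Longrightarrow> i > j \<Longrightarrow> AE x in lborel. A i f x = 0"
    and B: "B = (if j \<le> N then A j f else (\<lambda>_. 0))"
  shows "t \<noteq> 0 \<or> l \<ge> 1 \<Longrightarrow> AE x in lborel. B x = 0"
    and "t = 0 \<Longrightarrow> l = 0 \<Longrightarrow> AE x in lborel. B x =
      (if j = 1 then \<i> / of_real (rp\<^sup>2 + rm\<^sup>2) else 0) * of_real (r x) * L2_inner (\<lambda>y. of_real (r y)) f"
proof -
  obtain b where fb: "f \<in> L2_on b" using f by (auto simp: L2_comp_def)
  obtain e where e: "e > 0" and Bloc: "B \<in> L2_loc" and lim:
    "\<And>(\<epsilon> :: nat \<Rightarrow> real) u b. (\<And>n. 0 < \<epsilon> n \<and> \<epsilon> n < e) \<Longrightarrow> \<epsilon> \<longlonglongrightarrow> 0 \<Longrightarrow> (\<And>n. u n \<in> L2) \<Longrightarrow>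
      (\<And>n. AE x in lborel. R (of_real t + \<i> * of_real (\<epsilon> n)) f x = u n x) \<Longrightarrow>
      (\<lambda>n. L1_seminorm b (\<lambda>x. (\<i> * of_real (\<epsilon> n)) ^ j * u n x - B x)) \<longlonglongrightarrow> 0"
    by (rule laurent_limit[OF pp fb j zero B], assumption+) blast
  \<comment> \<open>Positive, at most 1 for \<open>zero_energy_flux\<close>, and below the radius
    \<open>e\<close> of the Laurent expansion.\<close>
  define \<epsilon> where "\<epsilon> = (\<lambda>n. min 1 (e / 2) * inverse (real (Suc n)))"
  have \<epsilon>: "0 < \<epsilon> n" "\<epsilon> n \<le> 1" "\<epsilon> n < e" for n
  proof -
    have "\<epsilon> n \<le> min 1 (e / 2)" unfolding \<epsilon>_def using e by (intro mult_left_le) (auto simp: field_simps)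
    then show "0 < \<epsilon> n" "\<epsilon> n \<le> 1" "\<epsilon> n < e" using e by (auto simp: \<epsilon>_def)
  qed
  have \<epsilon>0: "\<epsilon> \<longlonglongrightarrow> 0" 
    unfolding \<epsilon>_def by (intro tendsto_mult_right_zero LIMSEQ_inverse_real_of_nat)
  define z where "z = (\<lambda>n. of_real t + \<i> * complex_of_real (\<epsilon> n))"
  have "\<exists>u. P_op r a l u (\<lambda>x. f x + (z n)\<^sup>2 * u x) \<and> (AE x in lborel. R (z n) f x = u x)" for n
  proof -
    have "Im (z n) > 0" using \<epsilon> by (simp add: z_def)
    then obtain T where "is_resolvent (P_op r a l) ((z n)\<^sup>2) T" "\<forall>f\<in>L2_comp. AE x in lborel. R (z n) f x = T f x"
      using ext unfolding meromorphic_resolvent_extension_def by blast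
    then show ?thesis using f L2_onD(1)[OF fb] unfolding is_resolvent_def by blast
  qed
  then obtain u where u: "\<And>n. P_op r a l (u n) (\<lambda>x. f x + (z n)\<^sup>2 * u n x)" "\<And>n. AE x in lborel. R (z n) f x = u n x"
    by metis
  have uL2: "u n \<in> L2" for n using u(1)[of n] by (simp add: P_op_def)
  note res = resolvent_limit[OF fb j \<epsilon>(1,2) \<epsilon>0 uL2 u(1)[unfolded z_def] Bloc lim[OF conjI[OF \<epsilon>(1,3)] \<epsilon>0 uL2 u(2)[unfolded z_def]]]
  show "AE x in lborel. B x = 0" if "t \<noteq> 0 \<or> l \<ge> 1" by (rule res(1)[OF that])
  show "AE x in lborel. B x = (if j = 1 then \<i> / of_real (rp\<^sup>2 + rm\<^sup>2) else 0) * of_real (r x) * L2_inner (\<lambda>y. of_real (r y)) f"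
    if "t = 0" "l = 0" by (rule res(2)[OF that])
qed

text \<open>Descending induction from \<open>N\<close>: the coefficient of index i is a limit of the
  rescaled resolvent only after all higher ones are known to vanish. In the exceptional case t = 0,
  l = 0 it reaches down to index 2.\<close>

lemma laurent_coefficients_vanish:
  assumes ext: "meromorphic_resolvent_extension (P_op r a l) R"
    and pp: "laurent_principal_part R (of_real t) N A" and f: "f \<in> L2_comp"
    and i: "i \<in> {1..N}" and cond: "t \<noteq> 0 \<or> l \<ge> 1 \<or> i \<ge> 2"
  shows "AE x in lborel. A i f x = 0"
  using i cond
proof (induction "N - i" arbitrary: i rule: less_induct)
  case less
  have zero: "AE x in lborel. A k f x = 0" if "k \<in> {1..N}" "k > i" for k
    using less that by auto
  have i: "i \<ge> 1" "i \<le> N" using less.prems by auto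
  note c = laurent_coefficient[OF ext pp f i(1) zero refl]
  show ?case
  proof (cases "t \<noteq> 0 \<or> l \<ge> 1")
    case True
    then show ?thesis using c(1) i by simp
  next
    case False
    then show ?thesis using c(2) i less.prems by auto
  qed
qed

text \<open>Here \<open>t\<close> is the spectral value z^2, which may be negative. Then it is the
  square of a point of the upper half plane, where the resolvent excludes an eigenvector; otherwise
  \<open>sqrt t\<close> is a real energy for \<open>no_eigenvalue\<close>.\<close>

lemma no_real_eigenvalue:
  assumes ext: "meromorphic_resolvent_extension (P_op r a l) R"
  shows "\<not> is_eigenvalue (P_op r a l) (of_real t)"
proof
  assume "is_eigenvalue (P_op r a l) (of_real t)"
  then obtain u where P: "P_op r a l u (\<lambda>x. of_real t * u x)" and u: "\<not> (AE x in lborel. u x = 0)"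
    by (auto simp: is_eigenvalue_def)
  show False
  proof (cases "t < 0")
    case True
    define z where "z = \<i> * complex_of_real (sqrt (- t))"
    have z: "Im z > 0" "z\<^sup>2 = of_real t"
      using True by (simp_all add: z_def power_mult_distrib flip: of_real_power)
    then obtain T where T: "is_resolvent (P_op r a l) (z\<^sup>2) T"
      using ext unfolding meromorphic_resolvent_extension_def by blast
    have 0: "(\<lambda>_. 0) \<in> L2" by (simp add: L2_def)
    obtain c where "L2_norm (T (\<lambda>_. 0)) \<le> c * L2_norm (\<lambda>_. 0)"
      using T 0 unfolding is_resolvent_def by blast
    then have "L2_norm (T (\<lambda>_. 0)) \<le> 0" by (simp add: L2_norm_def)
    moreover have "T (\<lambda>_. 0) \<in> L2" using T 0 unfolding is_resolvent_def P_op_def by blast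
    ultimately have 1: "AE x in lborel. T (\<lambda>_. 0) x = 0" by (intro L2_norm_eq_0)
    \<comment> \<open>For an eigenvector the argument of \<open>T\<close> is the zero function,
      which \<open>T\<close> maps to 0 almost everywhere by its norm bound.\<close>
    have 2: "AE x in lborel. T (\<lambda>y. of_real t * u y - z\<^sup>2 * u y) x = u x"
      using T P unfolding is_resolvent_def by blast
    from 1 2[unfolded z(2)] have "AE x in lborel. u x = 0" by eventually_elim simp
    then show False using u by contradiction
  next
    case False
    then have "P_op r a l u (\<lambda>x. 0 + (of_real (sqrt t))\<^sup>2 * u x)" using P by (simp flip: of_real_power)
    then obtain \<phi> K where sol: "weak_sol (of_real (sqrt t)) (\<lambda>_. 0) \<phi> K" and ae: "AE x in lborel. u x = of_real (r x) * \<phi> x"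
      by (rule P_op_weak_sol) auto
    have "u \<in> L2" using P by (simp add: P_op_def)
    then have "\<phi> x = 0" for x
      using no_eigenvalue[OF sol, of u] ae by (simp add: sol_u_def)
    then show False using ae u by simp
  qed
qed

end

section \<open>The Regge-Wheeler coordinate\<close>

text \<open>Factoring \<alpha>^2 through its zeros shows that it vanishes to first order at both
  horizons. Hence \<open>X\<close> diverges logarithmically there and maps onto the whole line, and
  near each horizon the distance to it is comparable with \<alpha>^2.\<close>

lemma regge_wheeler_coordinate:
  fixes M \<Lambda> rm rp :: real and X r a :: "real \<Rightarrow> real"
  assumes M: "M > 0" and \<Lambda>: "\<Lambda> > 0"
    and rm: "0 < rm" and rmp: "rm < rp" and zeros: "alpha M \<Lambda> rm = 0" "alpha M \<Lambda> rp = 0"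
    and X: "\<And>\<rho>. \<rho> \<in> {rm<..<rp} \<Longrightarrow> (X has_real_derivative 1 / (alpha M \<Lambda> \<rho>)\<^sup>2) (at \<rho>)"
    and r_def: "r = the_inv_into {rm<..<rp} X"
    and a_def: "a = (\<lambda>x. alpha M \<Lambda> (r x))"
  shows "\<exists>r1 r2 C. regge_wheeler r r1 r2 a rm rp C l"
proof -
  define F where "F = (\<lambda>\<rho>. 1 - 2 * M / \<rho> - \<Lambda> * \<rho>\<^sup>2 / 3)"
  define F1 where "F1 = (\<lambda>\<rho>. 2 * M / \<rho>\<^sup>2 - 2 * \<Lambda> * \<rho> / 3)"
  have alpha: "alpha M \<Lambda> \<rho> = sqrt (F \<rho>)" for \<rho> by (simp add: alpha_def F_def)
  have F0: "F rm = 0" "F rp = 0" using zeros by (simp_all add: alpha)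
  have rp: "rp > 0" using rm rmp by simp
  \<comment> \<open>The cubic \<open>\<rho> * F \<rho>\<close> has no quadratic term, so its third
    root is - (rm + rp).\<close>
  have factor: "F \<rho> = \<Lambda> / 3 * (\<rho> - rm) * (rp - \<rho>) * ((\<rho> + rm + rp) / \<rho>)" if "\<rho> > 0" for \<rho>
  proof -
    have e1: "rm - 2 * M - \<Lambda> * rm ^ 3 / 3 = 0" and e2: "rp - 2 * M - \<Lambda> * rp ^ 3 / 3 = 0"
      using F0 rm rp by (simp_all add: F_def field_simps power2_eq_square power3_eq_cube)
    have "(rp - rm) * (1 - \<Lambda> / 3 * (rm\<^sup>2 + rm * rp + rp\<^sup>2))
        = (rp - 2 * M - \<Lambda> * rp ^ 3 / 3) - (rm - 2 * M - \<Lambda> * rm ^ 3 / 3)"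
      by (simp add: field_simps power2_eq_square power3_eq_cube)
    then have "(rp - rm) * (1 - \<Lambda> / 3 * (rm\<^sup>2 + rm * rp + rp\<^sup>2)) = 0"
      unfolding e1 e2 by simp
    \<comment> \<open>\<open>s\<close> and \<open>m\<close> are Vieta's relations for the cubic. The
      difference of the equations at the two horizons, divided by \<open>rp - rm\<close>, isolates
      the first.\<close>
    then have s: "\<Lambda> / 3 * (rm\<^sup>2 + rm * rp + rp\<^sup>2) = 1" using rmp by simp
    have m: "2 * M = \<Lambda> / 3 * (rm * rp * (rm + rp))"
    proof -
      have "2 * M = rm * 1 - \<Lambda> * rm ^ 3 / 3" using e1 by simp
      also have "\<dots> = \<Lambda> / 3 * (rm * rp * (rm + rp))"
        unfolding s[symmetric] by (simp add: algebra_simps power2_eq_square power3_eq_cube)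
      finally show ?thesis .
    qed
    have "\<rho> * F \<rho> = \<rho> * 1 - 2 * M - \<Lambda> * \<rho> ^ 3 / 3"
      using that by (simp add: F_def field_simps power2_eq_square power3_eq_cube)
    also have "\<dots> = \<Lambda> / 3 * (\<rho> - rm) * (rp - \<rho>) * (\<rho> + rm + rp)"
      unfolding m s[symmetric] by (simp add: algebra_simps power2_eq_square power3_eq_cube)
    finally show ?thesis using that by (simp add: field_simps)
  qed
  have F_pos: "F \<rho> > 0" if "\<rho> \<in> {rm<..<rp}" for \<rho>
    using that rm rp \<Lambda> by (subst factor) (auto intro!: mult_pos_pos divide_pos_pos)
  have F_deriv: "(F has_real_derivative F1 \<rho>) (at \<rho>)" if "\<rho> > 0" for \<rho>
    unfolding F_def F1_def using that
    by (auto intro!: derivative_eq_intros simp: field_simps power2_eq_square)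
  \<comment> \<open>Bounds what is left of \<open>F\<close> after \<open>rp - \<rho>\<close> or
    \<open>\<rho> - rm\<close> is split off: the other distance is at most \<open>rp - rm\<close>,
    the quotient at most \<open>3 * rp / rm\<close>.\<close>
  define c where "c = \<Lambda> / 3 * (rp - rm) * (3 * rp / rm)"
  have c: "c > 0" using \<Lambda> rm rmp rp by (simp add: c_def)
  have frac: "1 \<le> (\<rho> + rm + rp) / \<rho>" "(\<rho> + rm + rp) / \<rho> \<le> 3 * rp / rm" if "\<rho> \<in> {rm<..<rp}" for \<rho>
    using that rm by (simp, intro frac_le) auto
  have F_le: "F \<rho> \<le> c * (rp - \<rho>)" "F \<rho> \<le> c * (\<rho> - rm)" if \<rho>: "\<rho> \<in> {rm<..<rp}" for \<rho>
  proof -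
    have "F \<rho> = \<Lambda> / 3 * (\<rho> - rm) * (rp - \<rho>) * ((\<rho> + rm + rp) / \<rho>)"
      by (rule factor) (use \<rho> rm in auto)
    also have "\<dots> \<le> \<Lambda> / 3 * (rp - rm) * (rp - \<rho>) * (3 * rp / rm)"
      by (rule mult_mono[OF mult_mono[OF mult_mono]]) (use \<rho> rm \<Lambda> frac(2)[OF \<rho>] in \<open>auto intro!: mult_nonneg_nonneg\<close>)
    finally have "F \<rho> \<le> \<Lambda> / 3 * (rp - rm) * (rp - \<rho>) * (3 * rp / rm)" .
    then show "F \<rho> \<le> c * (rp - \<rho>)" by (simp add: c_def mult_ac)
    have "F \<rho> = \<Lambda> / 3 * (\<rho> - rm) * (rp - \<rho>) * ((\<rho> + rm + rp) / \<rho>)"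
      by (rule factor) (use \<rho> rm in auto)
    also have "\<dots> \<le> \<Lambda> / 3 * (\<rho> - rm) * (rp - rm) * (3 * rp / rm)"
      by (rule mult_mono[OF mult_mono[OF mult_mono]]) (use \<rho> rm \<Lambda> frac(2)[OF \<rho>] in \<open>auto intro!: mult_nonneg_nonneg\<close>)
    finally have "F \<rho> \<le> \<Lambda> / 3 * (\<rho> - rm) * (rp - rm) * (3 * rp / rm)" .
    then show "F \<rho> \<le> c * (\<rho> - rm)" by (simp add: c_def mult_ac)
  qed
  have X': "(X has_real_derivative 1 / F \<rho>) (at \<rho>)" if "\<rho> \<in> {rm<..<rp}" for \<rho>
    using X[OF that] F_pos[OF that] by (simp add: alpha)
  have X_mono: "X s < X t" if "s \<in> {rm<..<rp}" "t \<in> {rm<..<rp}" "s < t" for s t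
  proof (rule DERIV_pos_imp_increasing[OF that(3)])
    fix y assume "s \<le> y" "y \<le> t"
    then have "y \<in> {rm<..<rp}" using that by auto
    then show "\<exists>z. (X has_real_derivative z) (at y) \<and> 0 < z"
      using X' F_pos by (intro exI[of _ "1 / F y"]) auto
  qed
  have inj: "inj_on X {rm<..<rp}"
    by (rule linorder_inj_onI') (use X_mono in force)
  define \<rho>0 where "\<rho>0 = (rm + rp) / 2"
  have \<rho>0: "\<rho>0 \<in> {rm<..<rp}" using rmp by (simp add: \<rho>0_def)
  have X_large: "\<exists>\<rho>\<in>{\<rho>0..<rp}. X \<rho> \<ge> x" for x
  proof -
    \<comment> \<open>Comparison of 1 / F with 1 / (c (rp - \<rho>)) makes \<open>g\<close>
      nondecreasing, so \<open>X\<close> grows at least like - ln (rp - \<rho>) / c. The exponential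
      in \<open>\<rho>\<close> is chosen to reach the level x; the minimum keeps
      \<open>\<rho>\<close> from falling below \<open>\<rho>0\<close>.\<close>
    define g where "g = (\<lambda>\<rho>. X \<rho> + ln (rp - \<rho>) / c)"
    define \<rho> where "\<rho> = rp - min (exp (c * (g \<rho>0 - x))) (rp - \<rho>0)"
    have \<rho>: "\<rho>0 \<le> \<rho>" "\<rho> < rp" using \<rho>0 by (auto simp: \<rho>_def)
    have "g \<rho>0 \<le> g \<rho>"
    proof (rule DERIV_nonneg_imp_nondecreasing[OF \<rho>(1)])
      fix y assume "\<rho>0 \<le> y" "y \<le> \<rho>"
      then have y: "y \<in> {rm<..<rp}" using \<rho> \<rho>0 by auto
      have "((\<lambda>\<rho>. ln (rp - \<rho>)) has_real_derivative - 1 / (rp - y)) (at y)"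
        using y by (auto intro!: derivative_eq_intros)
      from DERIV_add[OF X'[OF y] DERIV_cdivide[OF this, of c]]
      have "(g has_real_derivative 1 / F y - 1 / (c * (rp - y))) (at y)"
        unfolding g_def by (simp add: mult.commute)
      moreover have "0 \<le> 1 / F y - 1 / (c * (rp - y))"
        using F_le(1)[OF y] F_pos[OF y] by (simp add: frac_le)
      ultimately show "\<exists>z. (g has_real_derivative z) (at y) \<and> 0 \<le> z" by blast
    qed
    moreover have "ln (rp - \<rho>) \<le> c * (g \<rho>0 - x)"
    proof -
      have "ln (rp - \<rho>) \<le> ln (exp (c * (g \<rho>0 - x)))"
        using \<rho> by (subst ln_le_cancel_iff) (auto simp: \<rho>_def)
      then show ?thesis by simp
    qed
    then have "ln (rp - \<rho>) / c \<le> g \<rho>0 - x" using c by (simp add: divide_le_eq mult.commute)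
    ultimately have "x \<le> X \<rho>" by (simp add: g_def)
    then show ?thesis using \<rho> by auto
  qed
  have X_small: "\<exists>\<rho>\<in>{rm<..\<rho>0}. X \<rho> \<le> x" for x
  proof -
    define g where "g = (\<lambda>\<rho>. X \<rho> - ln (\<rho> - rm) / c)"
    define \<rho> where "\<rho> = rm + min (exp (c * (x - g \<rho>0))) (\<rho>0 - rm)"
    have \<rho>: "\<rho> \<le> \<rho>0" "rm < \<rho>" using \<rho>0 by (auto simp: \<rho>_def)
    have "g \<rho> \<le> g \<rho>0"
    proof (rule DERIV_nonneg_imp_nondecreasing[OF \<rho>(1)])
      fix y assume "\<rho> \<le> y" "y \<le> \<rho>0"
      then have y: "y \<in> {rm<..<rp}" using \<rho> \<rho>0 by auto
      have "((\<lambda>\<rho>. ln (\<rho> - rm)) has_real_derivative 1 / (y - rm)) (at y)"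
        using y by (auto intro!: derivative_eq_intros)
      from DERIV_diff[OF X'[OF y] DERIV_cdivide[OF this, of c]]
      have "(g has_real_derivative 1 / F y - 1 / (c * (y - rm))) (at y)"
        unfolding g_def by (simp add: mult.commute)
      moreover have "0 \<le> 1 / F y - 1 / (c * (y - rm))"
        using F_le(2)[OF y] F_pos[OF y] by (simp add: frac_le)
      ultimately show "\<exists>z. (g has_real_derivative z) (at y) \<and> 0 \<le> z" by blast
    qed
    moreover have "ln (\<rho> - rm) \<le> c * (x - g \<rho>0)"
    proof -
      have "ln (\<rho> - rm) \<le> ln (exp (c * (x - g \<rho>0)))"
        using \<rho> by (subst ln_le_cancel_iff) (auto simp: \<rho>_def)
      then show ?thesis by simp
    qed
    then have "ln (\<rho> - rm) / c \<le> x - g \<rho>0" using c by (simp add: divide_le_eq mult.commute)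
    ultimately have "X \<rho> \<le> x" by (simp add: g_def)
    then show ?thesis using \<rho> by auto
  qed
  have X_cont: "isCont X \<rho>" if "\<rho> \<in> {rm<..<rp}" for \<rho> using X'[OF that] by (rule DERIV_isCont)
  have surj: "x \<in> X ` {rm<..<rp}" for x
  proof -
    obtain s where s: "s \<in> {rm<..\<rho>0}" "X s \<le> x" using X_small by blast
    obtain t where t: "t \<in> {\<rho>0..<rp}" "X t \<ge> x" using X_large by blast
    have "\<exists>\<rho>. s \<le> \<rho> \<and> \<rho> \<le> t \<and> X \<rho> = x"
      by (rule IVT[of X s x t]) (use s t \<rho>0 in \<open>auto intro!: X_cont\<close>)
    then show ?thesis using s t by auto
  qed
  have r_in: "r x \<in> {rm<..<rp}" for x
    unfolding r_def by (rule the_inv_into_into[OF inj surj order_refl])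
  have Xr: "X (r x) = x" for x
    unfolding r_def by (rule f_the_inv_into_f[OF inj surj])
  have rX: "r (X \<rho>) = \<rho>" if "\<rho> \<in> {rm<..<rp}" for \<rho>
    unfolding r_def by (rule the_inv_into_f_f[OF inj that])
  have r_isCont: "isCont r x" for x
  proof -
    have "isCont r (X (r x))"
    proof (rule isCont_inverse_function2[where f = X and g = r and x = "r x" and a = "(rm + r x) / 2" and b = "(r x + rp) / 2"])
      show "(rm + r x) / 2 < r x" "r x < (r x + rp) / 2" using r_in[of x] by auto
      fix s assume s: "(rm + r x) / 2 \<le> s" "s \<le> (r x + rp) / 2"
      have "rm < (rm + r x) / 2" "(r x + rp) / 2 < rp" using r_in[of x] by auto
      then have "s \<in> {rm<..<rp}" unfolding greaterThanLessThan_iff using s by linarith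
      then show "r (X s) = s" "isCont X s" by (rule rX, rule X_cont)
    qed
    then show ?thesis by (simp add: Xr)
  qed
  define r1 where "r1 = (\<lambda>x. F (r x))"
  define r2 where "r2 = (\<lambda>x. F1 (r x) * F (r x))"
  have r_deriv: "(r has_real_derivative r1 x) (at x)" for x
  proof -
    have "(r has_real_derivative inverse (1 / F (r x))) (at x)"
      by (rule DERIV_inverse_function[where f = X and a = "x - 1" and b = "x + 1"])
         (use X'[OF r_in] F_pos[OF r_in[of x]] Xr r_isCont in auto)
    then show ?thesis by (simp add: r1_def)
  qed
  have r1_deriv: "(r1 has_real_derivative r2 x) (at x)" for x
    unfolding r1_def r2_def using DERIV_chain2[OF F_deriv r_deriv[unfolded r1_def]] r_in[of x] rm
    by simp
  have r_mono: "r x \<le> r y" if "x \<le> y" for x y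
    using X_mono[OF r_in[of y] r_in[of x]] that by (auto simp: Xr not_le[symmetric])
  have lim_top: "(r \<longlongrightarrow> rp) at_top"
  proof (rule order_tendstoI)
    fix y assume "y < rp"
    then have "max y \<rho>0 \<in> {rm<..<rp}" using \<rho>0 by auto
    then obtain s where s: "max y \<rho>0 < s" "s < rp" using dense[of "max y \<rho>0" rp] by auto
    have "y < r x" if "x \<ge> X s" for x
      using r_mono[OF that] rX[of s] s \<rho>0 by auto
    then show "\<forall>\<^sub>F x in at_top. y < r x" by (rule eventually_at_top_linorderI)
  next
    fix y assume "rp < y"
    then show "\<forall>\<^sub>F x in at_top. r x < y"
      by (intro always_eventually) (use r_in in \<open>auto intro: less_trans\<close>)
  qed
  have lim_bot: "(r \<longlongrightarrow> rm) at_bot"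
  proof (rule order_tendstoI)
    fix y assume "rm < y"
    then have "min y \<rho>0 \<in> {rm<..<rp}" using \<rho>0 by auto
    then obtain s where s: "rm < s" "s < min y \<rho>0" using dense[of rm "min y \<rho>0"] by auto
    have "r x < y" if "x \<le> X s" for x
      using r_mono[OF that] rX[of s] s \<rho>0 by auto
    then show "\<forall>\<^sub>F x in at_bot. r x < y" by (rule eventually_at_bot_linorderI)
  next
    fix y assume "y < rm"
    then show "\<forall>\<^sub>F x in at_bot. y < r x"
      by (intro always_eventually) (use r_in in \<open>auto intro: less_trans\<close>)
  qed
  have r1_lim: "(r1 \<longlongrightarrow> 0) at_top" "(r1 \<longlongrightarrow> 0) at_bot"
    using isCont_tendsto_compose[OF DERIV_isCont[OF F_deriv[OF rp]] lim_top]
      isCont_tendsto_compose[OF DERIV_isCont[OF F_deriv[OF rm]] lim_bot]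
    by (simp_all add: r1_def F0)
  define L where "L = real (l * (l + 1))"
  \<comment> \<open>\<open>C1\<close> bounds the coefficient of \<open>r1\<close> in the potential.
    For \<open>C2\<close> and \<open>C3\<close>, monotonicity of \<open>r\<close> bounds the
    distance to the opposite horizon from below by its value at x = 0, and the quotient in
    \<open>factor\<close> is at least 1. The summand 1 of \<open>C\<close> covers
    \<open>r1 x \<le> 1\<close>.\<close>
  define C1 where "C1 = (2 * M / rm\<^sup>2 + 2 * \<Lambda> * rp / 3) / rm + L / rm\<^sup>2"
  define C2 where "C2 = 3 / (\<Lambda> * (r 0 - rm))"
  define C3 where "C3 = 3 / (\<Lambda> * (rp - r 0))"
  define C where "C = 1 + C1 + C2 + C3"
  have pos: "C1 \<ge> 0" "C2 \<ge> 0" "C3 \<ge> 0"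
    using M \<Lambda> rm rp r_in[of 0] by (auto simp: C1_def C2_def C3_def L_def intro!: add_nonneg_nonneg divide_nonneg_nonneg mult_nonneg_nonneg)
  have r1_pos: "r1 x > 0" for x unfolding r1_def by (rule F_pos[OF r_in])
  have "regge_wheeler r r1 r2 a rm rp C l"
  proof
    show "0 < rm" "C > 0" using rm pos by (auto simp: C_def)
    show "rm < r x" "r x < rp" for x using r_in[of x] by auto
    show "(r has_real_derivative r1 x) (at x)" "(r1 has_real_derivative r2 x) (at x)" for x
      by (rule r_deriv, rule r1_deriv)
    show "r1 x \<le> C" for x
    proof -
      have "0 \<le> 2 * M / r x" "0 \<le> \<Lambda> * (r x)\<^sup>2 / 3" using M \<Lambda> r_in[of x] rm by auto
      then have "r1 x \<le> 1" by (simp add: r1_def F_def)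
      then show ?thesis using pos by (simp add: C_def)
    qed
    have a: "a x = sqrt (r1 x)" for x by (simp add: a_def alpha r1_def)
    then show "a x > 0" for x using r1_pos by simp
    have "continuous_on UNIV r1"
      using r1_deriv by (intro continuous_at_imp_continuous_on ballI DERIV_isCont) auto
    then have "continuous_on UNIV (\<lambda>x. sqrt (r1 x))" by (intro continuous_intros)
    then show "continuous_on UNIV a" using a by (simp add: fun_eq_iff[symmetric] cong: continuous_on_cong)
    show "\<bar>r2 x / r x + (a x)\<^sup>2 / (r x)\<^sup>2 * real (l * (l + 1))\<bar> \<le> C * r1 x" for x
    proof -
      have rx: "rm < r x" "r x < rp" "r x > 0" using r_in[of x] rm by auto
      have "r2 x / r x + (a x)\<^sup>2 / (r x)\<^sup>2 * real (l * (l + 1)) = (F1 (r x) / r x + L / (r x)\<^sup>2) * r1 x"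
        using r1_pos[of x] unfolding a L_def by (simp add: r2_def r1_def field_simps)
      also have "\<bar>\<dots>\<bar> = \<bar>F1 (r x) / r x + L / (r x)\<^sup>2\<bar> * r1 x"
        using r1_pos[of x] by (simp add: abs_mult)
      also have "\<dots> \<le> C1 * r1 x"
      proof (rule mult_right_mono)
        have p2: "rm\<^sup>2 \<le> (r x)\<^sup>2" using rx rm by (intro power_mono) auto
        have "\<bar>F1 (r x)\<bar> \<le> \<bar>2 * M / (r x)\<^sup>2\<bar> + \<bar>2 * \<Lambda> * r x / 3\<bar>"
          unfolding F1_def by (rule abs_triangle_ineq4)
        also have "\<dots> = 2 * M / (r x)\<^sup>2 + 2 * \<Lambda> * r x / 3" using M \<Lambda> rx by simp
        also have "\<dots> \<le> 2 * M / rm\<^sup>2 + 2 * \<Lambda> * rp / 3"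
          using M \<Lambda> rx rm p2 by (intro add_mono frac_le divide_right_mono mult_left_mono) auto
        finally have "\<bar>F1 (r x)\<bar> / r x \<le> (2 * M / rm\<^sup>2 + 2 * \<Lambda> * rp / 3) / rm"
          using rx rm by (intro frac_le) auto
        moreover have "L / (r x)\<^sup>2 \<le> L / rm\<^sup>2" using rm p2 by (intro frac_le) (auto simp: L_def)
        moreover have "\<bar>F1 (r x) / r x + L / (r x)\<^sup>2\<bar> \<le> \<bar>F1 (r x)\<bar> / r x + L / (r x)\<^sup>2"
          using abs_triangle_ineq[of "F1 (r x) / r x" "L / (r x)\<^sup>2"] rx by (simp add: L_def abs_mult)
        ultimately show "\<bar>F1 (r x) / r x + L / (r x)\<^sup>2\<bar> \<le> C1" by (simp add: C1_def)
      qed (use r1_pos[of x] in simp)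
      also have "\<dots> \<le> C * r1 x" using r1_pos[of x] pos by (intro mult_right_mono) (auto simp: C_def)
      finally show ?thesis .
    qed
    have r1_ge: "r1 x \<ge> \<Lambda> / 3 * (r x - rm) * (rp - r x)" for x
    proof -
      have "\<Lambda> / 3 * (r x - rm) * (rp - r x) * 1 \<le> \<Lambda> / 3 * (r x - rm) * (rp - r x) * ((r x + rm + rp) / r x)"
        using r_in[of x] \<Lambda> frac(1)[OF r_in[of x]] by (intro mult_left_mono) auto
      then show ?thesis unfolding r1_def using factor[of "r x"] r_in[of x] rm by simp
    qed
    show "rp - r x \<le> C * r1 x" if "x \<ge> 0" for x
    proof -
      have "rp - r x = C2 * (\<Lambda> / 3 * (r 0 - rm) * (rp - r x))"
        using \<Lambda> r_in[of 0] by (simp add: C2_def)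
      also have "\<dots> \<le> C2 * (\<Lambda> / 3 * (r x - rm) * (rp - r x))"
        using \<Lambda> r_mono[OF that] r_in[of x] pos by (intro mult_left_mono mult_right_mono) auto
      also have "\<dots> \<le> C2 * r1 x" using r1_ge pos by (intro mult_left_mono) auto
      also have "\<dots> \<le> C * r1 x" using r1_pos[of x] pos by (intro mult_right_mono) (auto simp: C_def)
      finally show ?thesis .
    qed
    show "r x - rm \<le> C * r1 x" if "x \<le> 0" for x
    proof -
      have "r x - rm = C3 * (\<Lambda> / 3 * (r x - rm) * (rp - r 0))"
        using \<Lambda> r_in[of 0] by (simp add: C3_def)
      also have "\<dots> \<le> C3 * (\<Lambda> / 3 * (r x - rm) * (rp - r x))"
        using \<Lambda> r_mono[OF that] r_in[of x] pos by (intro mult_left_mono) auto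
      also have "\<dots> \<le> C3 * r1 x" using r1_ge pos by (intro mult_left_mono) auto
      also have "\<dots> \<le> C * r1 x" using r1_pos[of x] pos by (intro mult_right_mono) (auto simp: C_def)
      finally show ?thesis .
    qed
  qed (use lim_top lim_bot r1_lim in auto)
  then show ?thesis by blast
qed

section \<open>The rank one residue at zero energy\<close>

lemma L1_seminorm_le_L2_norm:
  assumes f: "f \<in> L2" and m: "m \<ge> 0"
  shows "L1_seminorm m f \<le> (m + 1 / 2) * L2_norm f"
proof -
  define s where "s = L2_norm f"
  have fm[measurable]: "f \<in> borel_measurable borel" using f by (simp add: L2_def)
  have s0: "s \<ge> 0" unfolding s_def L2_norm_def by (auto intro!: integral_nonneg_AE)
  show ?thesis
  proof (cases "s = 0")
    case True
    then have "AE x in lborel. f x = 0" by (intro L2_norm_eq_0 f) (simp add: s_def)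
    then have "L1_seminorm m f = L1_seminorm m (\<lambda>_. 0)" by (intro L1_seminorm_cong_AE) auto
    then show ?thesis using True by (simp add: L1_seminorm_def s_def)
  next
    case False
    then have s: "s > 0" using s0 by simp
    have int: "integrable lborel (\<lambda>x. (cmod (f x))\<^sup>2)" using f by (simp add: L2_def)
    have s2: "(LINT x|lborel. (cmod (f x))\<^sup>2) = s\<^sup>2"
      unfolding s_def L2_norm_def by (subst real_sqrt_pow2) (auto intro!: integral_nonneg_AE)
    have i2: "set_integrable lborel {-m..m} (\<lambda>x. (cmod (f x))\<^sup>2)"
      using L2_subset_L2_loc[OF f] by (simp add: L2_loc_def)
    have i1: "set_integrable lborel {-m..m} (\<lambda>x. s / 2)" by (rule borel_integrable_atLeastAtMost') auto
    have i3: "set_integrable lborel {-m..m} (\<lambda>x. (cmod (f x))\<^sup>2 / (2 * s))" using i2 by simp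
    \<comment> \<open>Integrating |f| \<le> s / 2 + |f|^2 / (2 s) over [-m, m] gives at most m s + s
      / 2; taking s to be the norm of f makes the bound homogeneous, as a continuity estimate
      requires.\<close>
    have "L1_seminorm m f \<le> (LINT x:{-m..m}|lborel. s / 2 + (cmod (f x))\<^sup>2 / (2 * s))"
      unfolding L1_seminorm_def
    proof (intro set_integral_mono set_integral_add(1)[OF i1 i3] set_integrable_norm L2_locD(2) L2_subset_L2_loc f)
      show "cmod (f x) \<le> s / 2 + (cmod (f x))\<^sup>2 / (2 * s)" for x
        using zero_le_power2[of "cmod (f x) - s"] s by (simp add: field_simps power2_eq_square)
    qed
    also have "\<dots> = (LINT x:{-m..m}|lborel. s / 2) + (LINT x:{-m..m}|lborel. (cmod (f x))\<^sup>2 / (2 * s))"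
      by (rule set_integral_add(2)[OF i1 i3])
    also have "(LINT x:{-m..m}|lborel. s / 2) = m * s"
      using m by (simp add: set_lebesgue_integral_def)
    also have "(LINT x:{-m..m}|lborel. (cmod (f x))\<^sup>2 / (2 * s)) = (LINT x:{-m..m}|lborel. (cmod (f x))\<^sup>2) / (2 * s)"
      by (rule set_integral_divide_zero)
    also have "(LINT x:{-m..m}|lborel. (cmod (f x))\<^sup>2) \<le> s\<^sup>2"
      unfolding s2[symmetric] set_lebesgue_integral_def using i2
      by (intro integral_mono int) (auto simp: set_integrable_def indicator_def)
    then have "(LINT x:{-m..m}|lborel. (cmod (f x))\<^sup>2) / (2 * s) \<le> s\<^sup>2 / (2 * s)"
      using s by (intro divide_right_mono) auto
    also have "s\<^sup>2 / (2 * s) = s / 2" using s by (simp add: power2_eq_square)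
    finally show ?thesis by (simp add: s_def[symmetric] algebra_simps)
  qed
qed

text \<open>\<open>r\<close> lies between positive constants, so it belongs to L^2_loc but not to
  L^2. The pairing with it acts on compactly supported functions, where it is bounded by an L^1
  seminorm.\<close>

lemma (in regge_wheeler) rank_one_comp_loc_op:
  "comp_loc_op (\<lambda>f x. c * of_real (r x) * L2_inner (\<lambda>y. of_real (r y)) f)"
proof -
  define I where "I = L2_inner (\<lambda>y. of_real (r y))"
  have rloc: "(\<lambda>x. c * of_real (r x)) \<in> L2_loc"
    unfolding L2_loc_def
    by (auto intro!: borel_integrable_atLeastAtMost' continuous_intros r_cont)
  have loc: "(\<lambda>x. c * of_real (r x) * k) \<in> L2_loc" for k
    using L2_loc_mult[OF rloc, of k] by (simp add: mult.commute)
  have inner: "I f = (LINT y:{-max A 0..max A 0}|lborel. of_real (r y) * f y)" if "f \<in> L2_on A" for f A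
    unfolding I_def using L2_onD[OF that]
    by (intro L2_inner_eq_set_integral) (auto simp: L2_def)
  have int: "integrable lborel (\<lambda>y. cnj (of_real (r y)) * f y)" if f: "f \<in> L2_comp" for f
  proof -
    obtain A where A: "f \<in> L2_on A" using f by (auto simp: L2_comp_def)
    have fL2: "f \<in> L2" using L2_onD[OF A] by simp
    have [measurable]: "f \<in> borel_measurable borel" using fL2 by (simp add: L2_def)
    have "set_integrable lborel {-max A 0..max A 0} (\<lambda>y. of_real (r y) * f y)"
      by (rule set_integrable_continuous_mult[OF _ set_integrable_L2[OF fL2]])
         (auto intro!: continuous_intros r_cont borel_measurable_continuous_onI)
    moreover have "AE y in lborel. indicator {-max A 0..max A 0} y *\<^sub>R (of_real (r y) * f y) = cnj (of_real (r y)) * f y"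
      using L2_onD(2)[OF A] by eventually_elim (auto simp: indicator_def)
    ultimately show ?thesis unfolding set_integrable_def
      by (subst (asm) integrable_cong_AE) auto
  qed
  have lin: "I (\<lambda>y. k * f y + d * g y) = k * I f + d * I g" if "f \<in> L2_comp" "g \<in> L2_comp" for f g k d
  proof -
    have "I (\<lambda>y. k * f y + d * g y) = (LINT y|lborel. k * (cnj (of_real (r y)) * f y) + d * (cnj (of_real (r y)) * g y))"
      unfolding I_def L2_inner_def by (simp add: algebra_simps)
    also have "\<dots> = k * I f + d * I g"
      unfolding I_def L2_inner_def using int[OF that(1)] int[OF that(2)] by simp
    finally show ?thesis .
  qed
  have bound: "L2_seminorm b (\<lambda>x. c * of_real (r x) * I f) \<le> (rp * (max A 0 + 1 / 2)) * L2_seminorm b (\<lambda>x. c * of_real (r x)) * L2_norm f"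
    if f: "f \<in> L2_on A" for f A b
  proof -
    define m where "m = max A 0"
    have fL2: "f \<in> L2" using L2_onD[OF f] by simp
    have rp: "rp \<ge> 0" using r_bounds(2)[of 0] r_pos[of 0] by simp
    have ie: "set_integrable lborel {-m..m} (\<lambda>y. of_real (r y) * f y)"
      using fL2 by (intro set_integrable_continuous_mult[OF _ set_integrable_L2[OF fL2]])
        (auto simp: L2_def intro!: continuous_intros r_cont borel_measurable_continuous_onI)
    have "cmod (I f) \<le> (LINT y:{-m..m}|lborel. cmod (of_real (r y) * f y))"
      unfolding inner[OF f] m_def[symmetric] by (rule set_integral_norm_bound[OF ie])
    also have "\<dots> \<le> (LINT y:{-m..m}|lborel. rp * cmod (f y))"
      by (intro set_integral_mono set_integrable_norm ie set_integrable_mult_right set_integrable_L2 fL2)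
         (use r_bounds(2) r_pos in \<open>auto simp: norm_mult less_imp_le intro!: mult_right_mono\<close>)
    also have "\<dots> = rp * L1_seminorm m f" unfolding L1_seminorm_def by (rule set_integral_mult_right)
    also have "\<dots> \<le> rp * ((m + 1 / 2) * L2_norm f)"
      by (intro mult_left_mono L1_seminorm_le_L2_norm fL2 rp) (simp add: m_def)
    finally have If: "cmod (I f) \<le> rp * ((m + 1 / 2) * L2_norm f)" .
    have "L2_seminorm b (\<lambda>x. c * of_real (r x) * I f) = cmod (I f) * L2_seminorm b (\<lambda>x. c * of_real (r x))"
      by (simp add: L2_seminorm_def norm_mult power_mult_distrib real_sqrt_mult)
    also have "\<dots> \<le> rp * ((m + 1 / 2) * L2_norm f) * L2_seminorm b (\<lambda>x. c * of_real (r x))"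
      by (intro mult_right_mono If)
         (auto simp: L2_seminorm_def set_lebesgue_integral_def intro!: integral_nonneg_AE)
    finally show ?thesis by (simp add: m_def mult_ac)
  qed
  have "\<exists>k. \<forall>f\<in>L2_on A. L2_seminorm b (\<lambda>x. c * of_real (r x) * I f) \<le> k * L2_norm f" for A b
    using bound[of _ A b] by blast
  then show ?thesis
    unfolding comp_loc_op_def I_def[symmetric]
  proof (intro conjI ballI allI AE_I2)
    show "(\<lambda>x. c * of_real (r x) * I f) \<in> L2_loc" for f by (rule loc)
    show "c * of_real (r x) * I (\<lambda>y. k * f y + d * g y) = k * (c * of_real (r x) * I f) + d * (c * of_real (r x) * I g)"
      if "f \<in> L2_comp" "g \<in> L2_comp" for f g k d x
      unfolding lin[OF that] by (simp add: algebra_simps)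
  qed
qed

text \<open>The expansion supplied by meromorphy may have any length \<open>N\<close>. Once its
  coefficients are identified almost everywhere, the same \<open>H\<close> serves an expansion of
  length 1, as a simple pole demands.\<close>

lemma (in regge_wheeler) zero_resonance:
  assumes l: "l = 0" and ext: "meromorphic_resolvent_extension (P_op r a l) R"
  defines "\<gamma> \<equiv> 1 / (rp\<^sup>2 + rm\<^sup>2)"
  shows "\<exists>e>0. \<exists>H. holomorphic_family H (ball 0 e) \<and>
            (\<forall>z\<in>ball 0 e - {0}. \<forall>f\<in>L2_comp. AE x in lborel.
                R z f x = \<i> * of_real \<gamma> / z * of_real (r x) * L2_inner (\<lambda>y. of_real (r y)) f + H z f x)"
    and "is_simple_resonance R 0"
proof -
  define A1 :: fun_op where "A1 = (\<lambda>f x. (\<i> * of_real \<gamma>) * of_real (r x) * L2_inner (\<lambda>y. of_real (r y)) f)"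
  have \<gamma>: "\<gamma> > 0" unfolding \<gamma>_def using rm by (simp add: add_nonneg_pos)
  obtain N A where pp: "laurent_principal_part R 0 N A"
    using ext unfolding meromorphic_resolvent_extension_def meromorphic_family_def by blast
  then have pp0: "laurent_principal_part R (of_real 0) N A" by simp
  obtain e H where e: "e > 0" and H: "holomorphic_family H (ball 0 e)"
    and R: "\<And>z f. z \<in> ball 0 e - {0} \<Longrightarrow> f \<in> L2_comp \<Longrightarrow> AE x in lborel. R z f x = (\<Sum>j=1..N. A j f x / z ^ j) + H z f x"
    using pp unfolding laurent_principal_part_def by auto
  have RA: "AE x in lborel. R z f x = A1 f x / z + H z f x" if z: "z \<in> ball 0 e - {0}" and f: "f \<in> L2_comp" for z f
  proof -
    have higher: "AE x in lborel. \<forall>i\<in>{2..N}. A i f x = 0"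
      by (intro AE_finite_allI laurent_coefficients_vanish[OF ext pp0 f]) auto
    \<comment> \<open>The default 0 treats the case N = 0 uniformly, without first ruling it
      out.\<close>
    define B where "B = (if 1 \<le> N then A 1 f else (\<lambda>_. 0))"
    have "AE x in lborel. B x = (if (1::nat) = 1 then \<i> / of_real (rp\<^sup>2 + rm\<^sup>2) else 0) * of_real (r x) * L2_inner (\<lambda>y. of_real (r y)) f"
      by (rule laurent_coefficient(2)[OF ext pp0 f order_refl _ B_def refl l])
         (rule laurent_coefficients_vanish[OF ext pp0 f], auto)
    then have "AE x in lborel. B x = A1 f x"
      by (simp add: A1_def \<gamma>_def)
    then show ?thesis using higher R[OF z f]
    proof eventually_elim
      case (elim x)
      have "(\<Sum>j=1..N. A j f x / z ^ j) = B x / z"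
      proof (cases "1 \<le> N")
        case True
        then have "(\<Sum>j=1..N. A j f x / z ^ j) = A 1 f x / z ^ 1 + (\<Sum>j=2..N. A j f x / z ^ j)"
          by (subst sum.atLeast_Suc_atMost) (auto simp: numeral_2_eq_2)
        also have "(\<Sum>j=2..N. A j f x / z ^ j) = 0" using elim(2) by (intro sum.neutral) auto
        finally show ?thesis using True by (simp add: B_def)
      qed (simp add: B_def)
      then show ?case using elim(1,3) by simp
    qed
  qed
  show "\<exists>e>0. \<exists>H. holomorphic_family H (ball 0 e) \<and>
            (\<forall>z\<in>ball 0 e - {0}. \<forall>f\<in>L2_comp. AE x in lborel.
                R z f x = \<i> * of_real \<gamma> / z * of_real (r x) * L2_inner (\<lambda>y. of_real (r y)) f + H z f x)"
    using e H RA by (intro exI[of _ e] conjI exI[of _ H]) (auto simp: A1_def)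
  have "laurent_principal_part R 0 1 (\<lambda>_. A1)"
    unfolding laurent_principal_part_def
  proof (intro conjI exI[of _ e] exI[of _ H] ballI)
    show "comp_loc_op A1" unfolding A1_def by (rule rank_one_comp_loc_op)
    show "AE x in lborel. R z f x = (\<Sum>j=1..1. A1 f x / (z - 0) ^ j) + H z f x"
      if "z \<in> ball 0 e - {0}" "f \<in> L2_comp" for z f
      using RA[OF that] by simp
  qed (use e H in auto)
  moreover have "\<exists>f\<in>L2_comp. \<not> (AE x in lborel. A1 f x = 0)"
  proof
    \<comment> \<open>The pairing of \<open>r\<close> with the indicator of [0, 1] is at least
      \<open>rm\<close>, so \<open>A1 f\<close> vanishes nowhere.\<close>
    define f :: "real \<Rightarrow> complex" where "f = indicator {0..1}"
    have fm: "f \<in> borel_measurable borel" by (simp add: f_def)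
    have "(\<lambda>x. (cmod (f x))\<^sup>2) = indicator {0..1}" by (auto simp: f_def indicator_def)
    then have "f \<in> L2" using fm by (simp add: L2_def)
    moreover have f0: "AE x in lborel. x \<notin> {-1..1} \<longrightarrow> f x = 0"
      by (rule AE_I2) (auto simp: f_def indicator_def)
    ultimately have "f \<in> L2_on 1" by (simp add: L2_on_def)
    then show "f \<in> L2_comp" by (auto simp: L2_comp_def)
    have "L2_inner (\<lambda>y. of_real (r y)) f = (LINT y:{0..1}|lborel. of_real (r y))"
      unfolding L2_inner_def set_lebesgue_integral_def
      by (intro Bochner_Integration.integral_cong) (auto simp: f_def indicator_def)
    also have "\<dots> = of_real (LINT y:{0..1}|lborel. r y)" by (rule set_integral_complex_of_real)
    finally have I: "L2_inner (\<lambda>y. of_real (r y)) f = of_real (LINT y:{0..1}|lborel. r y)" .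
    have "(LINT y:{0..1::real}|lborel. rm) \<le> (LINT y:{0..1}|lborel. r y)"
      using r_bounds(1) by (intro set_integral_mono borel_integrable_atLeastAtMost' continuous_intros r_cont) (auto intro: less_imp_le)
    then have "(LINT y:{0..1}|lborel. r y) > 0" using rm by (simp add: set_lebesgue_integral_def)
    then have nz: "A1 f x \<noteq> 0" for x using \<gamma> by (simp add: A1_def I)
    show "\<not> (AE x in lborel. A1 f x = 0)"
    proof
      assume "AE x in lborel. A1 f x = 0"
      then obtain x where "A1 f x = 0" using zero_less_one by (rule AE_real_interval_obtain)
      then show False using nz by blast
    qed
  qed
  ultimately show "is_simple_resonance R 0"
    unfolding is_simple_resonance_def family_pole_of_order_def by auto
qed

theorem proposition1p2:
  fixes M \<Lambda> rm rp :: real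
    and X r a :: "real \<Rightarrow> real"
    and R :: "nat \<Rightarrow> complex \<Rightarrow> fun_op"
  assumes M: "M > 0"
    and Lambda: "0 < 9 * M\<^sup>2 * \<Lambda>" "9 * M\<^sup>2 * \<Lambda> < 1"
    and horizons: "0 < rm" "rm < rp" "{\<rho>. \<rho> > 0 \<and> alpha M \<Lambda> \<rho> = 0} = {rm, rp}"
    and Regge_Wheeler: "\<And>\<rho>. \<rho> \<in> {rm<..<rp} \<Longrightarrow>
          (X has_real_derivative 1 / (alpha M \<Lambda> \<rho>)\<^sup>2) (at \<rho>)"
    and r_def: "r = the_inv_into {rm<..<rp} X"
    and a_def: "a = (\<lambda>x. alpha M \<Lambda> (r x))"
    and R: "\<And>l. meromorphic_resolvent_extension (P_op r a l) (R l)"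
  shows "(\<forall>l\<ge>1. (\<forall>t::real. \<not> is_resonance (R l) (of_real t)) \<and>
                 (\<forall>t::real. \<not> is_eigenvalue (P_op r a l) (of_real t))) \<and>
         (\<forall>t::real. \<not> is_eigenvalue (P_op r a 0) (of_real t)) \<and>
         (\<forall>t::real. t \<noteq> 0 \<longrightarrow> \<not> is_resonance (R 0) (of_real t)) \<and>
         is_simple_resonance (R 0) 0 \<and>
         (\<exists>\<gamma>::real. \<gamma> > 0 \<and>
           (\<exists>e>0. \<exists>H. holomorphic_family H (ball 0 e) \<and>
             (\<forall>z\<in>ball 0 e - {0}. \<forall>f\<in>L2_comp. AE x in lborel.
                R 0 z f x = \<i> * of_real \<gamma> / z * of_real (r x)
                              * L2_inner (\<lambda>y. of_real (r y)) f
                            + H z f x)))"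
proof -
  have "\<Lambda> > 0" using M Lambda(1) by (simp add: zero_less_mult_iff)
  moreover have "alpha M \<Lambda> rm = 0" "alpha M \<Lambda> rp = 0" using horizons(3) by blast+
  \<comment> \<open>The constant \<open>C\<close> depends on \<open>l\<close> through the potential,
    so it is chosen anew for each \<open>l\<close>.\<close>
  ultimately have RW: "\<exists>r1 r2 C. regge_wheeler r r1 r2 a rm rp C l" for l
    using M horizons Regge_Wheeler r_def a_def by (intro regge_wheeler_coordinate)
  have eigen: "\<not> is_eigenvalue (P_op r a l) (of_real t)" for l t
    using RW[of l] regge_wheeler.no_real_eigenvalue[OF _ R] by blast
  \<comment> \<open>A pole comes with a nonzero leading coefficient of index N \<ge> 1, which
    \<open>laurent_coefficients_vanish\<close> excludes.\<close>
  have res: "\<not> is_resonance (R l) (of_real t)" if "t \<noteq> 0 \<or> l \<ge> 1" for l t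
  proof
    assume "is_resonance (R l) (of_real t)"
    then obtain N A f where N: "N \<ge> 1" and pp: "laurent_principal_part (R l) (of_real t) N A"
      and f: "f \<in> L2_comp" "\<not> (AE x in lborel. A N f x = 0)"
      unfolding is_resonance_def family_pole_of_order_def by blast
    obtain r1 r2 C where "regge_wheeler r r1 r2 a rm rp C l" using RW by blast
    from regge_wheeler.laurent_coefficients_vanish[OF this R pp f(1), of N] N that f(2)
    show False by auto
  qed
  obtain r1 r2 C where "regge_wheeler r r1 r2 a rm rp C 0" using RW by blast
  then interpret regge_wheeler r r1 r2 a rm rp C 0 .
  have "1 / (rp\<^sup>2 + rm\<^sup>2) > 0" using horizons by (simp add: add_pos_pos)
  with zero_resonance[OF refl R] show ?thesis using eigen res by blast
qed

end
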